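(* Let $X$ and $Y$ be Banach spaces and let $E$ and $F$ be Banach lattices. For a set $\mathcal{T}$ of operators write $\mathcal{T}'=\{T' : T\in\mathcal{T}\}$ for the set of adjoint operators. The following statements hold. $(i)$ For every $\mathcal{T}\subseteq \mathrm{L}(E,Y)$: $\mathcal{T}\in\mathbf{Mwc}(E,Y)\Longleftrightarrow\mathcal{T}'\in\mathbf{Lwc}(Y',E')$. $(ii)$ For every $\mathcal{T}\subseteq \mathrm{L}(X,F)$: $\mathcal{T}\in\mathbf{Lwc}(X,F)\Longleftrightarrow\mathcal{T}'\in\mathbf{Mwc}(F',X')$. $(i_1)$ For every $\mathcal{T}\subseteq \mathrm{L}(E,Y)$: $\mathcal{T}\in\mathbf{a\text{-}Mwc}(E,Y)\Longleftrightarrow\mathcal{T}'\in\mathbf{a\text{-}Lwc}(Y',E')$. $(ii_1)$ For every $\mathcal{T}\subseteq \mathrm{L}(X,F)$: $\mathcal{T}'\in\mathbf{a\text{-}Mwc}(F',X')\Longrightarrow\mathcal{T}\in\mathbf{a\text{-}Lwc}(X,F)$. $(i_2)$ For every $\mathcal{T}\subseteq \mathrm{L}(E,Y)$: $\mathcal{T}\in\mathbf{l\text{-}Mwc}(E,Y)\Longleftrightarrow\mathcal{T}'\in\mathbf{l\text{-}Lwc}(Y',E')$. $(ii_2)$ For every $\mathcal{T}\subseteq \mathrm{L}(X,F)$: $\mathcal{T}'\in\mathbf{l\text{-}Mwc}(F',X')\Longrightarrow\mathcal{T}\in\mathbf{l\text{-}Lwc}(X,F)$. $(i_3)$ For every $\mathcal{T}\subseteq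 \mathrm{L}(E,F)$: $\mathcal{T}\in\mathbf{o\text{-}Mwc}(E,F)\Longleftrightarrow\mathcal{T}'\in\mathbf{o\text{-}Lwc}(F',E')$. $(ii_3)$ For every $\mathcal{T}\subseteq \mathrm{L}(E,F)$: $\mathcal{T}'\in\mathbf{o\text{-}Mwc}(F',E')\Longrightarrow\mathcal{T}\in\mathbf{o\text{-}Lwc}(E,F)$.
   Context: All vector spaces are real and all operators are linear and bounded. $\mathrm{L}(X,Y)$ is the space of bounded operators from $X$ to $Y$ with the operator norm; $X'$ is the norm dual of $X$; $B_X$ is the closed unit ball of $X$. In a Banach lattice, a sequence $(x_n)$ is disjoint if $|x_n|\wedge|x_m|=0$ for $n\ne m$. A subset $A$ of a Banach lattice $F$ is L-weakly compact (an Lwc set) if every disjoint sequence in its solid hull $\mathrm{sol}(A)=\bigcup_{a\in A}[-|a|,|a|]$ is norm-null. A subset $A$ of a Banach space $X$ is limited if for every weak$^*$-null sequence $(f_n)$ in $X'$ one has $f_n\to 0$ uniformly on $A$. For a set $\mathcal{T}$ of operators, $\mathcal{T}A=\bigcup_{T\in\mathcal{T}}T(A)$. Let $X$ be a Banach space and $F$ a Banach lattice. A (norm) bounded subset $\mathcal{T}$ of $\mathrm{L}(X,F)$ belongs to: - $\mathbf{Lwc}(X,F)$ if $\mathcal{T}A$ is an Lwc set for each bounded $A\subseteq X$; - $\mathbf{a\text{-}Lwc}(X,F)$ if $\mathcal{T}A$ is an Lwc set for each relatively weakly compact $A\subseteq X$; - $\mathbf{l\text{-}Lwc}(X,F)$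 if $\mathcal{T}A$ is an Lwc set for each limited $A\subseteq X$. For Banach lattices $E,F$, a bounded subset $\mathcal{T}$ of $\mathrm{L}(E,F)$ belongs to $\mathbf{o\text{-}Lwc}(E,F)$ if $\mathcal{T}A$ is an Lwc set for each order bounded $A\subseteq E$. Let $E$ be a Banach lattice and $Y$ a Banach space. A bounded subset $\mathcal{T}$ of $\mathrm{L}(E,Y)$ belongs to: - $\mathbf{Mwc}(E,Y)$ if $\sup_{T\in\mathcal{T}}\|Tx_n\|\to 0$ for every disjoint sequence $(x_n)$ in $B_E$; - $\mathbf{a\text{-}Mwc}(E,Y)$ if $\sup_{T\in\mathcal{T}}|f_n(Tx_n)|\to 0$ for every weakly convergent sequence $(f_n)$ in $Y'$ and every disjoint sequence $(x_n)$ in $B_E$; - $\mathbf{l\text{-}Mwc}(E,Y)$ if $\sup_{T\in\mathcal{T}}|f(Tx_n)|\to 0$ for every $f\in Y'$ and every disjoint sequence $(x_n)$ in $B_E$. For Banach lattices $E,F$, a bounded subset $\mathcal{T}$ of $\mathrm{L}(E,F)$ belongs to $\mathbf{o\text{-}Mwc}(E,F)$ if $\sup_{T\in\mathcal{T}}|f_n(Tx_n)|\to 0$ for every order bounded sequence $(f_n)$ in $F'$ and every disjoint sequence $(x_n)$ in $B_E$. In particular, membership in each of these classes includes norm boundedness of the set of operators. *)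

theory Defs
  imports "HOL-Analysis.Analysis" "HOL-Library.Lattice_Algebras"
begin

section \<open>Banach lattices\<close>

class banach_lattice = banach + ordered_real_vector + lattice_ab_group_add_abs +
  assumes norm_mono: "\<bar>x\<bar> \<le> \<bar>y\<bar> \<Longrightarrow> norm x \<le> norm y"

instance real :: banach_lattice
  by standard simp

text \<open>
  The norm dual of \<open>'a\<close> is the library type \<open>'a \<Rightarrow>\<^sub>L real\<close>. An instance declaration
  can constrain the codomain only by a class, not fix it to be \<^typ>\<open>real\<close>. The following
  class says that the type is isometrically order isomorphic to \<^typ>\<open>real\<close>; its only use
  is to make \<open>'a \<Rightarrow>\<^sub>L real\<close> an instance of \<^class>\<open>banach_lattice\<close>.
\<close>

class real_line = banach_lattice +
  assumes real_line_iso: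
    "\<exists>\<phi>::'a \<Rightarrow> real. bij \<phi> \<and> (\<forall>x y. \<phi> (x + y) = \<phi> x + \<phi> y) \<and> (\<forall>r x. \<phi> (r *\<^sub>R x) = r * \<phi> x)
      \<and> (\<forall>x y. x \<le> y \<longleftrightarrow> \<phi> x \<le> \<phi> y) \<and> (\<forall>x. norm x = \<bar>\<phi> x\<bar>)"

instance real :: real_line
  by standard (rule exI[of _ "\<lambda>x. x"], simp add: bij_def)

lemma norm_abs_lattice: "norm \<bar>x\<bar> = norm (x::'a::banach_lattice)"
  by (intro antisym norm_mono) simp_all

lemma norm_mono_nonneg: "0 \<le> x \<Longrightarrow> x \<le> y \<Longrightarrow> norm x \<le> norm (y::'a::banach_lattice)"
  by (rule norm_mono) simp

lemma riesz_decomposition: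
  fixes y :: "'a::lattice_ab_group_add"
  assumes "0 \<le> y" "y \<le> a + b" "0 \<le> a" "0 \<le> b"
  obtains u v where "y = u + v" "0 \<le> u" "u \<le> a" "0 \<le> v" "v \<le> b"
proof
  show "y = inf y a + (y - inf y a)" by (metis add.commute diff_add_cancel)
  show "0 \<le> inf y a" "inf y a \<le> a" using assms by simp_all
  show "0 \<le> y - inf y a" by (simp only: diff_ge_0_iff_ge inf_le1)
  have "y - inf y a = sup 0 (y - a)"
    unfolding diff_inf_eq_sup add_sup_distrib_left by simp
  also have "\<dots> \<le> b" using assms by (simp add: diff_le_eq add.commute)
  finally show "y - inf y a \<le> b" .
qed

section \<open>The order on the dual\<close>

text \<open>The Riesz--Kantorovich formula for the positive part of a functional.\<close>

lemma riesz_kantorovich: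
  fixes h :: "'a::banach_lattice \<Rightarrow> real"
  assumes h: "bounded_linear h"
  shows "\<exists>H. bounded_linear H \<and> (\<forall>x\<ge>0. 0 \<le> H x \<and> h x \<le> H x \<and>
    (\<forall>e>0. \<exists>y. 0 \<le> y \<and> y \<le> x \<and> H x - e < h y))"
proof -
  interpret h: bounded_linear h by fact
  obtain K where K: "0 < K" "\<And>x. norm (h x) \<le> norm x * K"
    using h.pos_bounded by blast
  define p where "p x = (SUP y\<in>{0..x}. h y)" for x
  have hb: "h y \<le> norm x * K" if "0 \<le> y" "y \<le> x" for x y
  proof -
    have "h y \<le> norm y * K" using K(2)[of y] by simp
    also have "\<dots> \<le> norm x * K"
      using that K(1) by (intro mult_right_mono norm_mono_nonneg) auto
    finally show ?thesis .
  qed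
  have bdd: "bdd_above (h ` {0..x})" for x
    by (rule bdd_aboveI[of _ "norm x * K"]) (auto intro: hb)
  have up: "h y \<le> p x" if "0 \<le> y" "y \<le> x" for x y
    unfolding p_def using that by (intro cSUP_upper bdd) auto
  have le: "p x \<le> c" if "0 \<le> x" "\<And>y. 0 \<le> y \<Longrightarrow> y \<le> x \<Longrightarrow> h y \<le> c" for x c
    unfolding p_def using that by (intro cSUP_least) auto
  have approx: "\<exists>y. 0 \<le> y \<and> y \<le> x \<and> p x - e < h y" if "0 \<le> x" "0 < e" for x e
  proof (rule ccontr)
    assume "\<not> ?thesis"
    then have "p x \<le> p x - e" by (intro le that(1)) (auto simp: not_less)
    with that(2) show False by simp
  qed
  have p0: "0 \<le> p x" if "0 \<le> x" for x using up[of 0 x] that by (simp add: h.zero)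
  have pb: "p x \<le> norm x * K" if "0 \<le> x" for x by (rule le[OF that]) (rule hb)
  have padd: "p (a + b) = p a + p b" if ab: "0 \<le> a" "0 \<le> b" for a b
  proof (rule antisym)
    show "p (a + b) \<le> p a + p b"
    proof (rule le)
      fix y assume "0 \<le> y" "y \<le> a + b"
      then obtain u v where "y = u + v" "0 \<le> u" "u \<le> a" "0 \<le> v" "v \<le> b"
        using ab by (rule riesz_decomposition)
      then show "h y \<le> p a + p b" using up[of u a] up[of v b] by (simp add: h.add)
    qed (use ab in simp)
    show "p a + p b \<le> p (a + b)"
    proof (rule field_le_epsilon)
      fix e :: real assume "0 < e"
      then obtain u v where "0 \<le> u" "u \<le> a" "p a - e/2 < h u"
          "0 \<le> v" "v \<le> b" "p b - e/2 < h v"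
        using approx[OF ab(1), of "e/2"] approx[OF ab(2), of "e/2"] by auto
      moreover from this have "h (u + v) \<le> p (a + b)" by (intro up add_mono) auto
      ultimately show "p a + p b \<le> p (a + b) + e" by (simp add: h.add)
    qed
  qed
  have pscale_le: "p (c *\<^sub>R x) \<le> c * p x" if "0 \<le> x" "0 < c" for c x
  proof (rule le)
    show "0 \<le> c *\<^sub>R x" using that by (simp add: scaleR_nonneg_nonneg)
    fix y assume y: "0 \<le> y" "y \<le> c *\<^sub>R x"
    have "inverse c *\<^sub>R y \<le> inverse c *\<^sub>R (c *\<^sub>R x)"
      using y that by (intro scaleR_left_mono) auto
    then have "h (inverse c *\<^sub>R y) \<le> p x"
      using y that by (intro up) (auto simp: scaleR_nonneg_nonneg)
    then show "h y \<le> c * p x" using that by (simp add: h.scaleR field_simps)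
  qed
  have p_zero: "p 0 = 0" using padd[of 0 0] by simp
  have pscale: "p (c *\<^sub>R x) = c * p x" if "0 \<le> x" "0 \<le> c" for c x
  proof (cases "c = 0")
    case False
    then have c: "0 < c" using that by simp
    have "p (inverse c *\<^sub>R (c *\<^sub>R x)) \<le> inverse c * p (c *\<^sub>R x)"
      using that c by (intro pscale_le) (auto simp: scaleR_nonneg_nonneg)
    then have "c * p x \<le> p (c *\<^sub>R x)" using c by (simp add: field_simps)
    with pscale_le[OF that(1) c] show ?thesis by simp
  qed (simp add: p_zero)
  define H where "H x = p (pprt x) - p (- nprt x)" for x
  have Hdiff: "H (u - v) = p u - p v" if uv: "0 \<le> u" "0 \<le> v" for u v
  proof -
    let ?x = "u - v"
    have "pprt ?x + v = u + (- nprt ?x)" using prts[of ?x] by (simp add: algebra_simps)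
    then have "p (pprt ?x) + p v = p u + p (- nprt ?x)"
      using padd[of "pprt ?x" v] padd[of u "- nprt ?x"] uv by simp
    then show ?thesis by (simp add: H_def)
  qed
  have split: "\<exists>u v. 0 \<le> u \<and> 0 \<le> v \<and> x = u - v \<and> u \<le> \<bar>x\<bar> \<and> v \<le> \<bar>x\<bar>" for x :: 'a
    by (rule exI[of _ "pprt x"], rule exI[of _ "- nprt x"])
      (use prts[of x] in \<open>auto simp: abs_prts\<close>)
  have Hpos: "H x = p x" if "0 \<le> x" for x using Hdiff[of x 0] that by (simp add: p_zero)
  show ?thesis
  proof (intro exI[of _ H] conjI allI impI)
    show "bounded_linear H"
    proof (rule bounded_linear_intro[where K = K])
      show "H (x + y) = H x + H y" for x y
      proof -
        obtain a b c d where s: "0 \<le> a" "0 \<le> b" "x = a - b" "0 \<le> c" "0 \<le> d" "y = c - d"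
          using split[of x] split[of y] by metis
        then have "x + y = (a + c) - (b + d)" by simp
        then have "H (x + y) = p (a + c) - p (b + d)"
          by (simp only:) (rule Hdiff; use s in simp)
        moreover have "H x = p a - p b" "H y = p c - p d" using s by (simp_all add: Hdiff)
        ultimately show ?thesis using s by (simp add: padd)
      qed
      have neg: "H (- x) = - H x" for x
      proof -
        obtain a b where s: "0 \<le> a" "0 \<le> b" "x = a - b" using split[of x] by metis
        then show ?thesis using Hdiff[of b a] Hdiff[of a b] by simp
      qed
      have pos: "H (r *\<^sub>R x) = r *\<^sub>R H x" if "0 \<le> r" for r x
      proof -
        obtain a b where s: "0 \<le> a" "0 \<le> b" "x = a - b" using split[of x] by metis
        then have "r *\<^sub>R x = r *\<^sub>R a - r *\<^sub>R b" by (simp add: scaleR_diff_right)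
        then have "H (r *\<^sub>R x) = p (r *\<^sub>R a) - p (r *\<^sub>R b)"
          by (simp only:) (rule Hdiff; use s that in \<open>simp add: scaleR_nonneg_nonneg\<close>)
        moreover have "H x = p a - p b" using s by (simp add: Hdiff)
        ultimately show ?thesis using s that by (simp add: pscale right_diff_distrib)
      qed
      show "H (r *\<^sub>R x) = r *\<^sub>R H x" for r x
      proof (cases "0 \<le> r")
        case False
        then show ?thesis using pos[of "- r" x] neg[of "r *\<^sub>R x"] by simp
      qed (rule pos)
      show "norm (H x) \<le> norm x * K" for x
      proof -
        obtain a b where s: "0 \<le> a" "0 \<le> b" "x = a - b" "a \<le> \<bar>x\<bar>" "b \<le> \<bar>x\<bar>"
          using split[of x] by metis
        have "norm a * K \<le> norm x * K" "norm b * K \<le> norm x * K"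
          using s K(1) norm_mono_nonneg[of _ "\<bar>x\<bar>"]
          by (auto intro!: mult_right_mono simp: norm_abs_lattice)
        then show ?thesis
          using Hdiff[of a b] s pb[of a] pb[of b] p0[of a] p0[of b] by simp
      qed
    qed
    show "0 \<le> H x" "h x \<le> H x" if "0 \<le> x" for x
      using that by (simp_all add: Hpos p0 up)
    show "\<exists>y. 0 \<le> y \<and> y \<le> x \<and> H x - e < h y" if "0 \<le> x" "0 < e" for x e
      using approx[OF that] that by (simp add: Hpos)
  qed
qed

instantiation blinfun :: (banach_lattice, real_line) ordered_real_vector
begin

definition less_eq_blinfun :: "'a \<Rightarrow>\<^sub>L 'b \<Rightarrow> 'a \<Rightarrow>\<^sub>L 'b \<Rightarrow> bool"
  where "less_eq_blinfun f g \<longleftrightarrow> (\<forall>x\<ge>0. blinfun_apply f x \<le> blinfun_apply g x)"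

definition less_blinfun :: "'a \<Rightarrow>\<^sub>L 'b \<Rightarrow> 'a \<Rightarrow>\<^sub>L 'b \<Rightarrow> bool"
  where "less_blinfun f g \<longleftrightarrow> f \<le> g \<and> \<not> g \<le> f"

instance
proof
  fix f g k :: "'a \<Rightarrow>\<^sub>L 'b" and a b :: real
  show "f < g \<longleftrightarrow> f \<le> g \<and> \<not> g \<le> f" by (rule less_blinfun_def)
  show "f \<le> f" by (simp add: less_eq_blinfun_def)
  show "f \<le> g \<Longrightarrow> g \<le> k \<Longrightarrow> f \<le> k" by (force simp: less_eq_blinfun_def)
  show "f \<le> g \<Longrightarrow> g \<le> f \<Longrightarrow> f = g"
  proof (rule blinfun_eqI)
    fix x :: 'a assume "f \<le> g" "g \<le> f"
    then have *: "f y = g y" if "0 \<le> y" for y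
      using that by (intro antisym) (auto simp: less_eq_blinfun_def)
    have x: "x = pprt x - (- nprt x)" using prts[of x] by simp
    show "f x = g x"
      by (subst (1 2) x) (simp only: blinfun.diff_right * zero_le_pprt nprt_le_zero neg_0_le_iff_le)
  qed
  show "f \<le> g \<Longrightarrow> k + f \<le> k + g" by (simp add: less_eq_blinfun_def blinfun.add_left)
  show "f \<le> g \<Longrightarrow> 0 \<le> a \<Longrightarrow> a *\<^sub>R f \<le> a *\<^sub>R g"
    by (simp add: less_eq_blinfun_def blinfun.scaleR_left scaleR_left_mono)
  show "a \<le> b \<Longrightarrow> 0 \<le> f \<Longrightarrow> a *\<^sub>R f \<le> b *\<^sub>R f"
    by (simp add: less_eq_blinfun_def blinfun.scaleR_left scaleR_right_mono)
qed

end

lemma blinfun_pos_part: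
  fixes f :: "'a::banach_lattice \<Rightarrow>\<^sub>L 'b::real_line"
  obtains g where "0 \<le> g" "f \<le> g" "\<And>k. 0 \<le> k \<Longrightarrow> f \<le> k \<Longrightarrow> g \<le> k"
    "\<And>x e. 0 \<le> x \<Longrightarrow> 0 < e \<Longrightarrow> \<exists>y. 0 \<le> y \<and> y \<le> x \<and> norm (g x - f y) < e"
proof -
  obtain \<phi> :: "'b \<Rightarrow> real" where "bij \<phi> \<and> (\<forall>x y. \<phi> (x + y) = \<phi> x + \<phi> y) \<and> (\<forall>r x. \<phi> (r *\<^sub>R x) = r * \<phi> x)
      \<and> (\<forall>x y. x \<le> y \<longleftrightarrow> \<phi> x \<le> \<phi> y) \<and> (\<forall>x. norm x = \<bar>\<phi> x\<bar>)"
    using real_line_iso[where 'a = 'b] by (rule exE)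
  note \<phi> = this
  have bij: "bij \<phi>" using \<phi> by (elim conjE)
  have lin1: "\<phi> (x + y) = \<phi> x + \<phi> y" for x y using \<phi> by (elim conjE allE)
  have lin2: "\<phi> (r *\<^sub>R x) = r * \<phi> x" for r x using \<phi> by (elim conjE allE)
  have ord: "x \<le> y \<longleftrightarrow> \<phi> x \<le> \<phi> y" for x y using \<phi> by (elim conjE allE)
  have nrm: "norm x = \<bar>\<phi> x\<bar>" for x using \<phi> by (elim conjE allE)
  have bl: "bounded_linear \<phi>"
    by (rule bounded_linear_intro[of _ 1]) (simp_all add: lin1 lin2 nrm)
  define \<psi> where "\<psi> = inv \<phi>"
  have inv1: "\<phi> (\<psi> t) = t" and inv2: "\<psi> (\<phi> x) = x" for t x
    using bij by (simp_all add: \<psi>_def bij_is_surj surj_f_inv_f bij_is_inj)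
  have inj: "\<phi> x = \<phi> y \<Longrightarrow> x = y" for x y by (metis inv2)
  have bl': "bounded_linear \<psi>"
    by (rule bounded_linear_intro[of _ 1])
      (auto intro!: inj simp: lin1 lin2 nrm inv1)
  have \<phi>0: "\<phi> 0 = 0" using lin2[of 0 0] by simp
  have diff: "\<phi> (x - y) = \<phi> x - \<phi> y" for x y using lin1[of "x - y" y] by simp
  have "bounded_linear (\<lambda>x. \<phi> (f x))"
    by (rule bounded_linear_compose[OF bl blinfun.bounded_linear_right])
  then have "\<exists>H. bounded_linear H \<and> (\<forall>x\<ge>0. 0 \<le> H x \<and> \<phi> (f x) \<le> H x \<and>
      (\<forall>e>0. \<exists>y. 0 \<le> y \<and> y \<le> x \<and> H x - e < \<phi> (f y)))"
    by (rule riesz_kantorovich)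
  then obtain H where H0: "bounded_linear H \<and> (\<forall>x\<ge>0. 0 \<le> H x \<and> \<phi> (f x) \<le> H x \<and>
      (\<forall>e>0. \<exists>y. 0 \<le> y \<and> y \<le> x \<and> H x - e < \<phi> (f y)))" ..
  have H: "bounded_linear H" using H0 by (rule conjunct1)
  have Hx: "0 \<le> H x \<and> \<phi> (f x) \<le> H x \<and>
      (\<forall>e>0. \<exists>y. 0 \<le> y \<and> y \<le> x \<and> H x - e < \<phi> (f y))" if "0 \<le> x" for x
    using H0[THEN conjunct2, rule_format, OF that] by simp
  note H = H Hx[THEN conjunct1] Hx[THEN conjunct2, THEN conjunct1]
    Hx[THEN conjunct2, THEN conjunct2, rule_format]
  have "bounded_linear (\<lambda>x. \<psi> (H x))" by (rule bounded_linear_compose[OF bl' H(1)])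
  then have g: "blinfun_apply (Blinfun (\<lambda>x. \<psi> (H x))) x = \<psi> (H x)" for x
    by (simp add: bounded_linear_Blinfun_apply)
  show thesis
  proof (rule that[of "Blinfun (\<lambda>x. \<psi> (H x))"])
    show "0 \<le> Blinfun (\<lambda>x. \<psi> (H x))" "f \<le> Blinfun (\<lambda>x. \<psi> (H x))"
      using H(2,3) by (simp_all add: less_eq_blinfun_def g ord inv1 \<phi>0)
    show "Blinfun (\<lambda>x. \<psi> (H x)) \<le> k" if k: "0 \<le> k" "f \<le> k" for k
      unfolding less_eq_blinfun_def g ord inv1
    proof (intro allI impI, rule field_le_epsilon)
      fix x :: 'a and e :: real assume x: "0 \<le> x" "0 < e"
      obtain y where y: "0 \<le> y" "y \<le> x" "H x - e < \<phi> (f y)" using H(4)[OF x] by (elim exE conjE)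
      have "0 \<le> k (x - y)" using k(1) y by (simp add: less_eq_blinfun_def)
      then have "k y \<le> k x" by (simp add: blinfun.diff_right)
      moreover have "f y \<le> k y" using k(2) y by (simp add: less_eq_blinfun_def)
      ultimately have "f y \<le> k x" by (rule order_trans[rotated])
      then show "H x \<le> \<phi> (k x) + e" using y by (simp add: ord)
    qed
    show "\<exists>y. 0 \<le> y \<and> y \<le> x \<and> norm (Blinfun (\<lambda>x. \<psi> (H x)) x - f y) < e"
      if x: "0 \<le> x" "0 < e" for x e
    proof -
      obtain y where y: "0 \<le> y" "y \<le> x" "H x - e < \<phi> (f y)" using H(4)[OF x] by (elim exE conjE)
      interpret H: bounded_linear H by (rule H(1))
      have "\<phi> (f y) \<le> H x" using H(3)[OF y(1)] H(2)[of "x - y"] y(2) by (simp add: H.diff)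
      then show ?thesis using y by (intro exI[of _ y]) (simp add: g nrm diff inv1)
    qed
  qed
qed

lemma blinfun_lub:
  fixes f g :: "'a::banach_lattice \<Rightarrow>\<^sub>L 'b::real_line"
  shows "\<exists>!s. f \<le> s \<and> g \<le> s \<and> (\<forall>k. f \<le> k \<longrightarrow> g \<le> k \<longrightarrow> s \<le> k)"
proof -
  obtain p where p: "0 \<le> p" "f - g \<le> p" "\<And>k. 0 \<le> k \<Longrightarrow> f - g \<le> k \<Longrightarrow> p \<le> k"
    using blinfun_pos_part[of "f - g"] by metis
  have "p + g \<le> k" if "f \<le> k" "g \<le> k" for k
    using p(3)[of "k - g"] that by (simp add: le_diff_eq)
  then have "f \<le> p + g \<and> g \<le> p + g \<and> (\<forall>k. f \<le> k \<longrightarrow> g \<le> k \<longrightarrow> p + g \<le> k)"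
    using p by (simp add: diff_le_eq)
  then show ?thesis by (intro ex_ex1I) (blast, blast intro: antisym)
qed

instantiation blinfun :: (banach_lattice, real_line) lattice_ab_group_add_abs
begin

definition sup_blinfun :: "'a \<Rightarrow>\<^sub>L 'b \<Rightarrow> 'a \<Rightarrow>\<^sub>L 'b \<Rightarrow> 'a \<Rightarrow>\<^sub>L 'b"
  where "sup_blinfun f g = (THE s. f \<le> s \<and> g \<le> s \<and> (\<forall>k. f \<le> k \<longrightarrow> g \<le> k \<longrightarrow> s \<le> k))"

definition inf_blinfun :: "'a \<Rightarrow>\<^sub>L 'b \<Rightarrow> 'a \<Rightarrow>\<^sub>L 'b \<Rightarrow> 'a \<Rightarrow>\<^sub>L 'b"
  where "inf_blinfun f g = - sup (- f) (- g)"

definition abs_blinfun :: "'a \<Rightarrow>\<^sub>L 'b \<Rightarrow> 'a \<Rightarrow>\<^sub>L 'b"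
  where "abs_blinfun f = sup f (- f)"

instance
proof
  fix f g k :: "'a \<Rightarrow>\<^sub>L 'b"
  have *: "u \<le> sup u v \<and> v \<le> sup u v \<and> (\<forall>k. u \<le> k \<longrightarrow> v \<le> k \<longrightarrow> sup u v \<le> k)"
    for u v :: "'a \<Rightarrow>\<^sub>L 'b"
    unfolding sup_blinfun_def by (rule theI'[OF blinfun_lub])
  show "f \<le> sup f g" "g \<le> sup f g" "g \<le> f \<Longrightarrow> k \<le> f \<Longrightarrow> sup g k \<le> f"
    using * by blast+
  show "inf f g \<le> f" "inf f g \<le> g"
    using *[of "- f" "- g"] by (auto simp: inf_blinfun_def minus_le_iff)
  show "f \<le> g \<Longrightarrow> f \<le> k \<Longrightarrow> f \<le> inf g k"
    unfolding inf_blinfun_def using *[of "- g" "- k"] by (subst le_minus_iff) simp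
  show "\<bar>f\<bar> = sup f (- f)" by (rule abs_blinfun_def)
qed

end

instance blinfun :: (banach_lattice, real_line) banach_lattice
proof
  fix f g :: "'a \<Rightarrow>\<^sub>L 'b" assume fg: "\<bar>f\<bar> \<le> \<bar>g\<bar>"
  have le_abs: "norm (f x) \<le> norm (\<bar>f\<bar> \<bar>x\<bar>)" for x
  proof -
    have pos: "f u \<le> \<bar>f\<bar> u" "- (f u) \<le> \<bar>f\<bar> u" if "0 \<le> u" for u
      using that abs_ge_self[of f] abs_ge_minus_self[of f]
      by (auto simp: less_eq_blinfun_def blinfun.minus_left)
    have eq: "\<bar>f\<bar> \<bar>x\<bar> = \<bar>f\<bar> (pprt x) + \<bar>f\<bar> (- nprt x)"
      by (simp add: abs_prts blinfun.add_right[symmetric] blinfun.diff_right[symmetric])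
    have eqf: "f x = f (pprt x) - f (- nprt x)"
      by (simp add: blinfun.diff_right[symmetric] prts[symmetric])
    have "f x \<le> \<bar>f\<bar> \<bar>x\<bar>"
      unfolding eq eqf using add_mono[OF pos(1)[of "pprt x"] pos(2)[of "- nprt x"]] by simp
    moreover have "- f x \<le> \<bar>f\<bar> \<bar>x\<bar>"
      unfolding eq eqf using add_mono[OF pos(2)[of "pprt x"] pos(1)[of "- nprt x"]] by simp
    ultimately have "\<bar>f x\<bar> \<le> \<bar>f\<bar> \<bar>x\<bar>" by (rule abs_leI)
    then show ?thesis by (intro norm_mono) (metis abs_ge_self order_trans)
  qed
  have abs_bound: "norm (\<bar>g\<bar> u) \<le> norm g * norm u" if u: "0 \<le> u" for u
  proof -
    obtain h where h: "0 \<le> h" "g + g \<le> h" "\<And>k. 0 \<le> k \<Longrightarrow> g + g \<le> k \<Longrightarrow> h \<le> k"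
      "\<And>x e. 0 \<le> x \<Longrightarrow> 0 < e \<Longrightarrow> \<exists>y. 0 \<le> y \<and> y \<le> x \<and> norm (h x - (g + g) y) < e"
      using blinfun_pos_part[of "g + g"] by metis
    have "\<bar>g\<bar> + g = sup (g + g) 0" by (simp add: abs_blinfun_def add_sup_distrib_right)
    also have "\<dots> = h" by (rule antisym) (use h in \<open>auto intro: h(3)\<close>)
    finally have gh: "\<bar>g\<bar> = h - g" by (simp add: eq_diff_eq)
    show ?thesis
    proof (rule field_le_epsilon)
      fix e :: real assume "0 < e"
      then obtain y where y: "0 \<le> y" "y \<le> u" "norm (h u - (g + g) y) < e"
        using h(4)[OF u] by blast
      have "y + y - u \<le> u" using add_mono[OF y(2) y(2)] by (simp add: diff_le_eq)
      moreover have "- (y + y - u) \<le> u" using y(1) by (simp add: minus_le_self_iff)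
      ultimately have "\<bar>y + y - u\<bar> \<le> u" by (rule abs_leI)
      then have "norm (y + y - u) \<le> norm u" using u by (intro norm_mono) simp
      then have "norm (g (y + y - u)) \<le> norm g * norm u"
        by (meson mult_left_mono norm_blinfun norm_ge_zero order_trans)
      moreover have "\<bar>g\<bar> u = (h u - (g + g) y) + g (y + y - u)"
        by (simp add: gh blinfun.add_left blinfun.diff_left blinfun.add_right blinfun.diff_right)
      ultimately show "norm (\<bar>g\<bar> u) \<le> norm g * norm u + e"
        using y(3) norm_triangle_ineq[of "h u - (g + g) y" "g (y + y - u)"] by simp
    qed
  qed
  show "norm f \<le> norm g"
  proof (rule norm_blinfun_bound)
    fix x
    have "norm (\<bar>f\<bar> \<bar>x\<bar>) \<le> norm (\<bar>g\<bar> \<bar>x\<bar>)"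
    proof (rule norm_mono_nonneg)
      show "0 \<le> \<bar>f\<bar> \<bar>x\<bar>" "\<bar>f\<bar> \<bar>x\<bar> \<le> \<bar>g\<bar> \<bar>x\<bar>"
        using fg abs_ge_zero[of f] by (auto simp: less_eq_blinfun_def)
    qed
    then show "norm (f x) \<le> norm g * norm x"
      using le_abs[of x] abs_bound[of "\<bar>x\<bar>"] by (simp add: norm_abs_lattice)
  qed simp
qed

section \<open>Adjoint operators and weak convergence\<close>

definition adjoint_op :: "('a::real_normed_vector \<Rightarrow>\<^sub>L 'b::real_normed_vector) \<Rightarrow> ('b \<Rightarrow>\<^sub>L real) \<Rightarrow>\<^sub>L ('a \<Rightarrow>\<^sub>L real)"
  where "adjoint_op T = Blinfun (\<lambda>f. f o\<^sub>L T)"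

lemma adjoint_op_apply: "blinfun_apply (adjoint_op T) f = f o\<^sub>L T"
proof -
  have "bounded_linear (\<lambda>f :: _ \<Rightarrow>\<^sub>L real. f o\<^sub>L T)"
    by (rule bounded_bilinear.bounded_linear_left[OF bounded_bilinear_blinfun_compose])
  then show ?thesis unfolding adjoint_op_def by (simp add: bounded_linear_Blinfun_apply)
qed

text \<open>The initial topology of the evaluations \<open>x \<mapsto> f x\<close>, with \<open>f\<close> in the norm dual.\<close>

definition weak_topology :: "'a::real_normed_vector topology"
  where "weak_topology =
    pullback_topology UNIV (\<lambda>x (f::'a \<Rightarrow>\<^sub>L real). blinfun_apply f x) euclidean"

lemma topspace_weak_topology: "topspace weak_topology = UNIV"
  by (simp add: weak_topology_def topspace_pullback_topology)

lemma limitin_weak_topology: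
  fixes x :: "nat \<Rightarrow> 'a::real_normed_vector"
  shows "limitin weak_topology x l sequentially \<longleftrightarrow>
    (\<forall>f::'a \<Rightarrow>\<^sub>L real. (\<lambda>n. f (x n)) \<longlonglongrightarrow> f l)"
proof -
  let ?e = "\<lambda>x (f::'a \<Rightarrow>\<^sub>L real). blinfun_apply f x"
  have "limitin weak_topology x l sequentially \<longleftrightarrow> (\<lambda>n. ?e (x n)) \<longlonglongrightarrow> ?e l"
    unfolding limitin_def topspace_weak_topology
    by (auto simp: weak_topology_def openin_pullback_topology tendsto_def)
  also have "\<dots> \<longleftrightarrow> (\<forall>f::'a \<Rightarrow>\<^sub>L real. (\<lambda>n. f (x n)) \<longlonglongrightarrow> f l)"
    using limitin_componentwise[of "\<lambda>_. euclidean" UNIV "\<lambda>n. ?e (x n)" "?e l" sequentially]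
    by (simp add: euclidean_product_topology)
  finally show ?thesis .
qed

definition weakly_convergent :: "(nat \<Rightarrow> 'a::real_normed_vector) \<Rightarrow> bool"
  where "weakly_convergent x \<longleftrightarrow> (\<exists>l. limitin weak_topology x l sequentially)"

definition relatively_weakly_compact :: "'a::real_normed_vector set \<Rightarrow> bool"
  where "relatively_weakly_compact A \<longleftrightarrow> compactin weak_topology (weak_topology closure_of A)"

definition weak_star_null :: "(nat \<Rightarrow> 'a::real_normed_vector \<Rightarrow>\<^sub>L real) \<Rightarrow> bool"
  where "weak_star_null f \<longleftrightarrow> (\<forall>x. (\<lambda>n. f n x) \<longlonglongrightarrow> 0)"

definition limited_set :: "'a::real_normed_vector set \<Rightarrow> bool"
  where "limited_set A \<longleftrightarrow> (\<forall>f. weak_star_null f \<longrightarrow>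
    uniform_limit A (\<lambda>n x. blinfun_apply (f n) x) (\<lambda>x. 0) sequentially)"

section \<open>L-weakly compact sets\<close>

definition disjoint_seq :: "(nat \<Rightarrow> 'a::banach_lattice) \<Rightarrow> bool"
  where "disjoint_seq x \<longleftrightarrow> (\<forall>m n. m \<noteq> n \<longrightarrow> inf \<bar>x n\<bar> \<bar>x m\<bar> = 0)"

definition solid_hull :: "'a::banach_lattice set \<Rightarrow> 'a set"
  where "solid_hull A = (\<Union>a\<in>A. {- \<bar>a\<bar>..\<bar>a\<bar>})"

definition Lwc_set :: "'a::banach_lattice set \<Rightarrow> bool"
  where "Lwc_set A \<longleftrightarrow> (\<forall>x. disjoint_seq x \<longrightarrow> range x \<subseteq> solid_hull A \<longrightarrow> x \<longlonglongrightarrow> 0)"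

definition order_bounded :: "'a::order set \<Rightarrow> bool"
  where "order_bounded A \<longleftrightarrow> (\<exists>a b. A \<subseteq> {a..b})"

definition op_image :: "('a::real_normed_vector \<Rightarrow>\<^sub>L 'b::real_normed_vector) set \<Rightarrow> 'a set \<Rightarrow> 'b set"
  where "op_image \<T> A = (\<Union>T\<in>\<T>. blinfun_apply T ` A)"

section \<open>Classes of sets of operators\<close>

definition Lwc :: "('x::banach \<Rightarrow>\<^sub>L 'f::banach_lattice) set set"
  where "Lwc = {\<T>. bounded \<T> \<and> (\<forall>A. bounded A \<longrightarrow> Lwc_set (op_image \<T> A))}"

definition a_Lwc :: "('x::banach \<Rightarrow>\<^sub>L 'f::banach_lattice) set set"
  where "a_Lwc = {\<T>. bounded \<T> \<and>
    (\<forall>A. relatively_weakly_compact A \<longrightarrow> Lwc_set (op_image \<T> A))}"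

definition l_Lwc :: "('x::banach \<Rightarrow>\<^sub>L 'f::banach_lattice) set set"
  where "l_Lwc = {\<T>. bounded \<T> \<and> (\<forall>A. limited_set A \<longrightarrow> Lwc_set (op_image \<T> A))}"

definition o_Lwc :: "('e::banach_lattice \<Rightarrow>\<^sub>L 'f::banach_lattice) set set"
  where "o_Lwc = {\<T>. bounded \<T> \<and> (\<forall>A. order_bounded A \<longrightarrow> Lwc_set (op_image \<T> A))}"

text \<open>The suprema below are taken in \<^typ>\<open>ennreal\<close>, so that they are \<open>0\<close> for \<open>\<T> = {}\<close>;
  the supremum of the empty set is unspecified in \<^typ>\<open>real\<close>.\<close>

definition Mwc :: "('e::banach_lattice \<Rightarrow>\<^sub>L 'y::banach) set set"
  where "Mwc = {\<T>. bounded \<T> \<and>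
    (\<forall>x. disjoint_seq x \<longrightarrow> range x \<subseteq> cball 0 1 \<longrightarrow>
      (\<lambda>n. SUP T\<in>\<T>. ennreal (norm (blinfun_apply T (x n)))) \<longlonglongrightarrow> 0)}"

definition a_Mwc :: "('e::banach_lattice \<Rightarrow>\<^sub>L 'y::banach) set set"
  where "a_Mwc = {\<T>. bounded \<T> \<and>
    (\<forall>(f :: nat \<Rightarrow> 'y \<Rightarrow>\<^sub>L real) x. weakly_convergent f \<longrightarrow> disjoint_seq x \<longrightarrow> range x \<subseteq> cball 0 1 \<longrightarrow>
      (\<lambda>n. SUP T\<in>\<T>. ennreal \<bar>blinfun_apply (f n) (blinfun_apply T (x n))\<bar>) \<longlonglongrightarrow> 0)}"

definition l_Mwc :: "('e::banach_lattice \<Rightarrow>\<^sub>L 'y::banach) set set"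
  where "l_Mwc = {\<T>. bounded \<T> \<and>
    (\<forall>(f :: 'y \<Rightarrow>\<^sub>L real) x. disjoint_seq x \<longrightarrow> range x \<subseteq> cball 0 1 \<longrightarrow>
      (\<lambda>n. SUP T\<in>\<T>. ennreal \<bar>blinfun_apply f (blinfun_apply T (x n))\<bar>) \<longlonglongrightarrow> 0)}"

definition o_Mwc :: "('e::banach_lattice \<Rightarrow>\<^sub>L 'f::banach_lattice) set set"
  where "o_Mwc = {\<T>. bounded \<T> \<and>
    (\<forall>(f :: nat \<Rightarrow> 'f \<Rightarrow>\<^sub>L real) x. order_bounded (range f) \<longrightarrow> disjoint_seq x \<longrightarrow> range x \<subseteq> cball 0 1 \<longrightarrow>
      (\<lambda>n. SUP T\<in>\<T>. ennreal \<bar>blinfun_apply (f n) (blinfun_apply T (x n))\<bar>) \<longlonglongrightarrow> 0)}"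

end

theory Submission
  imports Defs
begin

text \<open>
  Everything rests on two dual descriptions of bounded L-weakly compact sets: a bounded set
  \<open>A\<close> in \<open>E\<close> is L-weakly compact iff every disjoint sequence in the unit ball of \<open>E'\<close> tends to \<open>0\<close>
  uniformly on \<open>A\<close>, and a bounded set in \<open>E'\<close> is L-weakly compact iff every disjoint sequence in
  the unit ball of \<open>E\<close> tends to \<open>0\<close> uniformly on it. Applied to \<open>\<T>'A\<close> and \<open>\<T>A\<close> they turn each claim
  into one about \<open>f (T x\<^sub>n)\<close>, uniformly in \<open>T \<in> \<T>\<close> and \<open>f \<in> A\<close>. A failure of uniformity picks sequences
  \<open>f\<^sub>n\<close> and \<open>T\<^sub>n\<close>: for weakly compact \<open>A\<close> one passes to a weakly convergent subsequence
  (Eberlein), and for limited \<open>A\<close> the sequence \<open>T\<^sub>n x\<^sub>n\<close> is weak* null in the bidual.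

  In both descriptions one direction replaces functionals \<open>f\<^sub>n\<close> by their components in the bands of
  disjoint elements \<open>x\<^sub>n\<close>. The other is one statement about a monotone seminorm \<open>\<rho>\<close> that is null on
  the disjoint sequences of a bounded solid set \<open>S\<close>, with \<open>\<rho> x = \<parallel>x\<parallel>\<close> in the first case and
  \<open>\<rho> x = sup {\<bar>f\<bar> x | f \<in> A}\<close>, \<open>S\<close> the unit ball, in the second.
\<close>

section \<open>Linear functionals on normed spaces\<close>

text \<open>Components are therefore taken of functionals, where the required suprema are suprema of
  real numbers, and suprema of elements are replaced by finite ones that are Cauchy for
  \<open>\<rho>\<close>. Nullity on disjoint sequences yields this Cauchy property inside an order
  interval \<open>{0..u}\<close> on which \<open>\<rho>\<close> is null along disjoint sequences.
  The set \<open>S\<close> need not be order bounded, but up to any given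
  \<open>\<rho>\<close>-error it lies below a single such \<open>u\<close>, so that only the values
  of the functionals at \<open>u\<close> remain to be studied.

  The statements about operators defined on \<open>E\<close> are equivalences because both sides
  test functionals from the same space \<open>Y'\<close>. For operators into \<open>F\<close>, the
  condition on the adjoints tests sequences of the bidual of \<open>X\<close>, the condition on
  \<open>\<T>\<close> only elements of \<open>X\<close>; this gives an implication. With all bounded
  sets as test sets the difference disappears, since the norm of \<open>f \<circ> T\<close> is
  already determined on \<open>X\<close>.\<close>

definition sublinear :: "('a::real_vector \<Rightarrow> real) \<Rightarrow> bool"
  where "sublinear p \<longleftrightarrow> (\<forall>x y. p (x + y) \<le> p x + p y) \<and> (\<forall>r x. 0 \<le> r \<longrightarrow> p (r *\<^sub>R x) = r * p x)"

text \<open>Homogeneity needs one inequality for positive \<open>r\<close>: applied with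
  \<open>inverse r\<close> at \<open>r *\<^sub>R x\<close> it yields the reverse one.\<close>

lemma sublinearI:
  assumes "\<And>x y. p (x + y) \<le> p x + p y" "p 0 = 0" "\<And>r x. 0 < r \<Longrightarrow> p (r *\<^sub>R x) \<le> r * p x"
  shows "sublinear p"
  unfolding sublinear_def
proof (intro conjI allI impI)
  fix r :: real and x assume "0 \<le> r"
  show "p (r *\<^sub>R x) = r * p x"
  proof (cases "r = 0")
    case False
    then have "0 < r" using \<open>0 \<le> r\<close> by simp
    then have "p x \<le> inverse r * p (r *\<^sub>R x)"
      using assms(3)[of "inverse r" "r *\<^sub>R x"] by simp
    then have "r * p x \<le> p (r *\<^sub>R x)" using \<open>0 < r\<close> by (simp add: field_simps)
    then show ?thesis using assms(3)[OF \<open>0 < r\<close>] by (simp add: antisym)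
  qed (simp add: assms(2))
qed (rule assms(1))

lemma sublinear_add: "sublinear p \<Longrightarrow> p (x + y) \<le> p x + p y"
  and sublinear_scale: "sublinear p \<Longrightarrow> 0 \<le> r \<Longrightarrow> p (r *\<^sub>R x) = r * p x"
  by (auto simp: sublinear_def)

lemma sublinear_zero: "sublinear p \<Longrightarrow> p 0 = 0"
  using sublinear_scale[of p 0 0] by simp

lemma sublinear_minus_ge: "sublinear p \<Longrightarrow> - p (- x) \<le> p x"
  using sublinear_add[of p x "- x"] sublinear_zero[of p] by simp

lemma le_cINF_add_cINF:
  fixes f :: "'i \<Rightarrow> real" and g :: "'j \<Rightarrow> real"
  assumes "I \<noteq> {}" "J \<noteq> {}" "\<And>i j. i \<in> I \<Longrightarrow> j \<in> J \<Longrightarrow> c \<le> f i + g j"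
  shows "c \<le> (INF i\<in>I. f i) + (INF j\<in>J. g j)"
proof -
  have "c - (INF i\<in>I. f i) \<le> (INF j\<in>J. g j)"
  proof (rule cINF_greatest[OF assms(2)])
    fix j assume "j \<in> J"
    then have "c - g j \<le> (INF i\<in>I. f i)"
      using assms(3) by (intro cINF_greatest[OF assms(1)]) (simp add: diff_le_eq)
    then show "c - (INF i\<in>I. f i) \<le> g j" by simp
  qed
  then show ?thesis by simp
qed

text \<open>Subadditivity gives \<open>q x \<le> q (x + t *\<^sub>R v) + t * q (- v)\<close>, so
  every sublinear minorant of \<open>p\<close> with value at most \<open>- p v\<close> at
  \<open>- v\<close> lies below the infimum over \<open>t \<ge> 0\<close> used here. That infimum is
  itself sublinear, hence the largest such minorant.\<close>

lemma sublinear_tilt: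
  assumes p: "sublinear (p :: 'a::real_vector \<Rightarrow> real)"
  obtains q where "sublinear q" "q \<le> p" "q (- v) \<le> - p v"
proof
  define q where "q x = (INF t\<in>{0..}. p (x + t *\<^sub>R v) - t * p v)" for x
  have bdd: "bdd_below ((\<lambda>t. p (x + t *\<^sub>R v) - t * p v) ` {0..})" for x
  proof (rule bdd_belowI2[of _ "- p (- x)"])
    fix t :: real assume "t \<in> {0..}"
    then show "- p (- x) \<le> p (x + t *\<^sub>R v) - t * p v"
      using sublinear_add[OF p, of "x + t *\<^sub>R v" "- x"] by (simp add: sublinear_scale[OF p])
  qed
  have lower: "q x \<le> p (x + t *\<^sub>R v) - t * p v" if "0 \<le> t" for x t
    unfolding q_def by (rule cINF_lower[OF bdd]) (use that in simp)
  show "sublinear q"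
  proof (rule sublinearI)
    fix x y
    show "q (x + y) \<le> q x + q y"
      unfolding q_def[of x] q_def[of y]
    proof (rule le_cINF_add_cINF)
      fix s t :: real assume "s \<in> {0..}" "t \<in> {0..}"
      then have "q (x + y) \<le> p ((x + y) + (s + t) *\<^sub>R v) - (s + t) * p v" by (intro lower) simp
      also have "(x + y) + (s + t) *\<^sub>R v = (x + s *\<^sub>R v) + (y + t *\<^sub>R v)"
        by (simp add: scaleR_add_left)
      finally show "q (x + y) \<le> (p (x + s *\<^sub>R v) - s * p v) + (p (y + t *\<^sub>R v) - t * p v)"
        using sublinear_add[OF p, of "x + s *\<^sub>R v" "y + t *\<^sub>R v"] by (simp add: distrib_right)
    qed auto
  next
    have "0 \<le> q 0" unfolding q_def
      by (rule cINF_greatest) (auto simp: sublinear_scale[OF p])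
    then show "q 0 = 0" using lower[of 0 0] by (simp add: sublinear_zero[OF p])
  next
    fix r :: real and x assume r: "0 < r"
    have "inverse r * q (r *\<^sub>R x) \<le> q x"
      unfolding q_def[of x]
    proof (rule cINF_greatest)
      fix t :: real assume t: "t \<in> {0..}"
      have "q (r *\<^sub>R x) \<le> p (r *\<^sub>R x + (r * t) *\<^sub>R v) - (r * t) * p v"
        using t r by (intro lower) simp
      also have "r *\<^sub>R x + (r * t) *\<^sub>R v = r *\<^sub>R (x + t *\<^sub>R v)" by (simp add: scaleR_add_right)
      also have "p \<dots> = r * p (x + t *\<^sub>R v)" using r by (intro sublinear_scale[OF p]) simp
      finally show "inverse r * q (r *\<^sub>R x) \<le> p (x + t *\<^sub>R v) - t * p v"
        using r by (simp add: field_simps)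
    qed simp
    then show "q (r *\<^sub>R x) \<le> r * q x" using r by (simp add: field_simps)
  qed
  show "q \<le> p" using lower[of 0] by (auto simp: le_fun_def)
  show "q (- v) \<le> - p v" using lower[of 1 "- v"] by (simp add: sublinear_zero[OF p])
qed

text \<open>A minimal sublinear functional is linear, since tilting it in any direction does not change it.\<close>

lemma hahn_banach:
  fixes p :: "'a::real_vector \<Rightarrow> real"
  assumes p: "sublinear p"
  obtains f where "linear f" "\<And>x. f x \<le> p x" "f u = p u"
proof -
  \<comment> \<open>Tilting along \<open>u\<close> first forces every linear functional below
    \<open>p'\<close> to take the value \<open>p u\<close> at \<open>u\<close>.\<close>
  obtain p' where p': "sublinear p'" "p' \<le> p" "p' (- u) \<le> - p u"
    using sublinear_tilt[OF p] by metis
  define A where "A = {q. sublinear q \<and> q \<le> p'}"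
  have "\<exists>m\<in>A. \<forall>a\<in>A. a \<le> m \<longrightarrow> a = m"
  proof (rule predicate_Zorn)
    show "partial_order_on A (relation_of (\<lambda>a b. b \<le> a) A)"
      by (rule partial_order_on_relation_ofI) auto
    fix C assume C: "C \<in> Chains (relation_of (\<lambda>a b. b \<le> a) A)"
    have CA: "C \<subseteq> A" using C by (auto simp: Chains_def relation_of_def)
    have tot: "a \<le> b \<or> b \<le> a" if "a \<in> C" "b \<in> C" for a b
      using C that by (auto simp: Chains_def relation_of_def)
    show "\<exists>l\<in>A. \<forall>a\<in>C. l \<le> a"
    proof (cases "C = {}")
      case True
      then show ?thesis using p' by (auto simp: A_def)
    next
      case False
      define l where "l x = (INF a\<in>C. a x)" for x
      have sub: "sublinear a" if "a \<in> C" for a using that CA by (auto simp: A_def)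
      have le: "a x \<le> p' x" if "a \<in> C" for a x using that CA by (auto simp: A_def le_fun_def)
      have bdd: "bdd_below ((\<lambda>a. a x) ` C)" for x
      proof (rule bdd_belowI2[of _ "- p' (- x)"])
        fix a assume "a \<in> C"
        then show "- p' (- x) \<le> a x" using sublinear_minus_ge[OF sub, of a x] le[of a "- x"] by simp
      qed
      have lower: "l x \<le> a x" if "a \<in> C" for a x
        unfolding l_def by (rule cINF_lower[OF bdd that])
      have "sublinear l"
      proof (rule sublinearI)
        fix x y
        show "l (x + y) \<le> l x + l y"
          unfolding l_def[of x] l_def[of y]
        proof (rule le_cINF_add_cINF[OF False False])
          fix a b assume ab: "a \<in> C" "b \<in> C"
          \<comment> \<open>The smaller of the two must serve both summands: the subadditivity of
            \<open>a\<close> and of \<open>b\<close> separately does not bound the mixed sum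
            \<open>a x + b y\<close>.\<close>
          then consider "a \<le> b" | "b \<le> a" using tot by blast
          then show "l (x + y) \<le> a x + b y"
          proof cases
            case 1
            then show ?thesis using lower[OF ab(1), of "x + y"] sublinear_add[OF sub[OF ab(1)], of x y]
              by (smt (verit) le_funD)
          next
            case 2
            then show ?thesis using lower[OF ab(2), of "x + y"] sublinear_add[OF sub[OF ab(2)], of x y]
              by (smt (verit) le_funD)
          qed
        qed
      next
        show "l 0 = 0" unfolding l_def using False by (simp add: sublinear_zero[OF sub] cong: INF_cong)
      next
        fix r :: real and x assume r: "0 < r"
        have "inverse r * l (r *\<^sub>R x) \<le> l x" unfolding l_def[of x]
        proof (rule cINF_greatest[OF False])
          fix a assume a: "a \<in> C"
          show "inverse r * l (r *\<^sub>R x) \<le> a x"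
            using lower[OF a, of "r *\<^sub>R x"] r by (simp add: sublinear_scale[OF sub[OF a]] field_simps)
        qed
        then show "l (r *\<^sub>R x) \<le> r * l x" using r by (simp add: field_simps)
      qed
      moreover have "l \<le> p'"
      proof (rule le_funI)
        fix x
        obtain a where "a \<in> C" using False by blast
        then show "l x \<le> p' x" using lower le order_trans by blast
      qed
      ultimately show ?thesis using lower by (auto simp: A_def le_fun_def)
    qed
  qed
  then obtain m where m: "sublinear m" "m \<le> p'" and min: "\<And>a. sublinear a \<Longrightarrow> a \<le> m \<Longrightarrow> a = m"
    by (auto simp: A_def)
  have neg: "m (- v) = - m v" for v
  proof -
    obtain q where "sublinear q" "q \<le> m" "q (- v) \<le> - m v" using sublinear_tilt[OF m(1)] by metis
    then have "m (- v) \<le> - m v" using min by metis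
    then show ?thesis using sublinear_minus_ge[OF m(1), of v] by simp
  qed
  show thesis
  proof
    show "linear m"
    proof (rule linearI)
      fix x y
      have "m x \<le> m (x + y) + m (- y)" using sublinear_add[OF m(1), of "x + y" "- y"] by simp
      then show "m (x + y) = m x + m y" using sublinear_add[OF m(1), of x y] by (simp add: neg)
    next
      fix r :: real and x
      show "m (r *\<^sub>R x) = r *\<^sub>R m x"
      proof (cases "0 \<le> r")
        case False
        then have "m (- (r *\<^sub>R x)) = - r * m x" using sublinear_scale[OF m(1), of "- r" x] by simp
        then show ?thesis by (simp add: neg)
      qed (simp add: sublinear_scale[OF m(1)])
    qed
    show le: "m x \<le> p x" for x using m(2) p'(2) by (meson le_funD order_trans)
    have "m (- u) \<le> - p u" using m(2) p'(3) by (meson le_funD order_trans)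
    then show "m u = p u" using le[of u] by (simp add: neg)
  qed
qed

lemma sublinear_norm: "sublinear (norm :: 'a::real_normed_vector \<Rightarrow> real)"
  by (auto simp: sublinear_def norm_triangle_ineq)

lemma hahn_banach_blinfun:
  fixes p :: "'a::real_normed_vector \<Rightarrow> real"
  assumes p: "sublinear p" "\<And>x. p x \<le> norm x"
  obtains f :: "'a \<Rightarrow>\<^sub>L real" where "norm f \<le> 1" "\<And>x. f x \<le> p x" "f u = p u"
proof -
  obtain f where f: "linear f" "\<And>x. f x \<le> p x" "f u = p u" using hahn_banach[OF p(1)] by metis
  have b: "norm (f x) \<le> 1 * norm x" for x
    using order_trans[OF f(2) p(2), of x] order_trans[OF f(2) p(2), of "- x"]
    by (simp add: linear_neg[OF f(1)])
  then have bl: "bounded_linear f"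
    using f(1) by (intro bounded_linear.intro bounded_linear_axioms.intro exI[of _ 1]) auto
  show thesis
  proof
    show "norm (Blinfun f) \<le> 1"
      by (rule norm_blinfun_bound) (use b in \<open>simp_all add: bounded_linear_Blinfun_apply[OF bl]\<close>)
  qed (use f in \<open>simp_all add: bounded_linear_Blinfun_apply[OF bl]\<close>)
qed

lemma norming_functional:
  fixes x :: "'a::real_normed_vector"
  obtains f :: "'a \<Rightarrow>\<^sub>L real" where "norm f \<le> 1" "f x = norm x"
  using hahn_banach_blinfun[OF sublinear_norm, of x] by (metis order_refl)

text \<open>The distance to \<open>Z\<close> is sublinear and vanishes on \<open>Z\<close>. A linear
  functional below it is at most 0 at \<open>z\<close> and at \<open>- z\<close>, hence zero on
  \<open>Z\<close>, and it can be made to attain the positive distance at \<open>x\<close>.\<close>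

lemma separating_functional:
  fixes Z :: "'a::real_normed_vector set"
  assumes "subspace Z" "closed Z" "x \<notin> Z"
  obtains f :: "'a \<Rightarrow>\<^sub>L real" where "\<And>z. z \<in> Z \<Longrightarrow> f z = 0" "f x \<noteq> 0"
proof -
  have ne: "Z \<noteq> {}" and z0: "0 \<in> Z" using subspace_0[OF assms(1)] by auto
  have sub: "sublinear (\<lambda>x. infdist x Z)"
  proof (rule sublinearI)
    fix x y
    have "infdist (x + y) Z \<le> (INF a\<in>Z. dist x a) + (INF b\<in>Z. dist y b)"
    proof (rule le_cINF_add_cINF[OF ne ne])
      fix a b assume "a \<in> Z" "b \<in> Z"
      then have "infdist (x + y) Z \<le> dist (x + y) (a + b)" using assms(1)
        by (intro infdist_le) (rule subspace_add)
      then show "infdist (x + y) Z \<le> dist x a + dist y b" using dist_triangle_add[of x y a b] by simp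
    qed
    then show "infdist (x + y) Z \<le> infdist x Z + infdist y Z" using ne by (simp add: infdist_def)
  next
    show "infdist 0 Z = 0" using z0 by simp
  next
    fix r :: real and x assume r: "0 < r"
    have "inverse r * infdist (r *\<^sub>R x) Z \<le> (INF a\<in>Z. dist x a)"
    proof (rule cINF_greatest[OF ne])
      fix a assume "a \<in> Z"
      then have "infdist (r *\<^sub>R x) Z \<le> dist (r *\<^sub>R x) (r *\<^sub>R a)" using assms(1)
        by (intro infdist_le) (rule subspace_scale)
      also have "\<dots> = r * dist x a" using r by (simp add: dist_norm scaleR_diff_right[symmetric])
      finally show "inverse r * infdist (r *\<^sub>R x) Z \<le> dist x a" using r by (simp add: field_simps)
    qed
    then show "infdist (r *\<^sub>R x) Z \<le> r * infdist x Z" using ne r by (simp add: infdist_def field_simps)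
  qed
  have "infdist y Z \<le> norm y" for y using infdist_le[OF z0, of y] by simp
  then obtain f :: "'a \<Rightarrow>\<^sub>L real" where f: "\<And>y. f y \<le> infdist y Z" "f x = infdist x Z"
    using hahn_banach_blinfun[OF sub] by metis
  show thesis
  proof
    fix z assume "z \<in> Z"
    then have "f z \<le> 0" "f (- z) \<le> 0"
      using f(1)[of z] f(1)[of "- z"] subspace_neg[OF assms(1)] by simp_all
    then show "f z = 0" by (simp add: blinfun.minus_right)
  next
    show "f x \<noteq> 0" using f(2) in_closed_iff_infdist_zero[OF assms(2) ne, of x] assms(3) by simp
  qed
qed

section \<open>Norms of functionals, the embedding into the bidual, adjoints, uniform
  boundedness\<close>

lemma blinfun_apply_le_norm: "norm x \<le> 1 \<Longrightarrow> \<bar>blinfun_apply f x\<bar> \<le> norm f"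
  for f :: "'a::real_normed_vector \<Rightarrow>\<^sub>L real"
  using norm_blinfun[of f x] mult_left_mono[of "norm x" 1 "norm f"] by simp

lemma norm_blinfun_le:
  fixes f :: "'a::real_normed_vector \<Rightarrow>\<^sub>L real"
  assumes "0 \<le> e" "\<And>x. norm x \<le> 1 \<Longrightarrow> \<bar>f x\<bar> \<le> e"
  shows "norm f \<le> e"
proof (rule norm_blinfun_bound[OF assms(1)])
  fix x
  show "norm (f x) \<le> e * norm x"
  proof (cases "x = 0")
    case False
    then have "\<bar>f (x /\<^sub>R norm x)\<bar> \<le> e" by (intro assms) simp
    then show ?thesis using False by (simp add: blinfun.scaleR_right field_simps abs_mult)
  qed simp
qed

text \<open>The canonical embedding into the bidual, packed as a bounded operator so that general
  facts about operators, such as weak continuity, apply to it.\<close>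

definition bidual :: "'a::real_normed_vector \<Rightarrow>\<^sub>L ('a \<Rightarrow>\<^sub>L real) \<Rightarrow>\<^sub>L real"
  where "bidual = Blinfun (\<lambda>x. Blinfun (\<lambda>f. blinfun_apply f x))"

lemma bidual_apply [simp]: "blinfun_apply (blinfun_apply bidual x) f = blinfun_apply f x"
proof -
  have J: "blinfun_apply (Blinfun (\<lambda>f. blinfun_apply f x)) f = f x"
    for x :: 'a and f :: "'a \<Rightarrow>\<^sub>L real"
    by (simp add: bounded_linear_Blinfun_apply blinfun.bounded_linear_left)
  have "bounded_linear (\<lambda>x :: 'a. Blinfun (\<lambda>f :: 'a \<Rightarrow>\<^sub>L real. blinfun_apply f x))"
  proof (rule bounded_linear_intro[where K = 1])
    fix x :: 'a
    show "norm (Blinfun (\<lambda>f :: 'a \<Rightarrow>\<^sub>L real. blinfun_apply f x)) \<le> norm x * 1"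
    proof (rule norm_blinfun_bound)
      fix f :: "'a \<Rightarrow>\<^sub>L real"
      show "norm (blinfun_apply (Blinfun (\<lambda>f. blinfun_apply f x)) f) \<le> norm x * 1 * norm f"
        using norm_blinfun[of f x] by (simp add: J mult.commute)
    qed simp
  qed (rule blinfun_eqI, simp only: J blinfun.add_left blinfun.scaleR_left,
      simp only: blinfun.add_right blinfun.scaleR_right)+
  then show ?thesis by (simp add: bidual_def bounded_linear_Blinfun_apply J)
qed

lemma norm_bidual: "norm (blinfun_apply bidual x) = norm (x :: 'a::real_normed_vector)"
proof (rule antisym)
  show "norm (blinfun_apply bidual x) \<le> norm x"
  proof (rule norm_blinfun_bound)
    fix f :: "'a \<Rightarrow>\<^sub>L real"
    show "norm (blinfun_apply (blinfun_apply bidual x) f) \<le> norm x * norm f"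
      using norm_blinfun[of f x] by (simp add: mult.commute)
  qed simp
  obtain f :: "_ \<Rightarrow>\<^sub>L real" where "norm f \<le> 1" "f x = norm x" using norming_functional by blast
  then show "norm x \<le> norm (blinfun_apply bidual x)"
    using blinfun_apply_le_norm[of f "blinfun_apply bidual x"] by simp
qed

lemma norm_adjoint_op:
  fixes T :: "'a::real_normed_vector \<Rightarrow>\<^sub>L 'b::real_normed_vector"
  shows "norm (adjoint_op T) = norm T"
proof (rule antisym)
  show "norm (adjoint_op T) \<le> norm T"
    by (rule norm_blinfun_bound)
      (use norm_blinfun_compose[of _ T] in \<open>auto simp: adjoint_op_apply mult.commute\<close>)
  show "norm T \<le> norm (adjoint_op T)"
  proof (rule norm_blinfun_bound)
    fix x
    obtain f :: "'b \<Rightarrow>\<^sub>L real" where f: "norm f \<le> 1" "f (T x) = norm (T x)"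
      using norming_functional by blast
    have "norm (T x) = adjoint_op T f x" using f by (simp add: adjoint_op_apply)
    also have "\<dots> \<le> norm (adjoint_op T f) * norm x" using norm_blinfun[of "adjoint_op T f" x] by simp
    also have "\<dots> \<le> (norm (adjoint_op T) * norm f) * norm x"
      by (intro mult_right_mono norm_blinfun) simp
    also have "\<dots> \<le> (norm (adjoint_op T) * 1) * norm x"
      using f by (intro mult_right_mono mult_left_mono) auto
    finally show "norm (T x) \<le> norm (adjoint_op T) * norm x" by simp
  qed simp
qed

lemma bounded_adjoint_op_image: "bounded (adjoint_op ` \<T>) \<longleftrightarrow> bounded \<T>"
  by (simp add: bounded_iff norm_adjoint_op)

text \<open>If every open set \<open>D n\<close> were dense, a point common to all of them would
  exist by Baire and violate pointwise boundedness. So some \<open>D n\<close> misses a ball, on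
  which all of \<open>B\<close> is bounded by \<open>n\<close>.\<close>

lemma uniform_boundedness:
  fixes B :: "('a::banach \<Rightarrow>\<^sub>L 'b::real_normed_vector) set"
  assumes "\<And>x. bounded ((\<lambda>f. blinfun_apply f x) ` B)"
  shows "bounded B"
proof -
  define D where "D n = {x. \<exists>f\<in>B. real n < norm (blinfun_apply f x)}" for n :: nat
  have opn: "open (D n)" for n
  proof -
    have "D n = (\<Union>f\<in>B. {x. real n < norm (blinfun_apply f x)})" by (auto simp: D_def)
    also have "open \<dots>" by (intro open_UN ballI open_Collect_less continuous_intros)
    finally show ?thesis .
  qed
  have "\<exists>n. closure (D n) \<noteq> UNIV"
  proof (rule ccontr)
    assume "\<not> ?thesis"
    then have cl: "closure (D n) = UNIV" for n by blast
    have "Met_TC.mtopology closure_of \<Inter> (range D) = (UNIV :: 'a set)"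
    proof (rule Met_TC.metric_Baire_category)
      show "Met_TC.mcomplete TYPE('a)" by (simp add: complete_UNIV)
    qed (use opn cl in auto)
    then have "\<Inter> (range D) \<noteq> {}" by (auto simp del: Inter_iff)
    then obtain x where x: "\<And>n. x \<in> D n" by auto
    obtain b where b: "\<And>f. f \<in> B \<Longrightarrow> norm (blinfun_apply f x) \<le> b"
      using assms[of x] by (auto simp: bounded_iff)
    obtain n :: nat where "b < real n" using reals_Archimedean2 by blast
    then show False using x[of n] b by (force simp: D_def)
  qed
  then obtain n where "closure (D n) \<noteq> UNIV" by blast
  then obtain x where "x \<notin> closure (D n)" by blast
  then obtain r where r: "0 < r" "ball x r \<inter> D n = {}"
    by (force simp: closure_approachable dist_commute not_less)
  have bd: "norm (blinfun_apply f y) \<le> real n" if "f \<in> B" "dist x y < r" for f y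
    using r that by (force simp: D_def disjoint_iff)
  \<comment> \<open>A vector of norm \<open>r / 2\<close> added to \<open>x\<close> stays inside the
    open ball, and the value of \<open>f\<close> at it is a difference of two values of norm at most
    \<open>n\<close>.\<close>
  have "norm f \<le> 2 * n / (r / 2)" if f: "f \<in> B" for f
  proof (rule norm_blinfun_bound)
    fix y
    show "norm (blinfun_apply f y) \<le> 2 * n / (r / 2) * norm y"
    proof (cases "y = 0")
      case False
      define c where "c = r / 2 / norm y"
      have c: "0 < c" "norm (c *\<^sub>R y) = r / 2" using False r by (simp_all add: c_def)
      have "c * norm (blinfun_apply f y) = norm (blinfun_apply f (x + c *\<^sub>R y) - blinfun_apply f x)"
        using c by (simp add: blinfun.add_right blinfun.scaleR_right)
      also have "\<dots> \<le> norm (blinfun_apply f (x + c *\<^sub>R y)) + norm (blinfun_apply f x)"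
        by (rule norm_triangle_ineq4)
      also have "\<dots> \<le> real n + real n"
        using c r f by (intro add_mono bd) (auto simp: dist_norm)
      finally have "norm (blinfun_apply f y) \<le> 2 * n / c" using c by (simp add: field_simps)
      then show ?thesis by (simp add: c_def)
    qed simp
  qed (use r in simp)
  then show ?thesis by (auto simp: bounded_iff)
qed


section \<open>Weakly compact sets\<close>

lemma continuous_map_weak_topology:
  "continuous_map weak_topology euclideanreal (\<lambda>x::'a::real_normed_vector. blinfun_apply f x)"
proof -
  have "continuous_map euclidean euclideanreal (\<lambda>\<phi>::('a \<Rightarrow>\<^sub>L real) \<Rightarrow> real. \<phi> f)"
    by (simp add: continuous_on_product_coordinates)
  then show ?thesis
    unfolding weak_topology_def by (drule_tac continuous_map_pullback) (simp add: o_def)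
qed

lemma continuous_map_weak_topology_seq:
  fixes g :: "nat \<Rightarrow> 'a::real_normed_vector \<Rightarrow>\<^sub>L real"
  shows "continuous_map weak_topology euclidean (\<lambda>x k. blinfun_apply (g k) x)"
proof -
  have "continuous_map euclidean euclidean (\<lambda>(\<phi>::('a \<Rightarrow>\<^sub>L real) \<Rightarrow> real) (k::nat). \<phi> (g k))"
    by (simp add: continuous_on_coordinatewise_then_product)
  then show ?thesis
    unfolding weak_topology_def by (drule_tac continuous_map_pullback) (simp add: o_def)
qed

lemma closedin_weak_topology_preimage:
  fixes f :: "'a::real_normed_vector \<Rightarrow>\<^sub>L real"
  assumes "closed C"
  shows "closedin weak_topology {x. blinfun_apply f x \<in> C}"
  using closedin_continuous_map_preimage[OF continuous_map_weak_topology, of C f] assms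
  by (simp add: topspace_weak_topology)

lemma Hausdorff_weak_topology: "Hausdorff_space (weak_topology :: 'a::real_normed_vector topology)"
  unfolding Hausdorff_space_def
proof (intro allI impI)
  fix x y :: 'a assume xy: "x \<in> topspace weak_topology \<and> y \<in> topspace weak_topology \<and> x \<noteq> y"
  obtain f :: "'a \<Rightarrow>\<^sub>L real" where f: "f (x - y) = norm (x - y)"
    using norming_functional by blast
  define c where "c = (f x + f y) / 2"
  have "0 < f (x - y)" using f xy by simp
  then have c: "f y < c" "c < f x" by (simp_all add: c_def blinfun.diff_right)
  have op: "openin weak_topology {z. f z \<in> U}" if "open U" for U
    using openin_continuous_map_preimage[OF continuous_map_weak_topology, of U f] that
    by (simp add: topspace_weak_topology)
  show "\<exists>U V. openin weak_topology U \<and> openin weak_topology V \<and> x \<in> U \<and> y \<in> V \<and> disjnt U V"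
    by (rule exI[of _ "{z. f z \<in> {c<..}}"], rule exI[of _ "{z. f z \<in> {..<c}}"])
      (use c op[of "{c<..}"] op[of "{..<c}"] in \<open>auto simp: disjnt_def\<close>)
qed

text \<open>By separation, \<open>Z\<close> is the intersection of the kernels of the functionals
  that vanish on it, and kernels are weakly closed.\<close>

lemma closedin_weak_topology_subspace:
  fixes Z :: "'a::real_normed_vector set"
  assumes "subspace Z" "closed Z"
  shows "closedin weak_topology Z"
proof -
  define F where "F = {f :: 'a \<Rightarrow>\<^sub>L real. \<forall>z\<in>Z. f z = 0}"
  have "Z = (\<Inter>f\<in>F. {x. blinfun_apply f x \<in> {0}})"
  proof (intro equalityI subsetI)
    fix x assume "x \<in> (\<Inter>f\<in>F. {x. blinfun_apply f x \<in> {0}})"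
    then show "x \<in> Z" using separating_functional[OF assms, of x] by (force simp: F_def)
  qed (auto simp: F_def)
  also have "closedin weak_topology \<dots>"
    by (intro closedin_INT) (auto simp: F_def intro: closedin_weak_topology_preimage[of "{0}", simplified] exI[of _ 0])
  finally show ?thesis .
qed

text \<open>Each functional maps the weak closure onto a compact set of reals. Viewed in the bidual,
  \<open>A\<close> is thus pointwise bounded on the dual, a Banach space, and the embedding
  preserves norms.\<close>

lemma relatively_weakly_compact_imp_bounded:
  fixes A :: "'a::real_normed_vector set"
  assumes "relatively_weakly_compact A"
  shows "bounded A"
proof -
  have "bounded (blinfun_apply bidual ` A)"
  proof (rule uniform_boundedness)
    fix f :: "'a \<Rightarrow>\<^sub>L real"
    have "compactin euclideanreal (blinfun_apply f ` (weak_topology closure_of A))"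
      using assms continuous_map_weak_topology
      unfolding relatively_weakly_compact_def by (rule image_compactin)
    then have "bounded (blinfun_apply f ` (weak_topology closure_of A))"
      by (simp add: compact_imp_bounded)
    moreover have "A \<subseteq> weak_topology closure_of A"
      by (rule closure_of_subset) (simp add: topspace_weak_topology)
    ultimately have "bounded (blinfun_apply f ` A)" by (meson bounded_subset image_mono)
    then show "bounded ((\<lambda>F. blinfun_apply F f) ` blinfun_apply bidual ` A)" by (simp add: image_image)
  qed
  then show ?thesis by (simp add: bounded_iff norm_bidual)
qed

text \<open>The sequence together with its limit is compact, hence closed because the weak topology
  is Hausdorff; so it contains the weak closure.\<close>

lemma weakly_convergent_imp_relatively_weakly_compact:
  fixes x :: "nat \<Rightarrow> 'a::real_normed_vector"
  assumes "weakly_convergent x"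
  shows "relatively_weakly_compact (range x)"
proof -
  obtain l where l: "limitin weak_topology x l sequentially"
    using assms by (auto simp: weakly_convergent_def)
  have c: "compactin weak_topology (insert l (range x))"
    by (rule compactin_sequence_with_limit[OF l]) (auto simp: topspace_weak_topology)
  then have "closedin weak_topology (insert l (range x))"
    by (rule compactin_imp_closedin[OF Hausdorff_weak_topology])
  then have "weak_topology closure_of (range x) \<subseteq> insert l (range x)"
    by (intro closure_of_minimal) auto
  then show ?thesis
    unfolding relatively_weakly_compact_def by (rule closed_compactin[OF c _ closedin_closure_of])
qed

section \<open>Separable subspaces and weak sequential compactness\<close>

lemma subspace_closure:
  fixes S :: "'a::real_normed_vector set"
  assumes S: "subspace S"
  shows "subspace (closure S)"
proof (rule subspaceI)
  show "0 \<in> closure S" using subspace_0[OF S] closure_subset by blast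
  show "x + y \<in> closure S" if xy: "x \<in> closure S" "y \<in> closure S" for x y
  proof -
    obtain a b where "\<And>n. a n \<in> S" "a \<longlonglongrightarrow> x" "\<And>n. b n \<in> S" "b \<longlonglongrightarrow> y"
      using xy unfolding closure_sequential by metis
    then have "\<And>n. a n + b n \<in> S" "(\<lambda>n. a n + b n) \<longlonglongrightarrow> x + y"
      by (auto intro: subspace_add[OF S] tendsto_add)
    then show ?thesis unfolding closure_sequential by (intro exI[of _ "\<lambda>n. a n + b n"]) simp
  qed
  show "c *\<^sub>R x \<in> closure S" if x: "x \<in> closure S" for c x
  proof -
    obtain a where "\<And>n. a n \<in> S" "a \<longlonglongrightarrow> x"
      using x unfolding closure_sequential by metis
    then have "\<And>n. c *\<^sub>R a n \<in> S" "(\<lambda>n. c *\<^sub>R a n) \<longlonglongrightarrow> c *\<^sub>R x"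
      by (auto intro: subspace_scale[OF S] tendsto_scaleR)
    then show ?thesis unfolding closure_sequential by (intro exI[of _ "\<lambda>n. c *\<^sub>R a n"]) simp
  qed
qed

lemma countable_dense_in_span:
  fixes y :: "nat \<Rightarrow> 'a::real_normed_vector"
  obtains D where "countable D" "D \<noteq> {}" "span (range y) \<subseteq> closure D"
proof
  \<comment> \<open>\<open>D n\<close> consists of the rational combinations of
    \<open>y 0, ..., y (n - 1)\<close>.\<close>
  define D where "D = rec_nat {0} (\<lambda>n D. (\<lambda>(d, q). d + of_rat q *\<^sub>R y n) ` (D \<times> UNIV))"
  have D0: "D 0 = {0}" and DS: "D (Suc n) = (\<lambda>(d, q). d + of_rat q *\<^sub>R y n) ` (D n \<times> UNIV)" for n
    by (simp_all add: D_def)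
  have "countable (D n)" for n by (induction n) (auto simp: D0 DS)
  then show "countable (\<Union>n. D n)" by simp
  show "(\<Union>n. D n) \<noteq> {}" using D0 by blast
  have dense: "x \<in> closure (D n)" if "x \<in> span (y ` {..<n})" for x n
    using that
  proof (induction n arbitrary: x)
    case 0
    then show ?case by (simp add: D0)
  next
    case (Suc n)
    then obtain k where k: "x - k *\<^sub>R y n \<in> span (y ` {..<n})"
      by (auto simp: lessThan_Suc span_breakdown_eq)
    show ?case unfolding closure_approachable
    proof (intro allI impI)
      fix e :: real assume e: "0 < e"
      obtain d where d: "d \<in> D n" "dist d (x - k *\<^sub>R y n) < e / 2"
        using Suc.IH[OF k] e unfolding closure_approachable by (meson half_gt_zero)
      \<comment> \<open>The added 1 covers \<open>y n = 0\<close> and makes the estimate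
        \<open>c * norm (y n) < e / 2\<close> strict.\<close>
      define c where "c = e / 2 / (norm (y n) + 1)"
      have c: "0 < c" using e by (simp add: c_def add_nonneg_pos)
      obtain q where q: "k - c < of_rat q" "of_rat q < k + c"
        using of_rat_dense[of "k - c" "k + c"] c by auto
      have "\<bar>of_rat q - k\<bar> * norm (y n) \<le> c * norm (y n)" using q by (intro mult_right_mono) auto
      also have "\<dots> < c * (norm (y n) + 1)" using c by simp
      also have "\<dots> = e / 2" using add_nonneg_pos[OF norm_ge_zero zero_less_one, of "y n"]
        unfolding c_def by (intro nonzero_eq_divide_eq[THEN iffD1, rotated] refl) simp
      finally have q': "norm ((of_rat q - k) *\<^sub>R y n) < e / 2" by simp
      have "dist (d + of_rat q *\<^sub>R y n) x = norm ((d - (x - k *\<^sub>R y n)) + (of_rat q - k) *\<^sub>R y n)"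
        by (simp add: dist_norm algebra_simps)
      also have "\<dots> < e / 2 + e / 2" using d(2) q' by (intro norm_triangle_lt add_strict_mono) (simp add: dist_norm)
      finally show "\<exists>z\<in>D (Suc n). dist z x < e" using d(1) by (auto simp: DS)
    qed
  qed
  show "span (range y) \<subseteq> closure (\<Union>n. D n)"
  proof
    fix x assume "x \<in> span (range y)"
    then obtain S where S: "finite S" "S \<subseteq> range y" "x \<in> span S"
      unfolding span_explicit by (force intro: span_sum span_scale span_base)
    obtain I where I: "finite I" "S = y ` I" using finite_subset_image[OF S(1,2)] by auto
    obtain n where "I \<subseteq> {..<n}" using finite_nat_bounded[OF I(1)] by blast
    then have "x \<in> span (y ` {..<n})" using S(3) I(2) by (meson image_mono span_mono subsetD)
    then have "x \<in> closure (D n)" by (rule dense)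
    then show "x \<in> closure (\<Union>n. D n)" by (meson UNIV_I UN_upper closure_mono subsetD)
  qed
qed

text \<open>Countably many functionals separate the points of the separable weakly closed subspace
  \<open>Z\<close> spanned by the sequence; they embed a weakly compact subset of \<open>Z\<close> into a metrizable space.\<close>

lemma eberlein:
  fixes y :: "nat \<Rightarrow> 'a::real_normed_vector"
  assumes A: "relatively_weakly_compact A" and y: "\<And>n. y n \<in> A"
  obtains r where "strict_mono (r :: nat \<Rightarrow> nat)" "weakly_convergent (y \<circ> r)"
proof -
  obtain D where D: "countable D" "D \<noteq> {}" "span (range y) \<subseteq> closure D"
    using countable_dense_in_span by blast
  define Z where "Z = closure (span (range y))"
  have Z: "subspace Z" "closed Z" "Z \<subseteq> closure D"
    using D(3) by (auto simp: Z_def subspace_closure[OF subspace_span] closure_minimal)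
  have yZ: "y n \<in> Z" for n using closure_subset[of "span (range y)"] by (auto simp: Z_def intro: span_base)
  have "\<exists>f :: 'a \<Rightarrow>\<^sub>L real. norm f \<le> 1 \<and> blinfun_apply f d = norm d" for d :: 'a using norming_functional[of d] by metis
  then obtain N :: "'a \<Rightarrow> 'a \<Rightarrow>\<^sub>L real" where N: "\<And>d. norm (N d) \<le> 1" "\<And>d. N d d = norm d" by metis
  define g where "g k = N (from_nat_into D k)" for k
  define \<Phi> where "\<Phi> x k = blinfun_apply (g k) x" for x and k :: nat
  have cont: "continuous_map weak_topology euclidean \<Phi>"
    unfolding \<Phi>_def by (rule continuous_map_weak_topology_seq)
  \<comment> \<open>If \<open>d\<close> in \<open>D\<close> is close to \<open>u - v\<close>, its
    norming functional kills \<open>u - v\<close>, so \<open>norm d\<close> is at most the distance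
    from \<open>d\<close> to \<open>u - v\<close>. Both \<open>d\<close> and \<open>u - v\<close>
    are then small.\<close>
  have inj: "u = v" if uv: "u \<in> Z" "v \<in> Z" "\<Phi> u = \<Phi> v" for u v
  proof -
    have "norm (u - v) \<le> e" if e: "0 < e" for e
    proof -
      have "u - v \<in> closure D" using Z uv subspace_diff by blast
      then obtain d where d: "d \<in> D" "dist d (u - v) < e / 2"
        using e unfolding closure_approachable by (meson half_gt_zero)
      obtain k where k: "from_nat_into D k = d" using from_nat_into_surj[OF D(1) d(1)] by blast
      have "blinfun_apply (N d) (u - v) = 0"
        using fun_cong[OF uv(3), of k] by (simp add: \<Phi>_def g_def k blinfun.diff_right)
      then have "norm d = blinfun_apply (N d) (d - (u - v))" using N(2) by (simp add: blinfun.diff_right)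
      also have "\<dots> \<le> norm (N d) * norm (d - (u - v))" using norm_blinfun[of "N d" "d - (u - v)"] by simp
      also have "\<dots> \<le> 1 * norm (d - (u - v))" by (intro mult_right_mono N(1)) simp
      finally have "norm d < e / 2" using d(2) by (simp add: dist_norm)
      then show ?thesis using d(2) norm_triangle_ineq4[of d "d - (u - v)"] by (simp add: dist_norm)
    qed
    then have "norm (u - v) \<le> 0" by (rule field_le_epsilon) simp
    then show ?thesis by simp
  qed
  define K where "K = (weak_topology closure_of A) \<inter> Z"
  have K: "compactin weak_topology K" unfolding K_def
    using A[unfolded relatively_weakly_compact_def] closedin_weak_topology_subspace[OF Z(1,2)]
    by (simp add: compact_Int_closedin)
  have yK: "y n \<in> K" for n using y yZ closure_of_subset[of A weak_topology]
    by (auto simp: K_def topspace_weak_topology)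
  have cpt: "compact (\<Phi> ` K')" if "compactin weak_topology K'" for K'
    using image_compactin[OF that cont] by simp
  have "\<forall>n. (\<Phi> \<circ> y) n \<in> \<Phi> ` K" using yK by simp
  then obtain l r where r: "l \<in> \<Phi> ` K" "strict_mono (r :: nat \<Rightarrow> nat)" "((\<Phi> \<circ> y) \<circ> r) \<longlonglongrightarrow> l"
    by (rule seq_compactE[OF compact_imp_seq_compact[OF cpt[OF K]]])
  then obtain u where u: "u \<in> K" "l = \<Phi> u" by blast
  have "limitin weak_topology (y \<circ> r) u sequentially"
    unfolding limitin_weak_topology
  proof (rule allI, rule ccontr)
    fix h :: "'a \<Rightarrow>\<^sub>L real"
    assume "\<not> (\<lambda>n. h ((y \<circ> r) n)) \<longlonglongrightarrow> h u"
    then obtain e where e: "0 < e" "\<exists>\<^sub>F n in sequentially. e \<le> dist (h (y (r n))) (h u)"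
      by (auto simp: tendsto_iff not_eventually not_less)
    then have "infinite {n. e \<le> dist (h (y (r n))) (h u)}"
      by (simp add: frequently_cofinite cofinite_eq_sequentially[symmetric])
    from infinite_enumerate[OF this]
    obtain s where s: "strict_mono (s :: nat \<Rightarrow> nat)" "\<And>n. e \<le> dist (h (y (r (s n)))) (h u)"
      by auto
    \<comment> \<open>The subsequence violating convergence at \<open>h\<close> stays in the compact
      set \<open>K'\<close>, whose image under \<open>\<Phi>\<close> is closed and so contains
      \<open>\<Phi> u\<close>. Injectivity puts \<open>u\<close> itself into \<open>K'\<close>,
      where \<open>h\<close> is at distance at least \<open>e\<close> from
      \<open>h u\<close>.\<close>
    define K' where "K' = K \<inter> {x. blinfun_apply h x \<in> - ball (h u) e}"
    have "compactin weak_topology K'"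
      unfolding K'_def by (intro compact_Int_closedin K closedin_weak_topology_preimage) auto
    then have "closed (\<Phi> ` K')" by (intro compact_imp_closed cpt)
    moreover have "\<Phi> (y (r (s n))) \<in> \<Phi> ` K'" for n
      using s(2)[of n] yK by (intro imageI) (simp add: K'_def dist_commute)
    moreover have "(\<lambda>n. \<Phi> (y (r (s n)))) \<longlonglongrightarrow> l"
      using LIMSEQ_subseq_LIMSEQ[OF r(3) s(1)] by (simp add: o_def)
    ultimately have "l \<in> \<Phi> ` K'" by (rule closed_sequentially)
    then obtain v where "v \<in> K'" "\<Phi> u = \<Phi> v" using u by auto
    moreover from this have "u = v" using u(1) by (intro inj) (auto simp: K_def K'_def)
    ultimately show False using e(1) by (simp add: K'_def)
  qed
  then show thesis using that[OF r(2)] by (auto simp: weakly_convergent_def)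
qed

section \<open>Disjoint sequences and monotone seminorms\<close>

lemma inf_add_le:
  fixes t a b :: "'a::lattice_ab_group_add"
  assumes "0 \<le> t" "0 \<le> a" "0 \<le> b"
  shows "inf t (a + b) \<le> inf t a + inf t b"
proof -
  have "t \<le> t + inf t b" using assms by simp
  then have "inf t (a + b) \<le> t + inf t b" by (rule order_trans[OF inf_le1])
  moreover have "inf t (a + b) \<le> a + inf t b"
    unfolding add_inf_distrib_left using assms by (intro inf_mono) (simp_all add: add_increasing)
  ultimately show ?thesis by (simp add: add_inf_distrib_right)
qed

lemma disjoint_mono:
  fixes a b :: "'a::lattice_ab_group_add"
  assumes "0 \<le> x" "x \<le> a" "0 \<le> y" "y \<le> b" "inf a b = 0"
  shows "inf x y = 0"
  using assms inf_mono[of x a y b] by (auto intro: antisym)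

lemma disjoint_sum:
  fixes t :: "'a::lattice_ab_group_add"
  assumes "0 \<le> t" "\<And>i. i \<in> I \<Longrightarrow> 0 \<le> b i" "\<And>i. i \<in> I \<Longrightarrow> inf t (b i) = 0"
  shows "inf t (\<Sum>i\<in>I. b i) = 0"
  using assms(2,3)
proof (induction I rule: infinite_finite_induct)
  case (insert i I)
  then have "inf t (b i + (\<Sum>i\<in>I. b i)) \<le> inf t (b i) + inf t (\<Sum>i\<in>I. b i)"
    using assms(1) by (intro inf_add_le sum_nonneg) auto
  moreover have "0 \<le> inf t (b i + (\<Sum>i\<in>I. b i))"
    using insert assms(1) by (intro le_infI add_nonneg_nonneg sum_nonneg) auto
  ultimately show ?case using insert by (auto intro: antisym)
qed (use assms(1) in \<open>auto intro: inf_absorb2\<close>)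

lemma inf_pprt_uminus: "inf (pprt x) (pprt (- x)) = (0::'a::lattice_ab_group_add)"
proof -
  have "pprt x = x - nprt x" using prts[of x] by (metis add_diff_cancel_right')
  then have "inf (pprt x) (pprt (- x)) = inf (x - nprt x) (- nprt x)" by (simp add: pprt_neg)
  also have "\<dots> = inf x 0 - nprt x" using add_inf_distrib_right[of x 0 "- nprt x"] by simp
  finally show ?thesis by (simp add: nprt_def)
qed

lemma scaleR_inf:
  fixes a b :: "'a::banach_lattice"
  assumes "0 \<le> c"
  shows "c *\<^sub>R inf a b = inf (c *\<^sub>R a) (c *\<^sub>R b)"
proof (cases "c = 0")
  case False
  then have c: "0 < c" using assms by simp
  show ?thesis
  proof (rule antisym)
    show "c *\<^sub>R inf a b \<le> inf (c *\<^sub>R a) (c *\<^sub>R b)" using assms by (simp add: scaleR_left_mono)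
    have "inverse c *\<^sub>R inf (c *\<^sub>R a) (c *\<^sub>R b) \<le> inf a b"
      using scaleR_left_mono[OF inf_le1, of "inverse c" "c *\<^sub>R a" "c *\<^sub>R b"]
        scaleR_left_mono[OF inf_le2, of "inverse c" "c *\<^sub>R a" "c *\<^sub>R b"] c by simp
    then have "c *\<^sub>R (inverse c *\<^sub>R inf (c *\<^sub>R a) (c *\<^sub>R b)) \<le> c *\<^sub>R inf a b"
      using assms by (rule scaleR_left_mono)
    then show "inf (c *\<^sub>R a) (c *\<^sub>R b) \<le> c *\<^sub>R inf a b" using c by simp
  qed
qed simp

text \<open>Both arguments lie below their multiples by \<open>1 + c\<close>, and a common factor
  passes through the infimum.\<close>

lemma disjoint_scaleR:
  fixes a b :: "'a::banach_lattice"
  assumes "inf a b = 0" "0 \<le> c"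
  shows "inf a (c *\<^sub>R b) = 0"
proof -
  have ab: "0 \<le> a" "0 \<le> b" using assms(1) inf_le1 inf_le2 by metis+
  have "inf a (c *\<^sub>R b) \<le> inf ((1 + c) *\<^sub>R a) ((1 + c) *\<^sub>R b)"
    using ab assms(2) by (intro inf_mono) (auto simp: scaleR_add_left scaleR_nonneg_nonneg)
  also have "\<dots> = 0" using assms scaleR_inf[of "1 + c" a b] by simp
  finally show ?thesis using ab assms(2) by (intro antisym) (auto simp: scaleR_nonneg_nonneg)
qed

lemma scaleR_pprt: "0 \<le> c \<Longrightarrow> c *\<^sub>R pprt x = pprt (c *\<^sub>R (x::'a::banach_lattice))"
  by (simp only: pprt_def sup_eq_neg_inf scaleR_inf scaleR_minus_right minus_zero scaleR_zero_right)

text \<open>Since \<open>d \<ge> 1 / c \<ge> 1\<close>, the second element is at most a multiple of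
  the negative part of \<open>a - c *\<^sub>R b\<close>, which is disjoint from the positive part.
  Subtracting the small multiple of \<open>b\<close> from \<open>a\<close> pays for the large
  multiple of the overlap subtracted from \<open>b\<close>.\<close>

lemma disjoint_pprt_diff:
  fixes a b :: "'a::banach_lattice"
  assumes "0 \<le> a" "0 \<le> b" "0 < c" "c \<le> 1" "1 \<le> c * d"
  shows "inf (pprt (a - c *\<^sub>R b)) (pprt (b - d *\<^sub>R inf a b)) = 0"
proof -
  have cd: "1 / c \<le> d" using assms(3,5) by (simp add: field_simps)
  moreover have "1 \<le> 1 / c" using assms(3,4) by simp
  ultimately have d: "1 \<le> d" by simp
  have "b - d *\<^sub>R inf a b = sup (b - d *\<^sub>R a) (b - d *\<^sub>R b)"
    using d by (simp add: scaleR_inf diff_inf_eq_sup add_sup_distrib_left)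
  also have "\<dots> \<le> pprt (b - d *\<^sub>R a)"
  proof (rule le_supI)
    have "1 *\<^sub>R b \<le> d *\<^sub>R b" using d assms(2) by (rule scaleR_right_mono)
    then show "b - d *\<^sub>R b \<le> pprt (b - d *\<^sub>R a)" by (intro order_trans[OF _ zero_le_pprt]) simp
  qed (simp add: pprt_def)
  also have "\<dots> \<le> pprt (b - (1 / c) *\<^sub>R a)"
    using cd assms(1) by (intro pprt_mono diff_left_mono scaleR_right_mono)
  also have "b - (1 / c) *\<^sub>R a = (1 / c) *\<^sub>R (- (a - c *\<^sub>R b))"
    using assms(3) by (simp add: scaleR_diff_right)
  also have "pprt \<dots> = (1 / c) *\<^sub>R pprt (- (a - c *\<^sub>R b))"
    using assms(3) by (intro scaleR_pprt[symmetric]) simp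
  finally have "pprt (b - d *\<^sub>R inf a b) \<le> (1 / c) *\<^sub>R pprt (- (a - c *\<^sub>R b))"
    using assms(3) unfolding pprt_def[of "b - d *\<^sub>R inf a b"]
    by (intro le_supI) (auto simp: scaleR_nonneg_nonneg)
  moreover have "inf (pprt (a - c *\<^sub>R b)) ((1 / c) *\<^sub>R pprt (- (a - c *\<^sub>R b))) = 0"
    using assms(3) by (intro disjoint_scaleR inf_pprt_uminus) simp
  ultimately show ?thesis by (rule disjoint_mono[OF zero_le_pprt order_refl zero_le_pprt])
qed

lemma pprt_le_add: "0 \<le> b \<Longrightarrow> pprt a \<le> pprt (a - b) + (b::'a::lattice_ab_group_add)"
  unfolding pprt_def by (intro le_supI add_nonneg_nonneg sup_ge2) (simp_all add: diff_le_eq[symmetric])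

lemma pprt_diff_le: "0 \<le> a \<Longrightarrow> 0 \<le> b \<Longrightarrow> pprt (a - b) \<le> (a::'a::lattice_ab_group_add)"
  unfolding pprt_def by (intro le_supI) (auto simp: diff_le_eq)

lemma disjoint_seqI:
  fixes x :: "nat \<Rightarrow> 'a::banach_lattice"
  assumes "\<And>n. 0 \<le> x n" "\<And>m n. m < n \<Longrightarrow> inf (x m) (x n) = 0"
  shows "disjoint_seq x"
  unfolding disjoint_seq_def
proof (intro allI impI)
  fix m n :: nat assume "m \<noteq> n"
  then consider "m < n" | "n < m" by linarith
  then show "inf \<bar>x n\<bar> \<bar>x m\<bar> = 0" 
    using assms(2)[of m n] assms(2)[of n m] by cases (simp_all add: assms(1) inf.commute)
qed

lemma disjoint_seq_mono:
  assumes "disjoint_seq x" "\<And>n. \<bar>y n\<bar> \<le> \<bar>x n\<bar>"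
  shows "disjoint_seq y"
  using assms unfolding disjoint_seq_def by (meson abs_ge_zero disjoint_mono)

lemma disjoint_seq_subseq: "disjoint_seq x \<Longrightarrow> strict_mono r \<Longrightarrow> disjoint_seq (\<lambda>n. x (r n))"
  unfolding disjoint_seq_def by (auto simp: strict_mono_eq)

text \<open>The norm of the negative part of \<open>l\<close> is at most the distance from
  \<open>l\<close> to any nonnegative \<open>x n\<close>.\<close>

lemma nonneg_limit:
  fixes x :: "nat \<Rightarrow> 'a::banach_lattice"
  assumes "x \<longlonglongrightarrow> l" "\<forall>\<^sub>F n in sequentially. 0 \<le> x n"
  shows "0 \<le> l"
proof -
  have "(\<lambda>n. norm (x n - l)) \<longlonglongrightarrow> 0" using assms(1) by (simp add: LIM_zero tendsto_norm_zero)
  then have "norm (pprt (- l)) \<le> 0"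
  proof (rule tendsto_lowerbound)
    show "\<forall>\<^sub>F n in sequentially. norm (pprt (- l)) \<le> norm (x n - l)"
      using assms(2)
    proof eventually_elim
      case (elim n)
      have "- l \<le> x n - l" using elim by (simp add: le_diff_eq)
      also have "\<dots> \<le> \<bar>x n - l\<bar>" by (rule abs_ge_self)
      finally have "pprt (- l) \<le> \<bar>x n - l\<bar>" by (simp add: pprt_def)
      from norm_mono_nonneg[OF zero_le_pprt this] show ?case by (simp only: norm_abs_lattice)
    qed
  qed simp
  then have "nprt l = 0" by (simp add: pprt_neg)
  then show ?thesis by (simp add: zero_le_iff_zero_nprt)
qed

lemma le_sum_nonneg:
  fixes f :: "'i \<Rightarrow> 'a::ordered_comm_monoid_add"
  assumes "finite I" "i \<in> I" "\<And>j. j \<in> I \<Longrightarrow> 0 \<le> f j"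
  shows "f i \<le> (\<Sum>j\<in>I. f j)"
  unfolding sum.remove[OF assms(1,2)] using assms(3) by (intro add_increasing2 sum_nonneg) auto

lemma le_suminf:
  fixes f :: "nat \<Rightarrow> 'a::banach_lattice"
  assumes "summable f" "\<And>n. 0 \<le> f n"
  shows "f m \<le> suminf f"
proof -
  have "(\<lambda>n. (\<Sum>i<n. f i) - f m) \<longlonglongrightarrow> suminf f - f m"
    using assms(1) by (intro tendsto_intros summable_LIMSEQ)
  moreover have "\<forall>\<^sub>F n in sequentially. 0 \<le> (\<Sum>i<n. f i) - f m"
    using eventually_gt_at_top[of m]
  proof eventually_elim
    case (elim n)
    then have "f m \<le> (\<Sum>i<n. f i)" using assms(2) by (intro le_sum_nonneg) auto
    then show ?case by simp
  qed
  ultimately have "0 \<le> suminf f - f m" by (rule nonneg_limit)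
  then show ?thesis by simp
qed

lemma not_tendsto_zero_subseq:
  fixes a :: "nat \<Rightarrow> real"
  assumes "\<not> a \<longlonglongrightarrow> 0" "\<And>n. 0 \<le> a n"
  obtains e r where "0 < e" "strict_mono (r :: nat \<Rightarrow> nat)" "\<And>n. e \<le> a (r n)"
proof -
  obtain e where e: "0 < e" "\<exists>\<^sub>F n in sequentially. e \<le> a n"
    using assms by (auto simp: tendsto_iff not_eventually not_less)
  then have "infinite {n. e \<le> a n}"
    by (simp add: frequently_cofinite cofinite_eq_sequentially[symmetric])
  from infinite_enumerate[OF this] obtain r where "strict_mono (r :: nat \<Rightarrow> nat)" "\<And>n. e \<le> a (r n)"
    by auto
  then show thesis using that e(1) by blast
qed

section \<open>Monotone seminorms on the positive cone\<close>

locale monotone_seminorm =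
  fixes \<rho> :: "'a::banach_lattice \<Rightarrow> real" and C :: real
  assumes mono: "0 \<le> x \<Longrightarrow> x \<le> y \<Longrightarrow> \<rho> x \<le> \<rho> y"
    and add: "0 \<le> x \<Longrightarrow> 0 \<le> y \<Longrightarrow> \<rho> (x + y) \<le> \<rho> x + \<rho> y"
    and bound: "0 \<le> x \<Longrightarrow> \<rho> x \<le> C * norm x"
    and C_nonneg: "0 \<le> C"
begin

lemma zero: "\<rho> 0 = 0"
  using add[of 0 0] bound[of 0] by simp

lemma nonneg: "0 \<le> x \<Longrightarrow> 0 \<le> \<rho> x"
  using mono[of 0 x] by (simp add: zero)

lemma sum: "(\<And>i. i \<in> I \<Longrightarrow> 0 \<le> x i) \<Longrightarrow> \<rho> (\<Sum>i\<in>I. x i) \<le> (\<Sum>i\<in>I. \<rho> (x i))"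
proof (induction I rule: infinite_finite_induct)
  case (insert i I)
  then show ?case using add[of "x i" "\<Sum>i\<in>I. x i"] by (force simp: sum_nonneg)
qed (auto simp: zero)

lemma scale: "0 \<le> x \<Longrightarrow> \<rho> (real n *\<^sub>R x) \<le> real n * \<rho> x"
proof (induction n)
  case (Suc n)
  have "real (Suc n) *\<^sub>R x = x + real n *\<^sub>R x" by (simp add: scaleR_add_left)
  then show ?case using Suc add[of x "real n *\<^sub>R x"] by (simp add: scaleR_nonneg_nonneg distrib_right)
qed (simp add: zero)

definition disjoint_null :: "'a set \<Rightarrow> bool"
  where "disjoint_null S \<longleftrightarrow> (\<forall>y. disjoint_seq y \<longrightarrow> range y \<subseteq> S \<longrightarrow> (\<lambda>n. \<rho> (y n)) \<longlonglongrightarrow> 0)"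

text \<open>The positive cone of an order ideal. On its order intervals \<open>\<rho>\<close>
  behaves like an order continuous norm: monotone sequences there turn out to be Cauchy for
  \<open>\<rho>\<close>.\<close>

definition null_ideal :: "'a set"
  where "null_ideal = {u. 0 \<le> u \<and> disjoint_null {0..u}}"

lemma null_ideal_nonneg: "u \<in> null_ideal \<Longrightarrow> 0 \<le> u"
  by (simp add: null_ideal_def)

lemma null_ideal_zero: "0 \<in> null_ideal"
proof -
  have "(\<lambda>n. \<rho> (y n)) \<longlonglongrightarrow> 0" if "range y \<subseteq> {0}" for y :: "nat \<Rightarrow> 'a"
    using that by (simp add: image_subset_iff zero)
  then show ?thesis by (simp add: null_ideal_def disjoint_null_def)
qed

text \<open>A disjoint sequence below \<open>u + v\<close> is cut at \<open>u\<close>. The parts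
  below \<open>u\<close> and the remainders below \<open>v\<close> are dominated by the original
  terms, so both stay disjoint.\<close>

lemma null_ideal_add:
  assumes "u \<in> null_ideal" "v \<in> null_ideal"
  shows "u + v \<in> null_ideal"
  unfolding null_ideal_def disjoint_null_def
proof (intro CollectI conjI allI impI)
  show uv: "0 \<le> u + v" using assms by (simp add: null_ideal_nonneg)
  fix y assume y: "disjoint_seq y" "range y \<subseteq> {0..u + v}"
  have y': "0 \<le> y n" "y n \<le> u + v" for n using range_subsetD[OF y(2), of n] by auto
  define a where "a n = inf (y n) u" for n
  have a: "0 \<le> a n" "a n \<le> u" "a n \<le> y n" for n
    using y' null_ideal_nonneg[OF assms(1)] by (auto simp: a_def)
  have "y n - a n = sup 0 (y n - u)" for n
    unfolding a_def diff_inf_eq_sup add_sup_distrib_left by simp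
  then have b: "0 \<le> y n - a n" "y n - a n \<le> v" "y n - a n \<le> y n" for n
    using y'[of n] a(1,3)[of n] null_ideal_nonneg[OF assms(1)] null_ideal_nonneg[OF assms(2)]
    by (auto simp: diff_le_eq add.commute)
  have "disjoint_seq a" "disjoint_seq (\<lambda>n. y n - a n)"
    using a b y' by (auto intro!: disjoint_seq_mono[OF y(1)])
  then have "(\<lambda>n. \<rho> (a n)) \<longlonglongrightarrow> 0" "(\<lambda>n. \<rho> (y n - a n)) \<longlonglongrightarrow> 0"
    using assms a b unfolding null_ideal_def disjoint_null_def by (auto simp: image_subset_iff)
  then have lim: "(\<lambda>n. \<rho> (a n) + \<rho> (y n - a n)) \<longlonglongrightarrow> 0"
    by (intro tendsto_add_zero)
  have le: "\<rho> (y n) \<le> \<rho> (a n) + \<rho> (y n - a n)" for n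
    using add[OF a(1) b(1), of n n] by simp
  show "(\<lambda>n. \<rho> (y n)) \<longlonglongrightarrow> 0"
    by (rule tendsto_sandwich[OF _ _ tendsto_const lim]) (use le nonneg[OF y'(1)] in auto)
qed

lemma null_ideal_scale: "u \<in> null_ideal \<Longrightarrow> real n *\<^sub>R u \<in> null_ideal"
  by (induction n) (auto simp: null_ideal_zero null_ideal_add scaleR_add_left)

end

text \<open>Three kinds of \<open>S\<close> occur: the positive part of the solid hull of
  \<open>A\<close>, the positive part of the unit ball, and the interval \<open>{0..u}\<close> for
  \<open>u\<close> in \<open>null_ideal\<close>.\<close>

locale disjoint_null_set = monotone_seminorm +
  fixes S :: "'a set" and M :: real
  assumes null: "disjoint_null S"
    and S_nonneg: "x \<in> S \<Longrightarrow> 0 \<le> x"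
    and S_solid: "x \<in> S \<Longrightarrow> 0 \<le> y \<Longrightarrow> y \<le> x \<Longrightarrow> y \<in> S"
    and S_bounded: "x \<in> S \<Longrightarrow> norm x \<le> M"
begin

lemma S_subset_null_ideal: "x \<in> S \<Longrightarrow> x \<in> null_ideal"
proof -
  assume x: "x \<in> S"
  then have "{0..x} \<subseteq> S" using S_solid by auto
  then show ?thesis using null S_nonneg[OF x] unfolding null_ideal_def disjoint_null_def by blast
qed

text \<open>Subtracting a small multiple of \<open>W\<close> removes what \<open>w n\<close> has in common with later
  terms; the large multiple of the finite sum removes what it has in common with earlier ones.\<close>

lemma disjointification:
  assumes w: "\<And>n. w n \<in> S" and d: "0 < d"
    and big: "\<And>m. d \<le> \<rho> (pprt (w m - 4 ^ m *\<^sub>R (\<Sum>j<m. inf (w j) (w m))))"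
  shows False
proof -
  have w0: "0 \<le> w n" for n using w S_nonneg by blast
  \<comment> \<open>One element that dominates \<open>(1 / 2) ^ n *\<^sub>R w n\<close> for all
    \<open>n\<close> at once; the series converges because \<open>S\<close> is norm bounded.\<close>
  define W where "W = (\<Sum>n. (1 / 2) ^ n *\<^sub>R w n)"
  have sm: "summable (\<lambda>n. (1 / 2) ^ n *\<^sub>R w n)"
  proof (rule summable_comparison_test')
    show "summable (\<lambda>n. M * (1 / 2) ^ n :: real)" by (intro summable_mult summable_geometric) simp
    show "norm ((1 / 2) ^ n *\<^sub>R w n) \<le> M * (1 / 2) ^ n" if "0 \<le> n" for n
      using S_bounded[OF w, of n] by (simp add: mult.commute mult_left_mono power_divide divide_right_mono)
  qed
  have leW: "(1 / 2) ^ n *\<^sub>R w n \<le> W" for n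
    unfolding W_def by (rule le_suminf[OF sm]) (simp add: w0 scaleR_nonneg_nonneg)
  have W0: "0 \<le> W" using leW[of 0] w0[of 0] by simp
  define B where "B m = 4 ^ m *\<^sub>R (\<Sum>j<m. inf (w j) (w m))" for m
  have B0: "0 \<le> B m" for m by (auto simp: B_def w0 intro!: scaleR_nonneg_nonneg sum_nonneg)
  define y where "y m = pprt (w m - B m - (1 / 2) ^ m *\<^sub>R W)" for m
  have hW: "0 \<le> (1 / 2) ^ m *\<^sub>R W" for m using W0 by (simp add: scaleR_nonneg_nonneg)
  have yw: "y m \<le> w m" for m
    unfolding y_def pprt_def using w0[of m] B0[of m] hW[of m]
    by (intro le_supI) (auto simp: diff_le_eq add_increasing2 intro: add_increasing2)
  have dis: "inf (y n) (y m) = 0" if nm: "n < m" for n m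
  proof (rule disjoint_mono)
    \<comment> \<open>\<open>W\<close> dominates \<open>(1 / 2) ^ m *\<^sub>R w m\<close>, so the
      multiple of \<open>W\<close> removed from \<open>w n\<close> covers
      \<open>c *\<^sub>R w m\<close>. The factor \<open>4 ^ m\<close> is large enough since
      \<open>c * 4 ^ m = 2 ^ (m - n)\<close>.\<close>
    define c where "c = (1 / 2) ^ n * (1 / 2 :: real) ^ m"
    have c1: "c \<le> 1" by (auto simp: c_def intro!: mult_le_one power_le_one)
    have "(2::real) ^ n \<le> 2 ^ m" using nm by (intro power_increasing) auto
    then have c4: "1 \<le> c * 4 ^ m"
      using power_mult_distrib[of 2 "2::real" m] by (simp add: c_def power_divide field_simps)
    show "inf (pprt (w n - c *\<^sub>R w m)) (pprt (w m - 4 ^ m *\<^sub>R inf (w n) (w m))) = 0"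
      by (rule disjoint_pprt_diff[OF w0 w0 _ c1 c4]) (simp add: c_def)
    have "c *\<^sub>R w m \<le> (1 / 2) ^ n *\<^sub>R W"
      using scaleR_left_mono[OF leW[of m], of "(1 / 2) ^ n"] by (simp add: c_def)
    also have "\<dots> \<le> B n + (1 / 2) ^ n *\<^sub>R W" using B0 by simp
    finally show "y n \<le> pprt (w n - c *\<^sub>R w m)"
      unfolding y_def by (intro pprt_mono) (simp add: diff_diff_eq diff_left_mono)
    have "inf (w n) (w m) \<le> (\<Sum>j<m. inf (w j) (w m))"
      using nm w0 by (intro le_sum_nonneg) auto
    then have "4 ^ m *\<^sub>R inf (w n) (w m) \<le> B m" unfolding B_def by (intro scaleR_left_mono) auto
    also have "\<dots> \<le> B m + (1 / 2) ^ m *\<^sub>R W" using hW by simp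
    finally show "y m \<le> pprt (w m - 4 ^ m *\<^sub>R inf (w n) (w m))"
      unfolding y_def by (intro pprt_mono) (simp add: diff_diff_eq diff_left_mono)
  qed (auto simp: y_def)
  have "disjoint_seq y" by (rule disjoint_seqI) (use dis in \<open>auto simp: y_def\<close>)
  moreover have "range y \<subseteq> S" using S_solid[OF w _ yw] by (auto simp: y_def)
  ultimately have "(\<lambda>n. \<rho> (y n)) \<longlonglongrightarrow> 0" using null by (auto simp: disjoint_null_def)
  moreover have "(\<lambda>n. C * ((1 / 2) ^ n * norm W)) \<longlonglongrightarrow> C * (0 * norm W)"
    by (intro tendsto_intros) simp
  ultimately have "(\<lambda>n. \<rho> (y n) + C * ((1 / 2) ^ n * norm W)) \<longlonglongrightarrow> 0 + C * (0 * norm W)"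
    by (rule tendsto_add)
  \<comment> \<open>Removing the multiple of \<open>W\<close> costs at most
    \<open>C * (1 / 2) ^ n * norm W\<close>, which tends to 0; hence \<open>\<rho> (y n)\<close>
    cannot tend to 0.\<close>
  moreover have "d \<le> \<rho> (y n) + C * ((1 / 2) ^ n * norm W)" for n
  proof -
    have "d \<le> \<rho> (pprt (w n - B n))" using big by (simp add: B_def)
    also have "\<dots> \<le> \<rho> (y n + (1 / 2) ^ n *\<^sub>R W)"
      unfolding y_def by (intro mono pprt_le_add hW) simp
    also have "\<dots> \<le> \<rho> (y n) + \<rho> ((1 / 2) ^ n *\<^sub>R W)" by (intro add hW) (simp add: y_def)
    also have "\<rho> ((1 / 2) ^ n *\<^sub>R W) \<le> C * norm ((1 / 2) ^ n *\<^sub>R W)" by (intro bound hW)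
    finally show ?thesis by simp
  qed
  ultimately have "d \<le> 0" using LIMSEQ_le_const by fastforce
  then show False using d by simp
qed

text \<open>A subsequence is chosen so sparse that the overlaps of each term with the earlier ones
  remain small even after the amplification by \<open>4 ^ m\<close> in
  \<open>disjointification\<close>.\<close>

lemma no_almost_disjoint_seq:
  assumes w: "\<And>n. w n \<in> S" and d: "0 < d" "\<And>n. d \<le> \<rho> (w n)"
    and lim: "\<And>n. (\<lambda>m. \<rho> (inf (w n) (w m))) \<longlonglongrightarrow> 0"
  shows False
proof -
  have w0: "0 \<le> w n" for n using w S_nonneg by blast
  \<comment> \<open>Chosen so that \<open>4 ^ m\<close> times the sum of \<open>m\<close> overlaps
    is at most \<open>d / 2\<close>; \<open>Suc m\<close> avoids a zero denominator at
    \<open>m = 0\<close>.\<close>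
  define e where "e m = d / 2 / (4 ^ m * real (Suc m))" for m
  have e: "0 < e m" for m using d by (simp add: e_def)
  have "\<exists>i>K. \<forall>j\<le>K. \<rho> (inf (w j) (w i)) < e m" for K m
  proof -
    have "\<forall>\<^sub>F i in sequentially. \<rho> (inf (w j) (w i)) < e m" for j
      using order_tendstoD(2)[OF lim e] by blast
    then have "\<forall>\<^sub>F i in sequentially. \<forall>j\<in>{..K}. \<rho> (inf (w j) (w i)) < e m"
      by (intro eventually_ball_finite) auto
    then have "\<forall>\<^sub>F i in sequentially. K < i \<and> (\<forall>j\<in>{..K}. \<rho> (inf (w j) (w i)) < e m)"
      by (intro eventually_conj eventually_gt_at_top)
    then show ?thesis using eventually_happens'[OF sequentially_bot] by blast
  qed
  then obtain f where f: "\<And>K m. K < f K m" "\<And>K m j. j \<le> K \<Longrightarrow> \<rho> (inf (w j) (w (f K m))) < e m"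
    by metis
  \<comment> \<open>The index \<open>r (Suc m)\<close> is selected with tolerance
    \<open>e (Suc m)\<close> against all indices up to \<open>r m\<close>, hence against all those
    selected before.\<close>
  define r where "r = rec_nat 0 (\<lambda>m K. f K (Suc m))"
  have r: "r (Suc m) = f (r m) (Suc m)" for m by (simp add: r_def)
  have sm: "strict_mono r" by (rule strict_monoI_Suc) (simp add: r f)
  have small: "\<rho> (inf (w (r j)) (w (r m))) \<le> e m" if jm: "j < m" for j m
  proof -
    obtain k where k: "m = Suc k" using jm by (cases m) auto
    then have "r j \<le> r k" using jm sm by (simp add: strict_mono_less_eq)
    then show ?thesis using f(2) by (simp add: k r less_imp_le)
  qed
  show False
  proof (rule disjointification[of "\<lambda>n. w (r n)" "d / 2"])
    fix m
    let ?I = "\<lambda>j. inf (w (r j)) (w (r m))"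
    let ?B = "4 ^ m *\<^sub>R (\<Sum>j<m. ?I j)"
    have s0: "0 \<le> (\<Sum>j<m. ?I j)" using w0 by (intro sum_nonneg) simp
    have "\<rho> ?B \<le> 4 ^ m * \<rho> (\<Sum>j<m. ?I j)" using scale[OF s0, of "4 ^ m"] by simp
    also have "\<dots> \<le> 4 ^ m * (\<Sum>j<m. \<rho> (?I j))" using w0 by (intro mult_left_mono sum) auto
    also have "\<dots> \<le> 4 ^ m * (\<Sum>j<m. e m)" by (intro mult_left_mono sum_mono small) auto
    also have "\<dots> \<le> 4 ^ m * (real (Suc m) * e m)" using e[of m] by simp
    also have "\<dots> = d / 2" by (simp add: e_def del: of_nat_Suc)
    finally have "\<rho> ?B \<le> d / 2" .
    moreover have B0: "0 \<le> ?B" using s0 by (simp add: scaleR_nonneg_nonneg)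
    have "\<rho> (w (r m)) \<le> \<rho> (pprt (w (r m) - ?B) + ?B)"
      using w0 pprt_le_add[OF B0, of "w (r m)"] by (intro mono) auto
    moreover have "\<dots> \<le> \<rho> (pprt (w (r m) - ?B)) + \<rho> ?B" by (intro add B0) simp
    ultimately show "d / 2 \<le> \<rho> (pprt (w (r m) - ?B))" using d(2)[of "r m"] by linarith
  qed (use w d in auto)
qed

text \<open>If no \<open>u\<close> works, terms can be picked greedily: \<open>w n\<close> in
  \<open>S\<close> sticks out of \<open>4 ^ n\<close> times the sum of its predecessors, which is
  still in \<open>null_ideal\<close>. That sum dominates the sum of the overlaps, so
  \<open>disjointification\<close> applies.\<close>

lemma approximate_in_null_ideal:
  assumes e: "0 < e"
  shows "\<exists>u\<in>null_ideal. \<forall>x\<in>S. \<rho> (pprt (x - u)) < e"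
proof (rule ccontr)
  assume "\<not> ?thesis"
  then have "\<exists>x. x \<in> S \<and> e \<le> \<rho> (pprt (x - u))" if "u \<in> null_ideal" for u
    using that by (auto simp: not_less)
  then obtain \<phi> where \<phi>: "\<And>u. u \<in> null_ideal \<Longrightarrow> \<phi> u \<in> S" "\<And>u. u \<in> null_ideal \<Longrightarrow> e \<le> \<rho> (pprt (\<phi> u - u))"
    by metis
  define s where "s = rec_nat 0 (\<lambda>n t. t + \<phi> (4 ^ n *\<^sub>R t))"
  define w where "w n = \<phi> (4 ^ n *\<^sub>R s n)" for n
  have s0: "s 0 = 0" and sS: "s (Suc n) = s n + w n" for n by (simp_all add: s_def w_def)
  have sc: "4 ^ n *\<^sub>R u \<in> null_ideal" if "u \<in> null_ideal" for u n using null_ideal_scale[OF that, of "4 ^ n"] by simp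
  have sN: "s n \<in> null_ideal" for n
  proof (induction n)
    case (Suc n)
    then show ?case unfolding sS w_def by (intro null_ideal_add) (auto intro: S_subset_null_ideal \<phi>(1) sc)
  qed (simp add: s0 null_ideal_zero)
  have s_sum: "s n = (\<Sum>j<n. w j)" for n by (induction n) (auto simp: s0 sS)
  have wS: "w n \<in> S" for n by (simp add: w_def \<phi> sc sN)
  show False
  proof (rule disjointification[OF wS e])
    fix m
    have "(\<Sum>j<m. inf (w j) (w m)) \<le> s m" unfolding s_sum by (intro sum_mono) simp
    then have "4 ^ m *\<^sub>R (\<Sum>j<m. inf (w j) (w m)) \<le> 4 ^ m *\<^sub>R s m" by (intro scaleR_left_mono) auto
    then have "pprt (w m - 4 ^ m *\<^sub>R s m) \<le> pprt (w m - 4 ^ m *\<^sub>R (\<Sum>j<m. inf (w j) (w m)))"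
      by (intro pprt_mono diff_left_mono)
    then have "\<rho> (pprt (w m - 4 ^ m *\<^sub>R s m)) \<le> \<rho> (pprt (w m - 4 ^ m *\<^sub>R (\<Sum>j<m. inf (w j) (w m))))"
      by (intro mono) auto
    then show "e \<le> \<rho> (pprt (w m - 4 ^ m *\<^sub>R (\<Sum>j<m. inf (w j) (w m))))"
      using \<phi>(2)[OF sc[OF sN], of m m] by (simp add: w_def)
  qed
qed

end

section \<open>Monotone sequences in order intervals of the null ideal\<close>

context monotone_seminorm
begin

lemma disjoint_null_set_interval:
  assumes "u \<in> null_ideal"
  shows "disjoint_null_set \<rho> C {0..u} (norm u)"
  using assms by unfold_locales (auto simp: null_ideal_def intro: norm_mono_nonneg)

text \<open>Induction on the number of terms that may overlap. The meets of a fixed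
  \<open>w n\<close> with later terms overlap one fewer at a time, so they are null by induction; a
  sequence that is not null would then have an almost disjoint subsequence with large terms.\<close>

lemma finitely_overlapping_null:
  assumes u: "u \<in> null_ideal" and w: "\<And>n. 0 \<le> w n" "\<And>n. w n \<le> u"
    and dis: "\<And>I t. finite I \<Longrightarrow> card I = Suc k \<Longrightarrow> 0 \<le> t \<Longrightarrow> (\<And>i. i \<in> I \<Longrightarrow> t \<le> w i) \<Longrightarrow> t = 0"
  shows "(\<lambda>n. \<rho> (w n)) \<longlonglongrightarrow> 0"
  using w dis
proof (induction k arbitrary: w)
  case 0
  have "w n = 0" for n using 0(3)[of "{n}" "w n"] 0(1) by simp
  then show ?case by (simp add: zero)
next
  case (Suc k)
  interpret disjoint_null_set \<rho> C "{0..u}" "norm u" by (rule disjoint_null_set_interval[OF u])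
  show ?case
  proof (rule ccontr)
    assume "\<not> ?case"
    then obtain e r where e: "0 < e" and r: "strict_mono (r :: nat \<Rightarrow> nat)" and er: "\<And>n. e \<le> \<rho> (w (r n))"
      using Suc.prems(1) by (elim not_tendsto_zero_subseq) (auto intro: nonneg)
    have inj: "r i = r j \<longleftrightarrow> i = j" for i j using r by (simp add: strict_mono_eq)
    show False
    proof (rule no_almost_disjoint_seq[OF _ e er])
      show "w (r n) \<in> {0..u}" for n using Suc.prems by simp
      fix n
      \<comment> \<open>The shift by \<open>Suc n\<close> keeps \<open>r n\<close> apart from the
        other indices, so adding it to \<open>I\<close> raises the cardinality by one.\<close>
      have "(\<lambda>m. \<rho> (inf (w (r n)) (w (r (m + Suc n))))) \<longlonglongrightarrow> 0"
      proof (rule Suc.IH)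
        show "0 \<le> inf (w (r n)) (w (r (m + Suc n)))" "inf (w (r n)) (w (r (m + Suc n))) \<le> u" for m
          using Suc.prems(1,2) by (auto intro: le_infI1)
        fix I t
        assume I: "finite I" "card I = Suc k" and t: "0 \<le> t" "\<And>i. i \<in> I \<Longrightarrow> t \<le> inf (w (r n)) (w (r (i + Suc n)))"
        let ?J = "insert (r n) ((\<lambda>i. r (i + Suc n)) ` I)"
        have "card ((\<lambda>i. r (i + Suc n)) ` I) = Suc k"
          using I(2) by (subst card_image) (auto simp: inj_on_def inj)
        then have J: "finite ?J" "card ?J = Suc (Suc k)" using I(1) by (auto simp: card_insert_if inj)
        obtain i where "i \<in> I" using I(2) by fastforce
        then have tn: "t \<le> w (r n)" using t(2)[of i] by simp
        show "t = 0" by (rule Suc.prems(3)[OF J t(1)]) (use t(2) tn in auto)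
      qed
      then show "(\<lambda>m. \<rho> (inf (w (r n)) (w (r m)))) \<longlonglongrightarrow> 0" by (rule LIMSEQ_offset)
    qed
  qed
qed


text \<open>As the sum stays below \<open>u\<close>, at most \<open>k\<close> summands can exceed
  \<open>u / (k + 1)\<close> at the same place. Cutting off \<open>c *\<^sub>R u\<close> thus leaves
  a sequence of bounded overlap, at a cost of at most \<open>e / 2\<close>.\<close>

lemma summands_null:
  assumes u: "u \<in> null_ideal" and z: "\<And>n. 0 \<le> z n" "\<And>n. (\<Sum>i<n. z i) \<le> u"
  shows "(\<lambda>n. \<rho> (z n)) \<longlonglongrightarrow> 0"
proof (rule ccontr)
  assume "\<not> ?thesis"
  then obtain e r where e: "0 < e" and r: "strict_mono (r :: nat \<Rightarrow> nat)" and er: "\<And>n. e \<le> \<rho> (z (r n))"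
    using z(1) by (elim not_tendsto_zero_subseq) (auto intro: nonneg)
  have u0: "0 \<le> u" by (rule null_ideal_nonneg[OF u])
  have fin: "(\<Sum>i\<in>I. z i) \<le> u" if I: "finite I" for I
  proof -
    obtain n where "I \<subseteq> {..<n}" using finite_nat_bounded[OF I] by blast
    then have "(\<Sum>i\<in>I. z i) \<le> (\<Sum>i<n. z i)" using z(1) by (intro sum_mono2) auto
    then show ?thesis using z(2) order_trans by blast
  qed
  \<comment> \<open>Makes \<open>\<rho> (c *\<^sub>R u) \<le> C * norm u / (k + 1) \<le> e /
    2\<close>.\<close>
  obtain k :: nat where k: "2 * (C * norm u) / e \<le> real (Suc k)"
    by (meson le_SucI of_nat_mono order_trans real_arch_simple lessI less_imp_le)
  define c where "c = 1 / real (Suc k)"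
  have c: "0 < c" "real (Suc k) * c = 1" by (simp_all add: c_def)
  have cu0: "0 \<le> c *\<^sub>R u" using c u0 by (simp add: scaleR_nonneg_nonneg)
  have "\<rho> (c *\<^sub>R u) \<le> C * norm (c *\<^sub>R u)" by (rule bound[OF cu0])
  also have "\<dots> = C * norm u / real (Suc k)" by (simp add: c_def)
  also have "\<dots> \<le> e / 2" using k e by (simp add: field_simps del: of_nat_Suc)
  finally have cu: "\<rho> (c *\<^sub>R u) \<le> e / 2" .
  define w where "w n = pprt (z (r n) - c *\<^sub>R u)" for n
  have big: "e / 2 \<le> \<rho> (w n)" for n
  proof -
    have "\<rho> (z (r n)) \<le> \<rho> (w n + c *\<^sub>R u)"
      using pprt_le_add[OF cu0, of "z (r n)"] z(1) by (intro mono) (simp_all add: w_def)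
    also have "\<dots> \<le> \<rho> (w n) + \<rho> (c *\<^sub>R u)" by (rule add[OF _ cu0]) (simp add: w_def)
    finally show ?thesis using er[of n] cu by linarith
  qed
  have "(\<lambda>n. \<rho> (w n)) \<longlonglongrightarrow> 0"
  proof (rule finitely_overlapping_null[OF u])
    show "0 \<le> w n" for n by (simp add: w_def)
    have "w n \<le> z (r n)" for n unfolding w_def by (rule pprt_diff_le[OF z(1) cu0])
    moreover have "z (r n) \<le> u" for n using fin[of "{r n}"] by simp
    ultimately show "w n \<le> u" for n using order_trans by blast
  next
    fix I t assume I: "finite I" "card I = Suc k" and t: "0 \<le> t" "\<And>i. i \<in> I \<Longrightarrow> t \<le> w i"
    \<comment> \<open>The \<open>k + 1\<close> differences sum to at most 0, so their positive parts
      sum to at most their negative parts. Now \<open>t\<close> lies below each positive part, hence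
      below the sum of the negative parts, yet it is disjoint from every one of them.\<close>
    let ?a = "\<lambda>i. z (r i) - c *\<^sub>R u"
    have "(\<Sum>i\<in>I. z (r i)) = (\<Sum>i\<in>r ` I. z i)"
      using r by (subst sum.reindex) (auto simp: strict_mono_imp_inj_on inj_on_subset)
    also have "\<dots> \<le> u" using I(1) by (intro fin) simp
    also have "u = (\<Sum>i\<in>I. c *\<^sub>R u)"
      using c(2) unfolding scaleR_left.sum[symmetric] by (simp add: I(2))
    finally have "(\<Sum>i\<in>I. ?a i) \<le> 0" by (simp add: sum_subtractf)
    moreover have "(\<Sum>i\<in>I. ?a i) = (\<Sum>i\<in>I. pprt (?a i)) - (\<Sum>i\<in>I. pprt (- ?a i))"
      unfolding sum_subtractf[symmetric] by (intro sum.cong refl) (simp add: pprt_neg prts[symmetric] del: minus_diff_eq)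
    ultimately have le: "(\<Sum>i\<in>I. pprt (?a i)) \<le> (\<Sum>i\<in>I. pprt (- ?a i))" by simp
    have "inf t (\<Sum>i\<in>I. pprt (- ?a i)) = 0"
    proof (rule disjoint_sum[OF t(1)])
      show "inf t (pprt (- ?a i)) = 0" if "i \<in> I" for i
        by (rule disjoint_mono[OF t(1) t(2)[OF that] _ order_refl]) (simp_all add: w_def inf_pprt_uminus del: minus_diff_eq)
    qed simp
    moreover obtain i where i: "i \<in> I" using I(2) by fastforce
    have "t \<le> (\<Sum>i\<in>I. pprt (?a i))"
      using t(2)[OF i] le_sum_nonneg[OF I(1) i, of "\<lambda>i. pprt (?a i)"] by (simp add: w_def)
    then have "t \<le> (\<Sum>i\<in>I. pprt (- ?a i))" using le by (rule order_trans)
    ultimately show "t = 0" by (simp add: inf_absorb1)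
  qed
  then have "e / 2 \<le> 0" by (rule LIMSEQ_le_const) (use big in auto)
  then show False using e by simp
qed

text \<open>Failure would give, by iteration, infinitely many increments of
  \<open>\<rho>\<close>-size at least \<open>e\<close> whose partial sums stay below
  \<open>u\<close>.\<close>

lemma incseq_Cauchy:
  assumes u: "u \<in> null_ideal" and x: "\<And>n. 0 \<le> x n" "\<And>n. x n \<le> u" "\<And>n. x n \<le> x (Suc n)" and e: "0 < e"
  shows "\<exists>K. \<forall>m\<ge>K. \<rho> (x m - x K) < e"
proof (rule ccontr)
  assume "\<not> ?thesis"
  then obtain f where f: "\<And>K. K \<le> f K" "\<And>K. e \<le> \<rho> (x (f K) - x K)" by (metis not_less)
  have le: "x m \<le> x n" if "m \<le> n" for m n using lift_Suc_mono_le[of x, OF x(3) that] .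
  define r where "r n = (f ^^ n) 0" for n
  have r: "r (Suc n) = f (r n)" for n by (simp add: r_def)
  have "(\<lambda>n. \<rho> (x (r (Suc n)) - x (r n))) \<longlonglongrightarrow> 0"
  proof (rule summands_null[OF u])
    show "0 \<le> x (r (Suc n)) - x (r n)" for n using le[OF f(1)] by (simp add: r)
    show "(\<Sum>i<n. x (r (Suc i)) - x (r i)) \<le> u" for n
      using add_mono[OF x(2)[of "r n"] x(1)[of "r 0"]]
      by (subst sum_lessThan_telescope[of "\<lambda>i. x (r i)"]) (simp add: diff_le_eq)
  qed
  then have "e \<le> 0" by (rule LIMSEQ_le_const) (use f(2) r in auto)
  then show False using e by simp
qed

end

section \<open>Disjoint positive functionals on the null ideal\<close>

lemma blinfun_nonneg: "0 \<le> f \<Longrightarrow> 0 \<le> x \<Longrightarrow> 0 \<le> blinfun_apply f x"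
  for f :: "'a::banach_lattice \<Rightarrow>\<^sub>L real"
  by (simp add: less_eq_blinfun_def)

lemma blinfun_mono: "0 \<le> f \<Longrightarrow> x \<le> y \<Longrightarrow> blinfun_apply f x \<le> blinfun_apply f y"
  for f :: "'a::banach_lattice \<Rightarrow>\<^sub>L real"
  using blinfun_nonneg[of f "y - x"] by (simp add: blinfun.diff_right)

text \<open>Disjointness makes \<open>f\<close> the positive part of \<open>f - g\<close>. A
  \<open>v\<close> nearly attaining its value at \<open>x\<close> leaves the error
  \<open>f (x - v) + g v\<close>, a sum of two nonnegative terms.\<close>

lemma disjoint_functionals:
  fixes f g :: "'a::banach_lattice \<Rightarrow>\<^sub>L real"
  assumes fg: "inf f g = 0" and x: "0 \<le> x" and e: "0 < e"
  obtains v where "0 \<le> v" "v \<le> x" "f (x - v) < e" "g v < e"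
proof -
  have f: "0 \<le> f" and g: "0 \<le> g" using fg inf_le1 inf_le2 by metis+
  obtain h where h: "0 \<le> h" "f - g \<le> h" "\<And>k. 0 \<le> k \<Longrightarrow> f - g \<le> k \<Longrightarrow> h \<le> k"
    and app: "\<And>x e. 0 \<le> x \<Longrightarrow> 0 < e \<Longrightarrow> \<exists>y. 0 \<le> y \<and> y \<le> x \<and> norm (h x - (f - g) y) < e"
    using blinfun_pos_part[of "f - g"] by metis
  have "f - h \<le> inf f g" using h(1,2) by (intro le_infI) (simp_all add: diff_le_eq add.commute)
  then have "h = f" using h(3)[OF f] f g fg by (intro antisym) (simp_all add: diff_le_eq)
  then obtain v where v: "0 \<le> v" "v \<le> x" "norm (f x - (f - g) v) < e" using app[OF x e] by blast
  then have "f (x - v) + g v < e" by (simp add: blinfun.diff_right blinfun.diff_left)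
  moreover have "0 \<le> f (x - v)" "0 \<le> g v" using v f g by (simp_all add: blinfun_nonneg)
  ultimately show thesis by (intro that[OF v(1,2)]) linarith+
qed

context monotone_seminorm
begin

text \<open>The functionals \<open>g n\<close> live on almost disjoint parts \<open>v n\<close> of \<open>u\<close>. The elements \<open>t n\<close> imitate
  \<open>limsup v\<close>, which need not exist: they are bounded below on \<open>g n\<close>, but \<open>g k (t n)\<close> tends to \<open>0\<close>
  for every \<open>k\<close>, contradicting that decreasing sequences in \<open>{0..u}\<close> are Cauchy for \<open>\<rho>\<close>.\<close>

lemma no_disjoint_functionals_large_on_null_ideal:
  fixes g :: "nat \<Rightarrow> 'a \<Rightarrow>\<^sub>L real"
  assumes u: "u \<in> null_ideal" and g: "\<And>n. 0 \<le> g n" "\<And>m n. m < n \<Longrightarrow> inf (g n) (g m) = 0"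
    and le: "\<And>n x. 0 \<le> x \<Longrightarrow> g n x \<le> \<rho> x"
    and e: "0 < e" "\<And>n. e \<le> g n u"
  shows False
proof -
  note u0 = null_ideal_nonneg[OF u]
  \<comment> \<open>The tolerances sum to \<open>e / 8\<close>. The lower bound for
    \<open>g m (t m)\<close> loses at most \<open>d m + 2 * d 0 \<le> 3 * e / 16\<close>, leaving
    \<open>3 * e / 4\<close>; the final upper bound \<open>e / 4 + 2 * d (Suc k)\<close> is at most
    \<open>3 * e / 8\<close>.\<close>
  define d where "d n = e / 16 * (1 / 2) ^ n" for n
  have d: "0 < d n" for n using e by (simp add: d_def)
  have d_sum: "(\<Sum>i<m. d (n + i)) \<le> 2 * d n" for n m
  proof -
    have "(\<Sum>i<m. (1 / 2 :: real) ^ i) \<le> 2" by (simp add: sum_gp_strict)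
    then have "d n * (\<Sum>i<m. (1 / 2) ^ i) \<le> d n * 2" using d[of n] by (intro mult_left_mono) auto
    then show ?thesis by (simp add: d_def power_add sum_distrib_left mult.assoc)
  qed
  have d_le: "d n \<le> e / 16" for n using e by (simp add: d_def mult_left_le power_le_one)
  \<comment> \<open>Almost all of \<open>g n u\<close> is carried by \<open>v n\<close>, while all
    earlier functionals nearly vanish there.\<close>
  have "\<exists>v. 0 \<le> v \<and> v \<le> u \<and> g n (u - v) < d n \<and> (\<Sum>i<n. g i) v < d n" for n
  proof -
    have "inf (g n) (\<Sum>i<n. g i) = 0" by (rule disjoint_sum) (use g in auto)
    from disjoint_functionals[OF this u0 d[of n]] show ?thesis by metis
  qed
  then obtain v where v: "\<And>n. 0 \<le> v n" "\<And>n. v n \<le> u" "\<And>n. g n (u - v n) < d n"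
      and v': "\<And>n. (\<Sum>i<n. g i) (v n) < d n" by metis
  have gv: "g i (v n) \<le> d n" if "i < n" for i n
  proof -
    have "g i \<le> (\<Sum>i<n. g i)" using that g(1) by (intro le_sum_nonneg) auto
    then have "g i (v n) \<le> (\<Sum>i<n. g i) (v n)" using v(1) by (simp add: less_eq_blinfun_def)
    then show ?thesis using v'[of n] by simp
  qed
  define s where "s n = rec_nat (v n) (\<lambda>m t. sup t (v (n + Suc m)))" for n
  have s0: "s n 0 = v n" and sS: "s n (Suc m) = sup (s n m) (v (n + Suc m))" for n m
    by (simp_all add: s_def)
  have s: "0 \<le> s n m" "s n m \<le> u" for n m
    by (induction m) (auto simp: s0 sS v intro: le_supI1)
  have s_mono: "s n m \<le> s n m'" if "m \<le> m'" for n m m'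
    by (rule lift_Suc_mono_le[OF _ that]) (simp add: sS)
  have v_le_s: "v (n + j) \<le> s n m" if "j \<le> m" for n j m
  proof -
    have "v (n + j) \<le> s n j" by (cases j) (simp_all add: s0 sS)
    then show ?thesis using s_mono[OF that] order_trans by blast
  qed
  have s_le: "s n m \<le> (\<Sum>j<Suc m. v (n + j))" for n m
  proof (induction m)
    case (Suc m)
    have "s n (Suc m) \<le> s n m + v (n + Suc m)"
      unfolding sS using s(1)[of n m] v(1)[of "n + Suc m"] by (intro le_supI) auto
    also have "\<dots> \<le> (\<Sum>j<Suc m. v (n + j)) + v (n + Suc m)" using Suc by (intro add_right_mono)
    finally show ?case by simp
  qed (simp add: s0)
  have "\<exists>K. \<forall>m\<ge>K. \<rho> (s n m - s n K) < d n" for n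
    by (rule incseq_Cauchy[OF u s _ d]) (simp add: sS)
  then obtain K where K: "\<And>n m. K n \<le> m \<Longrightarrow> \<rho> (s n m - s n (K n)) < d n" by metis
  \<comment> \<open>A substitute for the supremum of the tail \<open>v n, v (n + 1), ...\<close>:
    prolonging the finite supremum beyond \<open>K n\<close> changes it by less than
    \<open>d n\<close> in \<open>\<rho>\<close>.\<close>
  define S where "S n = s n (K n)" for n
  have g_S: "g k (S n) \<le> 2 * d n" if "k < n" for k n
  proof -
    have "g k (S n) \<le> g k (\<Sum>j<Suc (K n). v (n + j))"
      unfolding S_def by (intro blinfun_mono g s_le)
    also have "\<dots> = (\<Sum>j<Suc (K n). g k (v (n + j)))" by (simp only: blinfun.sum_right)
    also have "\<dots> \<le> (\<Sum>j<Suc (K n). d (n + j))" using that by (intro sum_mono gv) simp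
    finally show ?thesis using d_sum[of n "Suc (K n)"] by linarith
  qed
  have \<rho>_S: "\<rho> (pprt (v m - S i)) \<le> d i" if "i \<le> m" for i m
  proof -
    define q where "q = max (K i) (m - i)"
    have "v m \<le> s i q" using v_le_s[of "m - i" q i] that by (simp add: q_def)
    moreover have "S i \<le> s i q" unfolding S_def by (rule s_mono) (simp add: q_def)
    ultimately have "pprt (v m - S i) \<le> s i q - S i" by (simp add: pprt_def diff_right_mono)
    then have "\<rho> (pprt (v m - S i)) \<le> \<rho> (s i q - S i)" by (intro mono) auto
    also have "\<dots> < d i" unfolding S_def by (rule K) (simp add: q_def)
    finally show ?thesis by simp
  qed
  \<comment> \<open>The sets of indices behind the \<open>S n\<close> are finite, so the
    \<open>S n\<close> need not decrease; meets of initial segments restore monotonicity.\<close>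
  define t where "t = rec_nat (S 0) (\<lambda>n a. inf a (S (Suc n)))"
  have t0: "t 0 = S 0" and tS: "t (Suc n) = inf (t n) (S (Suc n))" for n by (simp_all add: t_def)
  have t: "0 \<le> t n" "t n \<le> u" for n
    by (induction n) (auto simp: t0 tS S_def s intro: le_infI1)
  have t_le_S: "t n \<le> S n" for n by (cases n) (simp_all add: t0 tS)
  have v_t: "v m - t n \<le> (\<Sum>i<Suc n. pprt (v m - S i))" for m n
  proof (induction n)
    case (Suc n)
    have "v m - t (Suc n) = sup (v m - t n) (v m - S (Suc n))"
      by (simp add: tS diff_inf_eq_sup add_sup_distrib_left)
    also have "\<dots> \<le> (\<Sum>i<Suc n. pprt (v m - S i)) + pprt (v m - S (Suc n))"
    proof (rule le_supI)
      show "v m - t n \<le> (\<Sum>i<Suc n. pprt (v m - S i)) + pprt (v m - S (Suc n))"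
        by (rule add_increasing2[OF zero_le_pprt Suc])
      show "v m - S (Suc n) \<le> (\<Sum>i<Suc n. pprt (v m - S i)) + pprt (v m - S (Suc n))"
        by (intro add_increasing sum_nonneg) (simp_all add: pprt_def)
    qed
    finally show ?case by simp
  qed (simp add: t0 pprt_def)
  have g_t: "e * 3 / 4 \<le> g m (t m)" for m
  proof -
    have "g m (v m - t m) \<le> g m (\<Sum>i<Suc m. pprt (v m - S i))" by (intro blinfun_mono g v_t)
    also have "\<dots> \<le> \<rho> (\<Sum>i<Suc m. pprt (v m - S i))" by (intro le sum_nonneg) simp
    also have "\<dots> \<le> (\<Sum>i<Suc m. \<rho> (pprt (v m - S i)))" by (rule sum) simp
    also have "\<dots> \<le> (\<Sum>i<Suc m. d (0 + i))" by (intro sum_mono) (simp add: \<rho>_S)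
    also have "\<dots> \<le> 2 * d 0" by (rule d_sum)
    finally have "g m (v m) - g m (t m) \<le> 2 * d 0" by (simp add: blinfun.diff_right)
    moreover have "g m u - g m (v m) < d m" using v(3)[of m] by (simp add: blinfun.diff_right)
    ultimately show ?thesis using e(2)[of m] d_le[of m] d_le[of 0] e(1) by linarith
  qed
  \<comment> \<open>Reflection in \<open>u\<close> makes the decreasing \<open>t\<close> increasing.
    One step from \<open>t k\<close> to \<open>t (Suc k)\<close> is then small in
    \<open>\<rho>\<close>, hence for \<open>g k\<close>, although \<open>g k\<close> is large on
    \<open>t k\<close> and small on \<open>t (Suc k) \<le> S (Suc k)\<close>.\<close>
  have "\<exists>K. \<forall>m\<ge>K. \<rho> ((u - t m) - (u - t K)) < e / 4"
    by (rule incseq_Cauchy[OF u]) (use t e in \<open>auto simp: tS diff_left_mono\<close>)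
  then obtain k where k: "\<rho> ((u - t (Suc k)) - (u - t k)) < e / 4" by (meson le_SucI order_refl)
  have "t (Suc k) \<le> t k" by (simp add: tS)
  then have "g k (t k - t (Suc k)) \<le> \<rho> (t k - t (Suc k))" by (intro le) simp
  moreover have "g k (t (Suc k)) \<le> g k (S (Suc k))" by (intro blinfun_mono g t_le_S)
  ultimately have "g k (t k) < e / 4 + 2 * d (Suc k)"
    using k g_S[of k "Suc k"] by (simp add: blinfun.diff_right)
  then show False using g_t[of k] d_le[of "Suc k"] e(1) by linarith
qed

end

context disjoint_null_set
begin

text \<open>With \<open>x \<le> pprt (x - u) + u\<close>, the first summand is small in
  \<open>\<rho>\<close> uniformly over \<open>S\<close> and in \<open>n\<close>, so only the numbers
  \<open>g n u\<close> need to tend to 0.\<close>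

theorem disjoint_functionals_uniformly_null:
  fixes g :: "nat \<Rightarrow> 'a \<Rightarrow>\<^sub>L real"
  assumes g: "\<And>n. 0 \<le> g n" "disjoint_seq g" and le: "\<And>n x. 0 \<le> x \<Longrightarrow> g n x \<le> \<rho> x"
  shows "uniform_limit S (\<lambda>n x. g n x) (\<lambda>x. 0) sequentially"
  unfolding uniform_limit_iff
proof (intro allI impI)
  fix e :: real assume e: "0 < e"
  then obtain u where u: "u \<in> null_ideal" "\<And>x. x \<in> S \<Longrightarrow> \<rho> (pprt (x - u)) < e / 2"
    using approximate_in_null_ideal[of "e / 2"] by auto
  have "(\<lambda>n. g n u) \<longlonglongrightarrow> 0"
  proof (rule ccontr)
    assume "\<not> ?thesis"
    then obtain d r where d: "0 < d" and r: "strict_mono (r :: nat \<Rightarrow> nat)" and dr: "\<And>n. d \<le> g (r n) u"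
      by (elim not_tendsto_zero_subseq) (auto intro: blinfun_nonneg g null_ideal_nonneg u)
    have "inf (g (r n)) (g (r m)) = 0" if "m < n" for m n
    proof -
      have "r m \<noteq> r n" using that r by (simp add: strict_mono_eq)
      then have "inf \<bar>g (r n)\<bar> \<bar>g (r m)\<bar> = 0" using g(2) unfolding disjoint_seq_def by blast
      then show ?thesis using g(1) by simp
    qed
    then show False
      by (intro no_disjoint_functionals_large_on_null_ideal[OF u(1), of "\<lambda>n. g (r n)" d]) (use g le d dr in auto)
  qed
  then have "\<forall>\<^sub>F n in sequentially. g n u < e / 2" using e by (intro order_tendstoD(2)) auto
  then show "\<forall>\<^sub>F n in sequentially. \<forall>x\<in>S. dist (g n x) 0 < e"
  proof (eventually_elim, intro ballI)
    fix n x assume n: "g n u < e / 2" and x: "x \<in> S"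
    have "x \<le> pprt (x - u) + u" by (simp add: pprt_def diff_le_eq[symmetric])
    then have "g n x \<le> g n (pprt (x - u) + u)" by (rule blinfun_mono[OF g(1)])
    also have "\<dots> = g n (pprt (x - u)) + g n u" by (rule blinfun.add_right)
    also have "\<dots> < e" using le[OF zero_le_pprt, of n "x - u"] u(2)[OF x] n by linarith
    finally show "dist (g n x) 0 < e" using blinfun_nonneg[OF g(1) S_nonneg[OF x]] by simp
  qed
qed

end

section \<open>Dual descriptions of L-weakly compact sets\<close>

lemma extend_from_cone:
  fixes p :: "'a::banach_lattice \<Rightarrow> real"
  assumes add: "\<And>a b. 0 \<le> a \<Longrightarrow> 0 \<le> b \<Longrightarrow> p (a + b) = p a + p b"
    and scale: "\<And>c x. 0 \<le> x \<Longrightarrow> 0 \<le> c \<Longrightarrow> p (c *\<^sub>R x) = c * p x"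
    and bound: "\<And>x. 0 \<le> x \<Longrightarrow> \<bar>p x\<bar> \<le> K * norm x" and K: "0 \<le> K"
  obtains h :: "'a \<Rightarrow>\<^sub>L real" where "\<And>x. 0 \<le> x \<Longrightarrow> h x = p x"
proof
  define H where "H x = p (pprt x) - p (pprt (- x))" for x
  have dec: "x = pprt x - pprt (- x)" for x :: 'a by (simp add: pprt_neg prts[symmetric])
  \<comment> \<open>The parts of a sum are not the sums of the parts; additivity of \<open>H\<close>
    rests on its independence of the chosen representation as a difference.\<close>
  have Hdiff: "H (u - v) = p u - p v" if uv: "0 \<le> u" "0 \<le> v" for u v
  proof -
    have "pprt (u - v) + v = u + pprt (- (u - v))" using dec[of "u - v"] by (simp add: algebra_simps)
    then have "p (pprt (u - v)) + p v = p u + p (pprt (- (u - v)))"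
      using add[of "pprt (u - v)" v] add[of u "pprt (- (u - v))"] uv by simp
    then show ?thesis by (simp add: H_def)
  qed
  have p0: "p 0 = 0" using add[of 0 0] by simp
  have Hneg: "H (- x) = - H x" for x by (simp add: H_def)
  have Hpos: "H (r *\<^sub>R x) = r * H x" if "0 \<le> r" for r x
  proof -
    have "H (r *\<^sub>R x) = H (r *\<^sub>R pprt x - r *\<^sub>R pprt (- x))"
      using dec[of x] by (metis scaleR_diff_right)
    also have "\<dots> = p (r *\<^sub>R pprt x) - p (r *\<^sub>R pprt (- x))"
      using that by (intro Hdiff) (simp_all add: scaleR_nonneg_nonneg)
    finally show ?thesis using that by (simp add: scale H_def right_diff_distrib)
  qed
  have bl: "bounded_linear H"
  proof (rule bounded_linear_intro[where K = "2 * K"])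
    fix x y
    have "H (x + y) = H ((pprt x + pprt y) - (pprt (- x) + pprt (- y)))"
      using dec[of x] dec[of y] by (metis add_diff_add)
    also have "\<dots> = p (pprt x + pprt y) - p (pprt (- x) + pprt (- y))" by (rule Hdiff) simp_all
    finally show "H (x + y) = H x + H y" by (simp add: add H_def)
  next
    fix r x
    show "H (r *\<^sub>R x) = r *\<^sub>R H x"
      using Hpos[of r x] Hpos[of "- r" x] Hneg[of "r *\<^sub>R x"] by (cases "0 \<le> r") auto
  next
    fix x :: 'a
    have "pprt x \<le> \<bar>x\<bar>" "pprt (- x) \<le> \<bar>x\<bar>"
      by (simp_all add: pprt_def abs_ge_self abs_ge_minus_self)
    then have "norm (pprt x) \<le> norm \<bar>x\<bar>" "norm (pprt (- x)) \<le> norm \<bar>x\<bar>"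
      by (simp_all only: norm_mono_nonneg zero_le_pprt)
    then have "K * norm (pprt x) \<le> K * norm x" "K * norm (pprt (- x)) \<le> K * norm x"
      using K by (auto simp: norm_abs_lattice intro: mult_left_mono)
    then have "norm (H x) \<le> 2 * (K * norm x)"
      using bound[OF zero_le_pprt, of x] bound[OF zero_le_pprt, of "- x"]
      unfolding H_def real_norm_def by linarith
    then show "norm (H x) \<le> norm x * (2 * K)" by (simp add: ac_simps)
  qed
  show "Blinfun H x = p x" if "0 \<le> x" for x
    using Hdiff[of x 0] that by (simp add: bounded_linear_Blinfun_apply[OF bl] p0)
qed

lemma disjoint_ideal:
  fixes p y z :: "'a::banach_lattice"
  assumes "0 \<le> z" "z \<le> t *\<^sub>R p" "inf y p = 0"
  shows "inf z y = 0"
proof -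
  have p: "0 \<le> p" and y: "0 \<le> y" using assms(3) inf_le1 inf_le2 by metis+
  have "t *\<^sub>R p \<le> \<bar>t\<bar> *\<^sub>R p" using p by (intro scaleR_right_mono) auto
  then have "z \<le> \<bar>t\<bar> *\<^sub>R p" using assms(2) by (rule order_trans[rotated])
  moreover have "inf (\<bar>t\<bar> *\<^sub>R p) y = 0"
    using disjoint_scaleR[OF assms(3), of "\<bar>t\<bar>"] by (simp add: inf.commute)
  ultimately show ?thesis using disjoint_mono[OF assms(1) _ y order_refl] by blast
qed

text \<open>The functional \<open>h\<close> is the component of \<open>f\<close> carried by the band of \<open>p\<close>.\<close>

lemma band_restriction:
  fixes f :: "'a::banach_lattice \<Rightarrow>\<^sub>L real"
  assumes f: "0 \<le> f" and p: "0 \<le> p"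
  obtains h where "0 \<le> h" "h \<le> f" "h p = f p" "\<And>y. inf y p = 0 \<Longrightarrow> h y = 0"
    "\<And>x e. 0 \<le> x \<Longrightarrow> 0 < e \<Longrightarrow>
      \<exists>z. 0 \<le> z \<and> z \<le> x \<and> (\<forall>y. inf y p = 0 \<longrightarrow> inf z y = 0) \<and> h x - h z < e"
proof -
  \<comment> \<open>The part of \<open>{0..x}\<close> in the principal ideal generated by
    \<open>p\<close>. No band projection is needed: the real supremum of \<open>f\<close> over this
    part defines the component, and its approximating \<open>z\<close> are disjoint from everything
    disjoint from \<open>p\<close>.\<close>
  define I where "I x = {z. 0 \<le> z \<and> z \<le> x \<and> (\<exists>t. z \<le> t *\<^sub>R p)}" for x
  define q where "q x = (SUP z\<in>I x. f z)" for x
  have I_le: "f z \<le> f x" if "z \<in> I x" for z x using that by (auto simp: I_def intro: blinfun_mono[OF f])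
  have I0: "0 \<in> I x" if "0 \<le> x" for x using that by (auto simp: I_def intro!: exI[of _ 0])
  have up: "f z \<le> q x" if "z \<in> I x" for z x
    unfolding q_def by (rule cSUP_upper[OF that]) (rule bdd_aboveI2[OF I_le])
  have least: "q x \<le> c" if "0 \<le> x" "\<And>z. z \<in> I x \<Longrightarrow> f z \<le> c" for x c
    unfolding q_def using that I0 by (intro cSUP_least) auto
  have app: "\<exists>z\<in>I x. q x - e < f z" if "0 \<le> x" "0 < e" for x e
  proof (rule ccontr)
    assume "\<not> ?thesis"
    then have "q x \<le> q x - e" using that(1) by (intro least) (auto simp: not_less)
    then show False using that(2) by simp
  qed
  have q0: "0 \<le> q x" if "0 \<le> x" for x using up[OF I0[OF that]] by simp
  have qf: "q x \<le> f x" if "0 \<le> x" for x using that by (rule least) (rule I_le)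
  have add: "q (a + b) = q a + q b" if ab: "0 \<le> a" "0 \<le> b" for a b
  proof (rule antisym)
    show "q (a + b) \<le> q a + q b"
    proof (rule least)
      fix z assume z: "z \<in> I (a + b)"
      then obtain t where t: "z \<le> t *\<^sub>R p" by (auto simp: I_def)
      have "0 \<le> z" "z \<le> a + b" using z by (auto simp: I_def)
      then obtain u v where uv: "z = u + v" "0 \<le> u" "u \<le> a" "0 \<le> v" "v \<le> b"
        using ab by (rule riesz_decomposition)
      have "u \<le> t *\<^sub>R p" "v \<le> t *\<^sub>R p" using uv by (auto intro: order_trans[OF _ t])
      then have "u \<in> I a" "v \<in> I b" using uv by (auto simp: I_def)
      then show "f z \<le> q a + q b"
        using add_mono[OF up up, of u a v b] by (simp add: uv(1) blinfun.add_right)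
    qed (use ab in simp)
    show "q a + q b \<le> q (a + b)"
    proof (rule field_le_epsilon)
      fix e :: real assume "0 < e"
      then obtain u v where u: "u \<in> I a" "q a - e / 2 < f u" and v: "v \<in> I b" "q b - e / 2 < f v"
        using app[OF ab(1), of "e / 2"] app[OF ab(2), of "e / 2"] by auto
      obtain s t where "u \<le> s *\<^sub>R p" "v \<le> t *\<^sub>R p" using u(1) v(1) by (auto simp: I_def)
      then have "u + v \<le> (s + t) *\<^sub>R p" by (simp add: scaleR_add_left add_mono)
      then have "u + v \<in> I (a + b)" using u(1) v(1) by (auto simp: I_def intro: add_mono)
      then show "q a + q b \<le> q (a + b) + e" using up u(2) v(2) by (force simp: blinfun.add_right)
    qed
  qed
  have scale_le: "c * q x \<le> q (c *\<^sub>R x)" if "0 \<le> x" "0 < c" for c x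
  proof -
    have "q x \<le> q (c *\<^sub>R x) / c"
    proof (rule least[OF that(1)])
      fix z assume z: "z \<in> I x"
      then obtain t where "z \<le> t *\<^sub>R p" by (auto simp: I_def)
      then have "c *\<^sub>R z \<le> (c * t) *\<^sub>R p"
        using scaleR_left_mono[of z "t *\<^sub>R p" c] that(2) by simp
      moreover have "0 \<le> c *\<^sub>R z" "c *\<^sub>R z \<le> c *\<^sub>R x"
        using z that(2) by (auto simp: I_def intro!: scaleR_nonneg_nonneg scaleR_left_mono)
      ultimately have "c *\<^sub>R z \<in> I (c *\<^sub>R x)" by (auto simp: I_def)
      from up[OF this] show "f z \<le> q (c *\<^sub>R x) / c"
        using that(2) by (simp add: blinfun.scaleR_right field_simps)
    qed
    then show ?thesis using that(2) by (simp add: field_simps)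
  qed
  have scale: "q (c *\<^sub>R x) = c * q x" if "0 \<le> x" "0 \<le> c" for c x
  proof (cases "c = 0")
    case True
    then show ?thesis using add[of 0 0] by simp
  next
    case False
    then have c: "0 < c" using that by simp
    have "inverse c * q (c *\<^sub>R x) \<le> q (inverse c *\<^sub>R (c *\<^sub>R x))"
      using that c by (intro scale_le) (auto simp: scaleR_nonneg_nonneg)
    then have "q (c *\<^sub>R x) \<le> c * q x" using c by (simp add: field_simps)
    then show ?thesis using scale_le[OF that(1) c] by simp
  qed
  have "\<bar>q x\<bar> \<le> norm f * norm x" if "0 \<le> x" for x
    using q0[OF that] qf[OF that] norm_blinfun[of f x] by simp
  then obtain h :: "'a \<Rightarrow>\<^sub>L real" where h: "\<And>x. 0 \<le> x \<Longrightarrow> h x = q x"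
    using extend_from_cone[OF add scale, of "norm f"] by (metis norm_ge_zero)
  have h_eq: "h z = f z" if "0 \<le> z" "z \<le> t *\<^sub>R p" for z t
  proof -
    have "z \<in> I z" using that by (auto simp: I_def)
    then show ?thesis using up[of z z] qf[of z] that by (simp add: h)
  qed
  have app_h: "\<exists>z. 0 \<le> z \<and> z \<le> x \<and> (\<forall>y. inf y p = 0 \<longrightarrow> inf z y = 0) \<and> h x - h z < e"
    if x: "0 \<le> x" and e: "0 < e" for x e
  proof -
    obtain z where z: "z \<in> I x" "q x - e < f z" using app[OF x e] by blast
    then obtain t where t: "0 \<le> z" "z \<le> x" "z \<le> t *\<^sub>R p" by (auto simp: I_def)
    then have "h x - h z < e" using z(2) h_eq[OF t(1,3)] x by (simp add: h)
    then show ?thesis using t disjoint_ideal[OF t(1,3)] by blast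
  qed
  show thesis
  proof (rule that)
    show h0: "0 \<le> h" "h \<le> f" using h q0 qf by (simp_all add: less_eq_blinfun_def)
    show "h p = f p" using h_eq[of p 1] p by simp
    show "h y = 0" if y: "inf y p = 0" for y
    proof -
      have y0: "0 \<le> y" using y inf_le1 by metis
      have "h y \<le> 0 + e" if e: "0 < e" for e
      proof -
        obtain z where z: "0 \<le> z" "z \<le> y" "inf z y = 0" "h y - h z < e"
          using app_h[OF y0 e] y by blast
        then have "z = 0" by (simp add: inf_absorb1)
        then show ?thesis using z(4) by simp
      qed
      then have "h y \<le> 0" by (rule field_le_epsilon)
      then show ?thesis using blinfun_nonneg[OF h0(1) y0] by (simp add: antisym)
    qed
  qed (rule app_h)
qed

text \<open>To see that \<open>h m\<close> and \<open>h n\<close> are disjoint, split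
  \<open>y\<close> as \<open>z + (y - z)\<close>: \<open>z\<close> is disjoint from
  \<open>x n\<close>, so \<open>h n\<close> vanishes on it, and \<open>h m\<close> is small on
  \<open>y - z\<close>.\<close>

lemma disjoint_restrictions:
  fixes f :: "nat \<Rightarrow> 'a::banach_lattice \<Rightarrow>\<^sub>L real"
  assumes f: "\<And>n. 0 \<le> f n" and x: "\<And>n. 0 \<le> x n" "disjoint_seq x"
  obtains h where "\<And>n. 0 \<le> h n" "\<And>n. h n \<le> f n" "\<And>n. h n (x n) = f n (x n)" "disjoint_seq h"
proof -
  have "\<exists>h. 0 \<le> h \<and> h \<le> f n \<and> blinfun_apply h (x n) = f n (x n) \<and>
    (\<forall>y. inf y (x n) = 0 \<longrightarrow> blinfun_apply h y = 0) \<and> (\<forall>y e. 0 \<le> y \<longrightarrow> 0 < e \<longrightarrow>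
      (\<exists>z. 0 \<le> z \<and> z \<le> y \<and> (\<forall>w. inf w (x n) = 0 \<longrightarrow> inf z w = 0) \<and> blinfun_apply h y - blinfun_apply h z < e))" for n
    by (rule band_restriction[OF f[of n] x(1)[of n]]) blast
  then obtain h where h: "\<And>n. 0 \<le> h n" "\<And>n. h n \<le> f n" "\<And>n. h n (x n) = f n (x n)"
    and vanish: "\<And>n y. inf y (x n) = 0 \<Longrightarrow> h n y = 0"
    and app: "\<And>n y e. 0 \<le> y \<Longrightarrow> 0 < e \<Longrightarrow>
      \<exists>z. 0 \<le> z \<and> z \<le> y \<and> (\<forall>w. inf w (x n) = 0 \<longrightarrow> inf z w = 0) \<and> h n y - h n z < e"
    by metis
  have "inf (h m) (h n) = 0" if mn: "m < n" for m n
  proof (rule antisym)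
    have "inf \<bar>x n\<bar> \<bar>x m\<bar> = 0" using x(2) mn by (simp add: disjoint_seq_def)
    then have perp: "inf (x n) (x m) = 0" using x(1) by simp
    show "inf (h m) (h n) \<le> 0"
      unfolding less_eq_blinfun_def
    proof (intro allI impI)
      fix y :: 'a assume y: "0 \<le> y"
      have "inf (h m) (h n) y \<le> 0 + e" if e: "0 < e" for e
      proof -
        obtain z where z: "0 \<le> z" "z \<le> y" "inf z (x n) = 0" "h m y - h m z < e"
          using app[OF y e, of m] perp by blast
        have "h n z = 0" by (rule vanish[OF z(3)])
        moreover have "inf (h m) (h n) z \<le> h n z" using z(1) inf_le2[of "h m" "h n"] by (simp add: less_eq_blinfun_def)
        moreover have "inf (h m) (h n) (y - z) \<le> h m (y - z)"
          using z(2) inf_le1[of "h m" "h n"] by (simp add: less_eq_blinfun_def)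
        ultimately show ?thesis using z(4) by (simp add: blinfun.diff_right)
      qed
      then have "inf (h m) (h n) y \<le> 0" by (rule field_le_epsilon)
      then show "inf (h m) (h n) y \<le> blinfun_apply 0 y" by simp
    qed
  qed (use h in simp)
  then have "disjoint_seq h" by (intro disjoint_seqI h)
  then show thesis using that h by blast
qed

lemma abs_blinfun_ge:
  fixes f :: "'a::banach_lattice \<Rightarrow>\<^sub>L real"
  shows "\<bar>f x\<bar> \<le> \<bar>f\<bar> \<bar>x\<bar>"
proof -
  have u: "f u \<le> \<bar>f\<bar> u" "- (f u) \<le> \<bar>f\<bar> u" if "0 \<le> u" for u
    using that abs_ge_self[of f] abs_ge_minus_self[of f]
    by (auto simp: less_eq_blinfun_def blinfun.minus_left)
  have "\<bar>f\<bar> \<bar>x\<bar> = \<bar>f\<bar> (pprt x) + \<bar>f\<bar> (pprt (- x))"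
    by (simp add: abs_prts pprt_neg blinfun.diff_right blinfun.minus_right)
  moreover have "f x = f (pprt x) - f (pprt (- x))"
    by (simp add: pprt_neg blinfun.diff_right[symmetric] prts[symmetric])
  ultimately show ?thesis
    using u[of "pprt x"] u[of "pprt (- x)"] by (simp add: abs_le_iff)
qed

text \<open>Here \<open>\<bar>f\<bar> + f\<close> is the positive part of \<open>f + f\<close>. If
  \<open>y\<close> in \<open>{0..x}\<close> nearly attains its value at \<open>x\<close>, then
  \<open>z = y + y - x\<close> nearly attains \<open>\<bar>f\<bar> x\<close>.\<close>

lemma abs_blinfun_approx:
  fixes f :: "'a::banach_lattice \<Rightarrow>\<^sub>L real"
  assumes x: "0 \<le> x" and e: "0 < e"
  obtains z where "\<bar>z\<bar> \<le> x" "\<bar>f\<bar> x - e < f z"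
proof -
  obtain h where h: "0 \<le> h" "f + f \<le> h" "\<And>k. 0 \<le> k \<Longrightarrow> f + f \<le> k \<Longrightarrow> h \<le> k"
    and app: "\<And>x e. 0 \<le> x \<Longrightarrow> 0 < e \<Longrightarrow> \<exists>y. 0 \<le> y \<and> y \<le> x \<and> norm (h x - (f + f) y) < e"
    using blinfun_pos_part[of "f + f"] by metis
  have "\<bar>f\<bar> + f = sup (f + f) 0" by (simp add: abs_blinfun_def add_sup_distrib_right)
  also have "\<dots> = h" by (rule antisym) (use h in \<open>auto intro: h(3)\<close>)
  finally have fh: "\<bar>f\<bar> = h - f" by (simp add: eq_diff_eq)
  obtain y where y: "0 \<le> y" "y \<le> x" "norm (h x - (f + f) y) < e" using app[OF x e] by blast
  show thesis
  proof
    have "y + y - x \<le> x" using add_mono[OF y(2) y(2)] by (simp add: diff_le_eq)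
    moreover have "- (y + y - x) \<le> x" using y(1) by (simp add: minus_le_self_iff)
    ultimately show "\<bar>y + y - x\<bar> \<le> x" by (rule abs_leI)
    show "\<bar>f\<bar> x - e < f (y + y - x)"
      using y(3) by (simp add: fh blinfun.diff_left blinfun.add_left blinfun.diff_right blinfun.add_right)
  qed
qed

section \<open>Uniform convergence on L-weakly compact sets\<close>

lemma disjoint_seq_abs_iff: "disjoint_seq (\<lambda>n. \<bar>x n\<bar>) \<longleftrightarrow> disjoint_seq x"
  by (simp add: disjoint_seq_def)

lemma not_uniformly_null_subseq:
  fixes F :: "nat \<Rightarrow> 'b \<Rightarrow> real"
  assumes "\<not> uniform_limit A F (\<lambda>_. 0) sequentially"
  obtains e r a where "0 < e" "strict_mono (r :: nat \<Rightarrow> nat)" "\<And>n. a n \<in> A" "\<And>n. e \<le> \<bar>F (r n) (a n)\<bar>"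
proof -
  obtain e where e: "0 < e" "\<exists>\<^sub>F n in sequentially. \<exists>a\<in>A. e \<le> \<bar>F n a\<bar>"
    using assms by (auto simp: uniform_limit_iff not_eventually not_less)
  then have "infinite {n. \<exists>a\<in>A. e \<le> \<bar>F n a\<bar>}"
    by (simp add: frequently_cofinite cofinite_eq_sequentially[symmetric])
  from infinite_enumerate[OF this] obtain r
    where r: "strict_mono (r :: nat \<Rightarrow> nat)" "\<forall>n. \<exists>a\<in>A. e \<le> \<bar>F (r n) a\<bar>" by auto
  from r(2) obtain a where "\<And>n. a n \<in> A" "\<And>n. e \<le> \<bar>F (r n) (a n)\<bar>" by metis
  then show thesis using that e(1) r(1) by blast
qed

lemma solid_hull_iff: "y \<in> solid_hull A \<longleftrightarrow> (\<exists>a\<in>A. \<bar>y\<bar> \<le> \<bar>a\<bar>)"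
  by (auto simp: solid_hull_def abs_le_iff minus_le_iff[of y])

lemma Lwc_setD:
  assumes "Lwc_set A" "disjoint_seq x" "\<And>n. a n \<in> A" "\<And>n. \<bar>x n\<bar> \<le> \<bar>a n\<bar>"
  shows "x \<longlonglongrightarrow> 0"
  using assms unfolding Lwc_set_def by (metis image_subsetI solid_hull_iff)

lemma Lwc_set_dual_iff:
  fixes A :: "('a::banach_lattice \<Rightarrow>\<^sub>L real) set"
  assumes A: "bounded A"
  shows "Lwc_set A \<longleftrightarrow> (\<forall>x. disjoint_seq x \<longrightarrow> range x \<subseteq> cball 0 1 \<longrightarrow>
    uniform_limit A (\<lambda>n f. blinfun_apply f (x n)) (\<lambda>_. 0) sequentially)" (is "_ \<longleftrightarrow> ?R")
proof
  assume L: "Lwc_set A"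
  show ?R
  proof (intro allI impI, rule ccontr)
    fix x :: "nat \<Rightarrow> 'a" assume x: "disjoint_seq x" "range x \<subseteq> cball 0 1"
    assume "\<not> uniform_limit A (\<lambda>n f. blinfun_apply f (x n)) (\<lambda>_. 0) sequentially"
    then obtain e r f where e: "0 < e" and r: "strict_mono (r :: nat \<Rightarrow> nat)" and f: "\<And>n. f n \<in> A"
      and big: "\<And>n. e \<le> \<bar>f n (x (r n))\<bar>" by (rule not_uniformly_null_subseq) blast
    obtain h where h: "\<And>n. 0 \<le> h n" "\<And>n. h n \<le> \<bar>f n\<bar>" "disjoint_seq h"
      "\<And>n. h n \<bar>x (r n)\<bar> = \<bar>f n\<bar> \<bar>x (r n)\<bar>"
    proof (rule disjoint_restrictions[of "\<lambda>n. \<bar>f n\<bar>" "\<lambda>n. \<bar>x (r n)\<bar>"])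
      show "disjoint_seq (\<lambda>n. \<bar>x (r n)\<bar>)"
        unfolding disjoint_seq_abs_iff by (rule disjoint_seq_subseq[OF x(1) r])
    qed auto
    have "h \<longlonglongrightarrow> 0" using h(1,2) by (intro Lwc_setD[OF L h(3) f]) simp
    then have "(\<lambda>n. norm (h n)) \<longlonglongrightarrow> 0" by (rule tendsto_norm_zero)
    moreover have "e \<le> norm (h n)" for n
    proof -
      have "norm \<bar>x (r n)\<bar> \<le> 1" using range_subsetD[OF x(2), of "r n"] by (simp add: norm_abs_lattice)
      then have "h n \<bar>x (r n)\<bar> \<le> norm (h n)" using blinfun_apply_le_norm abs_le_D1 by blast
      then show ?thesis using big[of n] abs_blinfun_ge[of "f n" "x (r n)"] h(4)[of n] by linarith
    qed
    ultimately have "e \<le> 0" by (intro LIMSEQ_le_const) auto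
    then show False using e by simp
  qed
next
  assume R: ?R
  obtain b where b: "0 < b" "\<And>f. f \<in> A \<Longrightarrow> norm f \<le> b" using A unfolding bounded_pos by blast
  \<comment> \<open>Inserting 0 keeps the supremum meaningful for empty \<open>A\<close> and makes
    \<open>\<rho>\<close> nonnegative everywhere.\<close>
  define \<rho> where "\<rho> x = (SUP f\<in>insert 0 A. blinfun_apply \<bar>f\<bar> x)" for x :: 'a
  have le_b: "blinfun_apply \<bar>f\<bar> x \<le> b * norm x" if "f \<in> insert 0 A" for f x
  proof -
    have "\<bar>f\<bar> x \<le> norm \<bar>f\<bar> * norm x" using norm_blinfun[of "\<bar>f\<bar>" x] by simp
    also have "\<dots> \<le> b * norm x"
      using that b by (intro mult_right_mono) (auto simp: norm_abs_lattice)
    finally show ?thesis .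
  qed
  have up: "blinfun_apply \<bar>f\<bar> x \<le> \<rho> x" if "f \<in> insert 0 A" for f x
    unfolding \<rho>_def by (rule cSUP_upper[OF that]) (rule bdd_aboveI2[OF le_b])
  have least: "\<rho> x \<le> c" if "0 \<le> c" "\<And>f. f \<in> A \<Longrightarrow> blinfun_apply \<bar>f\<bar> x \<le> c" for x c
    unfolding \<rho>_def by (rule cSUP_least) (use that in auto)
  interpret monotone_seminorm \<rho> b
  proof
    fix x y :: 'a assume x: "0 \<le> x"
    have "0 \<le> \<rho> y" for y using up[of 0 y] by simp
    then show "\<rho> x \<le> \<rho> y" if "x \<le> y"
      using blinfun_mono[OF abs_ge_zero that] up by (intro least) (blast intro: order_trans)+
    show "\<rho> (x + y) \<le> \<rho> x + \<rho> y"
      using \<open>\<And>y. 0 \<le> \<rho> y\<close> up by (intro least) (auto simp: blinfun.add_right intro!: add_mono)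
    show "\<rho> x \<le> b * norm x" using b(1) le_b by (intro least) auto
  qed (use b in simp)
  interpret disjoint_null_set \<rho> b "{x. 0 \<le> x \<and> norm x \<le> 1}" 1
  proof
    show "disjoint_null {x. 0 \<le> x \<and> norm x \<le> 1}"
      unfolding disjoint_null_def
    proof (intro allI impI)
      fix y :: "nat \<Rightarrow> 'a" assume y: "disjoint_seq y" "range y \<subseteq> {x. 0 \<le> x \<and> norm x \<le> 1}"
      have y': "0 \<le> y n" "norm (y n) \<le> 1" for n using range_subsetD[OF y(2), of n] by auto
      have "uniform_limit A (\<lambda>n f. blinfun_apply \<bar>f\<bar> (y n)) (\<lambda>_. 0) sequentially"
      proof (rule ccontr)
        assume "\<not> ?thesis"
        then obtain e r f where e: "0 < e" and r: "strict_mono (r :: nat \<Rightarrow> nat)" and f: "\<And>n. f n \<in> A"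
          and big: "\<And>n. e \<le> \<bar>\<bar>f n\<bar> (y (r n))\<bar>" by (rule not_uniformly_null_subseq) blast
        \<comment> \<open>The hypothesis controls \<open>f\<close>, not
          \<open>\<bar>f\<bar>\<close>. The sign is moved into the argument: the elements
          \<open>z n\<close> are dominated by a disjoint sequence in the ball, hence form one
          themselves.\<close>
        have "\<exists>z. \<bar>z\<bar> \<le> y (r n) \<and> \<bar>f n\<bar> (y (r n)) - e / 2 < f n z" for n
          using abs_blinfun_approx[OF y'(1) half_gt_zero[OF e]] by metis
        then obtain z where z: "\<And>n. \<bar>z n\<bar> \<le> y (r n)" "\<And>n. \<bar>f n\<bar> (y (r n)) - e / 2 < f n (z n)"
          by metis
        have "disjoint_seq z"
          by (rule disjoint_seq_mono[OF disjoint_seq_subseq[OF y(1) r]]) (use z y' in simp)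
        moreover have "norm (z n) \<le> 1" for n
          using norm_mono[of "z n" "y (r n)"] z(1)[of n] y'[of "r n"] by simp
        ultimately have "uniform_limit A (\<lambda>n f. blinfun_apply f (z n)) (\<lambda>_. 0) sequentially"
          using R by (auto simp: image_subset_iff)
        then have "\<forall>\<^sub>F n in sequentially. \<forall>f\<in>A. dist (blinfun_apply f (z n)) 0 < e / 2"
          using half_gt_zero[OF e] unfolding uniform_limit_iff by blast
        then have "\<forall>\<^sub>F n in sequentially. \<forall>f\<in>A. \<bar>blinfun_apply f (z n)\<bar> < e / 2" by simp
        then obtain n where "\<forall>f\<in>A. \<bar>blinfun_apply f (z n)\<bar> < e / 2" using eventually_happens'[OF sequentially_bot] by blast
        then have "\<bar>f n (z n)\<bar> < e / 2" using f by blast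
        then show False
          using z(2)[of n] big[of n] blinfun_nonneg[OF abs_ge_zero y'(1), of "f n" "r n"] by linarith
      qed
      then show "(\<lambda>n. \<rho> (y n)) \<longlonglongrightarrow> 0"
        unfolding uniform_limit_iff tendsto_iff
      proof (intro allI impI)
        fix e :: real assume "\<forall>e>0. \<forall>\<^sub>F n in sequentially. \<forall>f\<in>A. dist (blinfun_apply \<bar>f\<bar> (y n)) 0 < e" "0 < e"
        then have "\<forall>\<^sub>F n in sequentially. \<forall>f\<in>A. dist (blinfun_apply \<bar>f\<bar> (y n)) 0 < e / 2" by (meson half_gt_zero)
        then show "\<forall>\<^sub>F n in sequentially. dist (\<rho> (y n)) 0 < e"
        proof eventually_elim
          case (elim n)
          have "\<rho> (y n) \<le> e / 2" using elim \<open>0 < e\<close> by (intro least) force+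
          then show ?case using nonneg[OF y'(1)] \<open>0 < e\<close> by simp
        qed
      qed
    qed
  qed (auto intro: norm_mono_nonneg order_trans)
  show "Lwc_set A"
    unfolding Lwc_set_def
  proof (intro allI impI)
    fix y :: "nat \<Rightarrow> 'a \<Rightarrow>\<^sub>L real" assume y: "disjoint_seq y" "range y \<subseteq> solid_hull A"
    have "\<bar>y n\<bar> x \<le> \<rho> x" if x: "0 \<le> x" for n x
    proof -
      obtain a where a: "a \<in> A" "\<bar>y n\<bar> \<le> \<bar>a\<bar>" using range_subsetD[OF y(2), of n] by (auto simp: solid_hull_iff)
      then have "\<bar>y n\<bar> x \<le> \<bar>a\<bar> x" using x by (simp add: less_eq_blinfun_def)
      then show ?thesis using up[of a x] a(1) by simp
    qed
    then have lim: "uniform_limit {x. 0 \<le> x \<and> norm x \<le> 1} (\<lambda>n x. \<bar>y n\<bar> x) (\<lambda>_. 0) sequentially"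
      by (intro disjoint_functionals_uniformly_null) (use y(1) in \<open>simp_all add: disjoint_seq_abs_iff\<close>)
    show "y \<longlonglongrightarrow> 0"
      unfolding tendsto_iff
    proof (intro allI impI)
      fix e :: real assume e: "0 < e"
      then have "\<forall>\<^sub>F n in sequentially. \<forall>x\<in>{x. 0 \<le> x \<and> norm x \<le> 1}. dist (\<bar>y n\<bar> x) 0 < e / 2"
        using lim half_gt_zero[OF e] unfolding uniform_limit_iff by blast
      then show "\<forall>\<^sub>F n in sequentially. dist (y n) 0 < e"
      proof eventually_elim
        case (elim n)
        have "norm (y n) \<le> e / 2"
        proof (rule norm_blinfun_le)
          fix x :: 'a assume "norm x \<le> 1"
          then have "dist (\<bar>y n\<bar> \<bar>x\<bar>) 0 < e / 2" using elim by (simp add: norm_abs_lattice)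
          then show "\<bar>y n x\<bar> \<le> e / 2" using abs_blinfun_ge[of "y n" x] by simp
        qed (use e in simp)
        then show ?case using e by simp
      qed
    qed
  qed
qed

lemma Lwc_set_iff:
  fixes A :: "'a::banach_lattice set"
  assumes A: "bounded A"
  shows "Lwc_set A \<longleftrightarrow> (\<forall>f :: nat \<Rightarrow> 'a \<Rightarrow>\<^sub>L real. disjoint_seq f \<longrightarrow> range f \<subseteq> cball 0 1 \<longrightarrow>
    uniform_limit A (\<lambda>n x. blinfun_apply (f n) x) (\<lambda>_. 0) sequentially)" (is "_ \<longleftrightarrow> ?R")
proof
  assume L: "Lwc_set A"
  obtain b where b: "\<And>a. a \<in> A \<Longrightarrow> norm a \<le> b" using A unfolding bounded_iff by blast
  define S where "S = {x \<in> solid_hull A. 0 \<le> x}"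
  interpret monotone_seminorm "norm :: 'a \<Rightarrow> real" 1
    by unfold_locales (auto intro: norm_mono_nonneg norm_triangle_ineq)
  interpret disjoint_null_set "norm :: 'a \<Rightarrow> real" 1 S b
  proof
    show "disjoint_null S"
      using L by (auto simp: disjoint_null_def Lwc_set_def S_def image_subset_iff tendsto_norm_zero)
    show "y \<in> S" if "x \<in> S" "0 \<le> y" "y \<le> x" for x y
      using that by (auto simp: S_def solid_hull_iff intro: order_trans)
    show "norm x \<le> b" if "x \<in> S" for x
      using that b norm_mono order_trans unfolding S_def solid_hull_iff by blast
  qed (auto simp: S_def)
  show ?R
  proof (intro allI impI)
    fix f :: "nat \<Rightarrow> 'a \<Rightarrow>\<^sub>L real" assume f: "disjoint_seq f" "range f \<subseteq> cball 0 1"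
    have "\<bar>f n\<bar> x \<le> norm x" if x: "0 \<le> x" for n x
    proof -
      have "\<bar>f n\<bar> x \<le> norm \<bar>f n\<bar> * norm x" using norm_blinfun[of "\<bar>f n\<bar>" x] by simp
      also have "\<dots> \<le> 1 * norm x"
        using range_subsetD[OF f(2), of n] by (intro mult_right_mono) (auto simp: norm_abs_lattice)
      finally show ?thesis by simp
    qed
    then have "uniform_limit S (\<lambda>n x. \<bar>f n\<bar> x) (\<lambda>_. 0) sequentially"
      by (intro disjoint_functionals_uniformly_null) (use f(1) in \<open>simp_all add: disjoint_seq_abs_iff\<close>)
    then have lim: "\<forall>\<^sub>F n in sequentially. \<forall>x\<in>S. dist (\<bar>f n\<bar> x) 0 < e" if "0 < e" for e
      using that unfolding uniform_limit_iff by blast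
    show "uniform_limit A (\<lambda>n x. f n x) (\<lambda>_. 0) sequentially"
      unfolding uniform_limit_iff
    proof (intro allI impI)
      fix e :: real assume "0 < e"
      from lim[OF this] show "\<forall>\<^sub>F n in sequentially. \<forall>x\<in>A. dist (f n x) 0 < e"
      proof (eventually_elim, intro ballI)
        fix n x assume *: "\<forall>x\<in>S. dist (\<bar>f n\<bar> x) 0 < e" and "x \<in> A"
        then have "\<bar>x\<bar> \<in> S" by (auto simp: S_def solid_hull_iff)
        then have "dist (\<bar>f n\<bar> \<bar>x\<bar>) 0 < e" using * by blast
        then show "dist (f n x) 0 < e" using abs_blinfun_ge[of "f n" x] by simp
      qed
    qed
  qed
next
  assume R: ?R
  show "Lwc_set A"
    unfolding Lwc_set_def
  proof (intro allI impI, rule ccontr)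
    fix y :: "nat \<Rightarrow> 'a" assume y: "disjoint_seq y" "range y \<subseteq> solid_hull A"
    assume "\<not> y \<longlonglongrightarrow> 0"
    then have "\<not> (\<lambda>n. norm (y n)) \<longlonglongrightarrow> 0" using tendsto_norm_zero_cancel by blast
    then obtain e r where e: "0 < e" and r: "strict_mono (r :: nat \<Rightarrow> nat)" and big: "\<And>n. e \<le> norm (y (r n))"
      by (elim not_tendsto_zero_subseq) auto
    define x where "x n = \<bar>y (r n)\<bar>" for n
    have x: "\<And>n. 0 \<le> x n" "disjoint_seq x" "\<And>n. e \<le> norm (x n)"
      using disjoint_seq_subseq[OF y(1) r] big
      by (simp_all add: x_def[abs_def] disjoint_seq_abs_iff norm_abs_lattice)
    have "\<exists>a\<in>A. x n \<le> \<bar>a\<bar>" for n using range_subsetD[OF y(2), of "r n"] by (simp add: x_def solid_hull_iff)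
    then obtain a where a: "\<And>n. a n \<in> A" "\<And>n. x n \<le> \<bar>a n\<bar>" by metis
    have "\<exists>\<phi> :: 'a \<Rightarrow>\<^sub>L real. norm \<phi> \<le> 1 \<and> blinfun_apply \<phi> (x n) = norm (x n)" for n
      using norming_functional[of "x n"] by metis
    then obtain \<phi> :: "nat \<Rightarrow> 'a \<Rightarrow>\<^sub>L real"
      where \<phi>: "\<And>n. norm (\<phi> n) \<le> 1" "\<And>n. \<phi> n (x n) = norm (x n)" by metis
    obtain h where h: "\<And>n. 0 \<le> h n" "\<And>n. h n \<le> \<bar>\<phi> n\<bar>" "disjoint_seq h" "\<And>n. h n (x n) = \<bar>\<phi> n\<bar> (x n)"
      using disjoint_restrictions[of "\<lambda>n. \<bar>\<phi> n\<bar>", OF abs_ge_zero x(1,2)] by metis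
    have h_big: "e \<le> h n \<bar>a n\<bar>" for n
    proof -
      have "e \<le> \<phi> n (x n)" using x(3)[of n] by (simp add: \<phi>)
      also have "\<dots> \<le> h n (x n)" using abs_blinfun_ge[of "\<phi> n" "x n"] x(1)[of n] h(4)[of n] by simp
      also have "\<dots> \<le> h n \<bar>a n\<bar>" by (rule blinfun_mono[OF h(1) a(2)])
      finally show ?thesis .
    qed
    \<comment> \<open>So far \<open>h n\<close> is large on \<open>\<bar>a n\<bar>\<close>, not on
      \<open>a n\<close>. One of the two parts of \<open>a n\<close> carries at least half of this
      value, and restricting \<open>h n\<close> to its band removes the cancellation by the other
      part.\<close>
    have "\<exists>k. 0 \<le> k \<and> k \<le> h n \<and> e \<le> 2 * \<bar>blinfun_apply k (a n)\<bar>" for n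
    proof -
      have half: "\<exists>k. 0 \<le> k \<and> k \<le> h n \<and> blinfun_apply k c = h n (pprt c)" for c
      proof -
        obtain k where k: "0 \<le> k" "k \<le> h n" "k (pprt c) = h n (pprt c)" "\<And>y. inf y (pprt c) = 0 \<Longrightarrow> k y = 0"
          using band_restriction[OF h(1) zero_le_pprt] by metis
        have "k (pprt (- c)) = 0" by (rule k(4)) (simp add: inf.commute inf_pprt_uminus)
        moreover have "k c = k (pprt c - pprt (- c))" by (simp add: pprt_neg prts[symmetric])
        ultimately show ?thesis using k(1-3) by (auto simp: blinfun.diff_right)
      qed
      have sum: "h n \<bar>a n\<bar> = h n (pprt (a n)) + h n (pprt (- a n))"
        by (simp add: abs_prts pprt_neg blinfun.diff_right blinfun.minus_right)
      show ?thesis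
      proof (cases "e \<le> 2 * h n (pprt (a n))")
        case True
        then show ?thesis using half[of "a n"] by force
      next
        case False
        then have "e \<le> 2 * h n (pprt (- a n))" using sum h_big[of n] by linarith
        then show ?thesis using half[of "- a n"] by (force simp: blinfun.minus_right)
      qed
    qed
    then obtain k where k: "\<And>n. 0 \<le> k n" "\<And>n. k n \<le> h n" "\<And>n. e \<le> 2 * \<bar>k n (a n)\<bar>" by metis
    have "disjoint_seq k" by (rule disjoint_seq_mono[OF h(3)]) (use k h in simp)
    moreover have "norm (k n) \<le> 1" for n
    proof -
      have "norm (k n) \<le> norm \<bar>\<phi> n\<bar>" using k(1,2) h(2) order_trans by (intro norm_mono_nonneg) blast+
      then show ?thesis using \<phi>(1)[of n] by (simp add: norm_abs_lattice)
    qed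
    ultimately have "uniform_limit A (\<lambda>n x. k n x) (\<lambda>_. 0) sequentially"
      using R by (auto simp: image_subset_iff)
    then have "\<forall>\<^sub>F n in sequentially. \<forall>x\<in>A. dist (k n x) 0 < e / 2"
      using half_gt_zero[OF e] unfolding uniform_limit_iff by blast
    then have "\<forall>\<^sub>F n in sequentially. \<forall>x\<in>A. \<bar>k n x\<bar> < e / 2" by simp
    then obtain n where "\<forall>x\<in>A. \<bar>k n x\<bar> < e / 2" using eventually_happens'[OF sequentially_bot] by blast
    then have "\<bar>k n (a n)\<bar> < e / 2" using a(1) by blast
    then show False using k(3)[of n] by linarith
  qed
qed

section \<open>Duality of the classes of operators\<close>

lemma weakly_convergent_blinfun:
  assumes "weakly_convergent x"
  shows "weakly_convergent (\<lambda>n. blinfun_apply T (x n))"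
proof -
  obtain l where l: "\<And>f :: _ \<Rightarrow>\<^sub>L real. (\<lambda>n. f (x n)) \<longlonglongrightarrow> f l"
    using assms by (auto simp: weakly_convergent_def limitin_weak_topology)
  have "(\<lambda>n. blinfun_apply g (blinfun_apply T (x n))) \<longlonglongrightarrow> g (blinfun_apply T l)" for g :: "_ \<Rightarrow>\<^sub>L real"
    using l[of "g o\<^sub>L T"] by simp
  then show ?thesis by (auto simp: weakly_convergent_def limitin_weak_topology)
qed

lemma order_bounded_imp_bounded:
  assumes "order_bounded (A :: 'a::banach_lattice set)"
  shows "bounded A"
proof -
  obtain a b where ab: "A \<subseteq> {a..b}" using assms by (auto simp: order_bounded_def)
  have "norm x \<le> norm (\<bar>a\<bar> + \<bar>b\<bar>)" if "x \<in> A" for x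
  proof -
    have x: "a \<le> x" "x \<le> b" using that ab by auto
    have "x \<le> \<bar>b\<bar>" by (rule order_trans[OF x(2) abs_ge_self])
    moreover have "- x \<le> \<bar>a\<bar>" by (rule order_trans[OF le_imp_neg_le[OF x(1)] abs_ge_minus_self])
    ultimately have "\<bar>x\<bar> \<le> \<bar>a\<bar> + \<bar>b\<bar>" by (intro abs_leI) (simp_all add: add_increasing add_increasing2)
    then show ?thesis by (intro norm_mono) simp
  qed
  then show ?thesis by (auto simp: bounded_iff)
qed

text \<open>Otherwise pick \<open>a n\<close> of norm above \<open>n + 1\<close>. Norming
  functionals divided by \<open>n + 1\<close> are norm null, hence weak* null, but exceed 1 at
  \<open>a n\<close>.\<close>

lemma limited_set_imp_bounded:
  assumes A: "limited_set (A :: 'a::real_normed_vector set)"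
  shows "bounded A"
proof (rule ccontr)
  assume "\<not> bounded A"
  then have "\<exists>a\<in>A. real (Suc n) < norm a" for n by (meson bounded_iff not_less)
  then obtain a where a: "\<And>n. a n \<in> A" "\<And>n. real (Suc n) < norm (a n)" by metis
  have "\<exists>f :: 'a \<Rightarrow>\<^sub>L real. norm f \<le> 1 \<and> blinfun_apply f (a n) = norm (a n)" for n
    using norming_functional[of "a n"] by metis
  then obtain f :: "nat \<Rightarrow> 'a \<Rightarrow>\<^sub>L real" where f: "\<And>n. norm (f n) \<le> 1" "\<And>n. f n (a n) = norm (a n)" by metis
  define g where "g n = (1 / real (Suc n)) *\<^sub>R f n" for n
  have "weak_star_null g"
    unfolding weak_star_null_def
  proof
    fix x :: 'a
    have "(\<lambda>n. norm x * (1 / real (Suc n))) \<longlonglongrightarrow> 0" by (intro tendsto_mult_right_zero LIMSEQ_Suc lim_1_over_n)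
    then show "(\<lambda>n. g n x) \<longlonglongrightarrow> 0"
    proof (rule Lim_null_comparison[rotated], intro always_eventually allI)
      fix n
      have "\<bar>f n x\<bar> \<le> 1 * norm x"
        using norm_blinfun[of "f n" x] mult_right_mono[OF f(1) norm_ge_zero, of n x] by simp
      then show "norm (g n x) \<le> norm x * (1 / real (Suc n))"
        by (simp add: g_def blinfun.scaleR_left divide_right_mono)
    qed
  qed
  then have "\<forall>\<^sub>F n in sequentially. \<forall>x\<in>A. dist (g n x) 0 < 1"
    using A unfolding limited_set_def uniform_limit_iff by simp
  then obtain n where "\<forall>x\<in>A. dist (g n x) 0 < 1" using eventually_happens'[OF sequentially_bot] by blast
  then have "\<bar>g n (a n)\<bar> < 1" using a(1) by simp
  moreover have "g n (a n) = norm (a n) / real (Suc n)" by (simp add: g_def f blinfun.scaleR_left)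
  ultimately show False using a(2)[of n] by (simp del: of_nat_Suc)
qed

lemma limited_set_singleton: "limited_set {x}"
  by (simp add: limited_set_def weak_star_null_def uniform_limit_iff tendsto_iff)

text \<open>Brings the suprema in the Mwc classes into the form of uniform convergence, shared with
  the descriptions of L-weakly compact sets. For an empty index set both sides hold.\<close>

lemma ennreal_SUP_tendsto_zero_iff:
  assumes "\<And>n i. 0 \<le> \<phi> n i"
  shows "(\<lambda>n. SUP i\<in>I. ennreal (\<phi> n i)) \<longlonglongrightarrow> 0 \<longleftrightarrow> uniform_limit I \<phi> (\<lambda>_. 0) sequentially"
proof
  assume L: "(\<lambda>n. SUP i\<in>I. ennreal (\<phi> n i)) \<longlonglongrightarrow> 0"
  show "uniform_limit I \<phi> (\<lambda>_. 0) sequentially"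
    unfolding uniform_limit_iff
  proof (intro allI impI)
    fix e :: real assume e: "0 < e"
    then have "\<forall>\<^sub>F n in sequentially. (SUP i\<in>I. ennreal (\<phi> n i)) < ennreal e"
      using order_tendstoD(2)[OF L] by simp
    then show "\<forall>\<^sub>F n in sequentially. \<forall>i\<in>I. dist (\<phi> n i) 0 < e"
    proof (eventually_elim, intro ballI)
      fix n i assume *: "(SUP i\<in>I. ennreal (\<phi> n i)) < ennreal e" and "i \<in> I"
      then have "ennreal (\<phi> n i) < ennreal e" by (meson SUP_upper le_less_trans)
      then show "dist (\<phi> n i) 0 < e" using assms[of n i] by (simp add: ennreal_less_iff)
    qed
  qed
next
  assume U: "uniform_limit I \<phi> (\<lambda>_. 0) sequentially"
  show "(\<lambda>n. SUP i\<in>I. ennreal (\<phi> n i)) \<longlonglongrightarrow> 0"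
  proof (rule order_tendstoI)
    fix a :: ennreal assume "0 < a"
    then obtain c where c: "0 < c" "c < a" using dense by blast
    then obtain e where e: "c = ennreal e" "0 < e" by (cases c) auto
    have "\<forall>\<^sub>F n in sequentially. \<forall>i\<in>I. dist (\<phi> n i) 0 < e" using U e(2) unfolding uniform_limit_iff by blast
    then show "\<forall>\<^sub>F n in sequentially. (SUP i\<in>I. ennreal (\<phi> n i)) < a"
    proof eventually_elim
      case (elim n)
      then have "(SUP i\<in>I. ennreal (\<phi> n i)) \<le> c" unfolding e(1)
        by (intro SUP_least ennreal_leI) (force simp: abs_less_iff)
      then show ?case using c(2) by simp
    qed
  qed simp
qed

lemma uniformly_null_abs_iff:
  fixes F :: "nat \<Rightarrow> 'i \<Rightarrow> real"
  shows "uniform_limit I (\<lambda>n i. \<bar>F n i\<bar>) (\<lambda>_. 0) sequentially \<longleftrightarrow> uniform_limit I F (\<lambda>_. 0) sequentially"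
  by (simp add: uniform_limit_iff)

lemmas SUP_abs_tendsto_zero_iff =
  trans[OF ennreal_SUP_tendsto_zero_iff[OF abs_ge_zero] uniformly_null_abs_iff]

lemma Mwc_iff:
  "\<T> \<in> Mwc \<longleftrightarrow> bounded \<T> \<and> (\<forall>x. disjoint_seq x \<longrightarrow> range x \<subseteq> cball 0 1 \<longrightarrow>
    uniform_limit \<T> (\<lambda>n T. norm (blinfun_apply T (x n))) (\<lambda>_. 0) sequentially)"
  by (simp add: Mwc_def ennreal_SUP_tendsto_zero_iff)

lemma a_Mwc_iff:
  "\<T> \<in> a_Mwc \<longleftrightarrow> bounded \<T> \<and> (\<forall>(f :: nat \<Rightarrow> 'y::banach \<Rightarrow>\<^sub>L real) x. weakly_convergent f \<longrightarrow>
    disjoint_seq x \<longrightarrow> range x \<subseteq> cball 0 1 \<longrightarrow>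
    uniform_limit \<T> (\<lambda>n T. blinfun_apply (f n) (blinfun_apply T (x n))) (\<lambda>_. 0) sequentially)"
  by (simp add: a_Mwc_def SUP_abs_tendsto_zero_iff)

lemma l_Mwc_iff:
  "\<T> \<in> l_Mwc \<longleftrightarrow> bounded \<T> \<and> (\<forall>(f :: 'y::banach \<Rightarrow>\<^sub>L real) x.
    disjoint_seq x \<longrightarrow> range x \<subseteq> cball 0 1 \<longrightarrow>
    uniform_limit \<T> (\<lambda>n T. blinfun_apply f (blinfun_apply T (x n))) (\<lambda>_. 0) sequentially)"
  by (simp add: l_Mwc_def SUP_abs_tendsto_zero_iff)

lemma o_Mwc_iff:
  "\<T> \<in> o_Mwc \<longleftrightarrow> bounded \<T> \<and> (\<forall>(f :: nat \<Rightarrow> 'f::banach_lattice \<Rightarrow>\<^sub>L real) x. order_bounded (range f) \<longrightarrow>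
    disjoint_seq x \<longrightarrow> range x \<subseteq> cball 0 1 \<longrightarrow>
    uniform_limit \<T> (\<lambda>n T. blinfun_apply (f n) (blinfun_apply T (x n))) (\<lambda>_. 0) sequentially)"
  by (simp add: o_Mwc_def SUP_abs_tendsto_zero_iff)

lemma uniform_limit_image: "uniform_limit (h ` I) F l sequentially \<longleftrightarrow>
    uniform_limit I (\<lambda>n i. F n (h i)) (\<lambda>i. l (h i)) sequentially"
  by (simp add: uniform_limit_iff)

section \<open>L-weak compactness of images under sets of operators\<close>

lemma op_image_eq: "op_image \<T> A = (\<lambda>p. blinfun_apply (fst p) (snd p)) ` (\<T> \<times> A)"
  by (force simp: op_image_def)

lemma bounded_op_image:
  assumes "bounded \<T>" "bounded A"
  shows "bounded (op_image \<T> A)"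
proof -
  obtain b where b: "0 < b" "\<And>T. T \<in> \<T> \<Longrightarrow> norm T \<le> b" using assms(1) unfolding bounded_pos by blast
  obtain c where c: "0 < c" "\<And>a. a \<in> A \<Longrightarrow> norm a \<le> c" using assms(2) unfolding bounded_pos by blast
  have "norm (blinfun_apply T a) \<le> b * c" if "T \<in> \<T>" "a \<in> A" for T a
    by (rule order_trans[OF norm_blinfun]) (use b c that in \<open>intro mult_mono; simp\<close>)
  then show ?thesis by (auto simp: op_image_def bounded_iff intro!: exI[of _ "b * c"])
qed

lemma Lwc_set_op_image_adjoint_iff:
  fixes \<T> :: "('e::banach_lattice \<Rightarrow>\<^sub>L 'y::banach) set"
  assumes "bounded \<T>" "bounded A"
  shows "Lwc_set (op_image (adjoint_op ` \<T>) A) \<longleftrightarrow>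
    (\<forall>x. disjoint_seq x \<longrightarrow> range x \<subseteq> cball 0 1 \<longrightarrow>
      uniform_limit (\<T> \<times> A) (\<lambda>n p. blinfun_apply (snd p) (blinfun_apply (fst p) (x n))) (\<lambda>_. 0) sequentially)"
proof -
  have eq: "op_image (adjoint_op ` \<T>) A = (\<lambda>p. snd p o\<^sub>L fst p) ` (\<T> \<times> A)"
    by (force simp: op_image_def adjoint_op_apply)
  have "bounded (op_image (adjoint_op ` \<T>) A)"
    by (intro bounded_op_image) (simp_all add: assms bounded_adjoint_op_image)
  from Lwc_set_dual_iff[OF this] show ?thesis by (simp add: eq uniform_limit_image)
qed

lemma Lwc_set_op_image_iff:
  fixes \<T> :: "('x::banach \<Rightarrow>\<^sub>L 'f::banach_lattice) set"
  assumes "bounded \<T>" "bounded A"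
  shows "Lwc_set (op_image \<T> A) \<longleftrightarrow>
    (\<forall>f :: nat \<Rightarrow> 'f \<Rightarrow>\<^sub>L real. disjoint_seq f \<longrightarrow> range f \<subseteq> cball 0 1 \<longrightarrow>
      uniform_limit (\<T> \<times> A) (\<lambda>n p. blinfun_apply (f n) (blinfun_apply (fst p) (snd p))) (\<lambda>_. 0) sequentially)"
  using Lwc_set_iff[OF bounded_op_image[OF assms]] by (simp add: op_image_eq uniform_limit_image)

text \<open>Serves both norm dualities: with the functional \<open>bidual (T (x n))\<close> on
  \<open>Y'\<close>, whose norm is that of \<open>T (x n)\<close>, and with
  \<open>f n o\<^sub>L T\<close> on \<open>X\<close>, which is the adjoint applied to
  \<open>f n\<close>.\<close>

lemma uniform_norm_blinfun_iff:
  fixes g :: "nat \<Rightarrow> 'i \<Rightarrow> 'a::real_normed_vector \<Rightarrow>\<^sub>L real"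
  shows "uniform_limit I (\<lambda>n i. norm (g n i)) (\<lambda>_. 0) sequentially \<longleftrightarrow> (\<forall>A. bounded A \<longrightarrow>
    uniform_limit (I \<times> A) (\<lambda>n p. blinfun_apply (g n (fst p)) (snd p)) (\<lambda>_. 0) sequentially)"
proof
  assume U: "uniform_limit I (\<lambda>n i. norm (g n i)) (\<lambda>_. 0) sequentially"
  show "\<forall>A. bounded A \<longrightarrow> uniform_limit (I \<times> A) (\<lambda>n p. g n (fst p) (snd p)) (\<lambda>_. 0) sequentially"
    unfolding uniform_limit_iff
  proof (intro allI impI)
    fix A :: "'a set" and e :: real assume "bounded A" and e: "0 < e"
    then obtain b where b: "0 < b" "\<And>a. a \<in> A \<Longrightarrow> norm a \<le> b" unfolding bounded_pos by blast
    have "\<forall>\<^sub>F n in sequentially. \<forall>i\<in>I. dist (norm (g n i)) 0 < e / b"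
      using U divide_pos_pos[OF e b(1)] unfolding uniform_limit_iff by blast
    then show "\<forall>\<^sub>F n in sequentially. \<forall>p\<in>I \<times> A. dist (g n (fst p) (snd p)) 0 < e"
    proof (eventually_elim, clarify)
      fix n i a assume *: "\<forall>i\<in>I. dist (norm (g n i)) 0 < e / b" and "i \<in> I" "a \<in> A"
      have "\<bar>g n i a\<bar> \<le> norm (g n i) * norm a" using norm_blinfun[of "g n i" a] by simp
      also have "\<dots> \<le> norm (g n i) * b" using b(2)[OF \<open>a \<in> A\<close>] by (intro mult_left_mono) auto
      also have "\<dots> < e" using * \<open>i \<in> I\<close> b(1) by (simp add: field_simps)
      finally show "dist (g n (fst (i, a)) (snd (i, a))) 0 < e" by simp
    qed
  qed
next
  assume R: "\<forall>A. bounded A \<longrightarrow> uniform_limit (I \<times> A) (\<lambda>n p. g n (fst p) (snd p)) (\<lambda>_. 0) sequentially"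
  show "uniform_limit I (\<lambda>n i. norm (g n i)) (\<lambda>_. 0) sequentially"
    unfolding uniform_limit_iff
  proof (intro allI impI)
    fix e :: real assume e: "0 < e"
    have "\<forall>\<^sub>F n in sequentially. \<forall>p\<in>I \<times> cball 0 1. dist (g n (fst p) (snd p)) 0 < e / 2"
      using R[THEN spec, of "cball 0 1"] half_gt_zero[OF e] bounded_cball unfolding uniform_limit_iff by blast
    then show "\<forall>\<^sub>F n in sequentially. \<forall>i\<in>I. dist (norm (g n i)) 0 < e"
    proof (eventually_elim, intro ballI)
      fix n i assume *: "\<forall>p\<in>I \<times> cball 0 1. dist (g n (fst p) (snd p)) 0 < e / 2" and i: "i \<in> I"
      have "norm (g n i) \<le> e / 2"
        by (rule norm_blinfun_le) (use * i e in \<open>force+\<close>)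
      then show "dist (norm (g n i)) 0 < e" using e by simp
    qed
  qed
qed

lemma Mwc_iff_adjoint_Lwc:
  fixes \<T> :: "('e::banach_lattice \<Rightarrow>\<^sub>L 'y::banach) set"
  shows "\<T> \<in> Mwc \<longleftrightarrow> adjoint_op ` \<T> \<in> Lwc"
proof (cases "bounded \<T>")
  case True
  have "uniform_limit \<T> (\<lambda>n T. norm (blinfun_apply T (x n))) (\<lambda>_. 0) sequentially \<longleftrightarrow>
    (\<forall>A :: ('y \<Rightarrow>\<^sub>L real) set. bounded A \<longrightarrow> uniform_limit (\<T> \<times> A) (\<lambda>n p. blinfun_apply (snd p) (blinfun_apply (fst p) (x n))) (\<lambda>_. 0) sequentially)" for x
    using uniform_norm_blinfun_iff[where I = \<T> and g = "\<lambda>n T. blinfun_apply bidual (blinfun_apply T (x n))"] by (simp add: norm_bidual)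
  with True show ?thesis
    unfolding Mwc_iff Lwc_def by (auto simp: bounded_adjoint_op_image Lwc_set_op_image_adjoint_iff)
qed (simp add: Mwc_def Lwc_def bounded_adjoint_op_image)

lemma Lwc_iff_adjoint_Mwc:
  fixes \<T> :: "('x::banach \<Rightarrow>\<^sub>L 'f::banach_lattice) set"
  shows "\<T> \<in> Lwc \<longleftrightarrow> adjoint_op ` \<T> \<in> Mwc"
proof (cases "bounded \<T>")
  case True
  have "uniform_limit (adjoint_op ` \<T>) (\<lambda>n S. norm (blinfun_apply S (f n))) (\<lambda>_. 0) sequentially \<longleftrightarrow>
    (\<forall>A. bounded A \<longrightarrow> uniform_limit (\<T> \<times> A) (\<lambda>n p. f n (blinfun_apply (fst p) (snd p))) (\<lambda>_. 0) sequentially)"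
    for f :: "nat \<Rightarrow> 'f \<Rightarrow>\<^sub>L real"
    using uniform_norm_blinfun_iff[where I = \<T> and g = "\<lambda>n T. f n o\<^sub>L T"] by (simp add: uniform_limit_image adjoint_op_apply)
  with True show ?thesis
    unfolding Mwc_iff Lwc_def by (auto simp: bounded_adjoint_op_image Lwc_set_op_image_iff)
qed (simp add: Mwc_def Lwc_def bounded_adjoint_op_image)

text \<open>A failure provides \<open>r\<close> and \<open>p\<close> with
  \<open>\<bar>F (r n) (p n)\<bar>\<close> above a positive bound at every index, so any index
  sequence \<open>s\<close> along which the values tend to 0 refutes it.\<close>

lemma uniformly_nullI:
  fixes F :: "nat \<Rightarrow> 'i \<Rightarrow> real"
  assumes "\<And>r (p :: nat \<Rightarrow> 'i). strict_mono (r :: nat \<Rightarrow> nat) \<Longrightarrow> (\<And>n. p n \<in> I) \<Longrightarrow>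
    \<exists>s :: nat \<Rightarrow> nat. (\<lambda>n. F (r (s n)) (p (s n))) \<longlonglongrightarrow> 0"
  shows "uniform_limit I F (\<lambda>_. 0) sequentially"
proof (rule ccontr)
  assume "\<not> ?thesis"
  then obtain e r p where e: "0 < e" and r: "strict_mono (r :: nat \<Rightarrow> nat)" and p: "\<And>n. p n \<in> I"
    and big: "\<And>n. e \<le> \<bar>F (r n) (p n)\<bar>" by (rule not_uniformly_null_subseq) blast
  obtain s :: "nat \<Rightarrow> nat" where "(\<lambda>n. F (r (s n)) (p (s n))) \<longlonglongrightarrow> 0" using assms[of r p, OF r p] by blast
  then have "(\<lambda>n. \<bar>F (r (s n)) (p (s n))\<bar>) \<longlonglongrightarrow> 0" by (rule tendsto_rabs_zero)
  then have "e \<le> 0" by (rule LIMSEQ_le_const) (use big in auto)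
  then show False using e by simp
qed

lemma uniform_limit_LIMSEQ:
  fixes F :: "nat \<Rightarrow> 'i \<Rightarrow> real"
  assumes "uniform_limit I F (\<lambda>_. 0) sequentially" "\<And>n. p n \<in> I"
  shows "(\<lambda>n. F n (p n)) \<longlonglongrightarrow> 0"
  unfolding tendsto_iff
proof (intro allI impI)
  fix e :: real assume "0 < e"
  then have "\<forall>\<^sub>F n in sequentially. \<forall>i\<in>I. dist (F n i) 0 < e" using assms(1) unfolding uniform_limit_iff by blast
  then show "\<forall>\<^sub>F n in sequentially. dist (F n (p n)) 0 < e" by eventually_elim (use assms(2) in blast)
qed

lemma range_subseq_subset: "range x \<subseteq> B \<Longrightarrow> range (\<lambda>n. x (r n)) \<subseteq> B"
  by auto

lemma uniform_limit_Times_range: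
  fixes F :: "nat \<Rightarrow> 'i \<Rightarrow> 'j \<Rightarrow> real"
  assumes "uniform_limit (I \<times> range f) (\<lambda>n p. F n (fst p) (snd p)) (\<lambda>_. 0) sequentially"
  shows "uniform_limit I (\<lambda>n i. F n i (f n)) (\<lambda>_. 0) sequentially"
  using assms unfolding uniform_limit_iff by (force elim: eventually_mono)

text \<open>Here \<open>adm\<close> stands for relative weak compactness or order boundedness of sets, and \<open>P\<close> for
  weak convergence or order boundedness of sequences.\<close>

lemma adjoint_Lwc_set_iff_sequential:
  fixes \<T> :: "('e::banach_lattice \<Rightarrow>\<^sub>L 'y::banach) set" and adm :: "('y \<Rightarrow>\<^sub>L real) set \<Rightarrow> bool"
  assumes \<T>: "bounded \<T>"
    and bdd: "\<And>A. adm A \<Longrightarrow> bounded A"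
    and subseq: "\<And>A (f :: nat \<Rightarrow> _). adm A \<Longrightarrow> (\<And>n. f n \<in> A) \<Longrightarrow> \<exists>s :: nat \<Rightarrow> nat. strict_mono s \<and> P (\<lambda>n. f (s n))"
    and range: "\<And>f. P f \<Longrightarrow> adm (range f)"
  shows "(\<forall>A. adm A \<longrightarrow> Lwc_set (op_image (adjoint_op ` \<T>) A)) \<longleftrightarrow>
    (\<forall>(f :: nat \<Rightarrow> 'y \<Rightarrow>\<^sub>L real) x. P f \<longrightarrow> disjoint_seq x \<longrightarrow> range x \<subseteq> cball 0 1 \<longrightarrow>
      uniform_limit \<T> (\<lambda>n T. blinfun_apply (f n) (blinfun_apply T (x n))) (\<lambda>_. 0) sequentially)" (is "?L \<longleftrightarrow> ?R")
proof
  assume L: ?L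
  show ?R
  proof (intro allI impI)
    fix f :: "nat \<Rightarrow> 'y \<Rightarrow>\<^sub>L real" and x :: "nat \<Rightarrow> 'e"
    assume f: "P f" and x: "disjoint_seq x" "range x \<subseteq> cball 0 1"
    have "Lwc_set (op_image (adjoint_op ` \<T>) (range f))" using L range[OF f] by blast
    from Lwc_set_op_image_adjoint_iff[THEN iffD1, rule_format, OF \<T> bdd[OF range[OF f]] this x]
    have "uniform_limit (\<T> \<times> range f) (\<lambda>n p. blinfun_apply (snd p) (blinfun_apply (fst p) (x n))) (\<lambda>_. 0) sequentially" .
    then show "uniform_limit \<T> (\<lambda>n T. blinfun_apply (f n) (blinfun_apply T (x n))) (\<lambda>_. 0) sequentially"
      by (rule uniform_limit_Times_range)
  qed
next
  assume R: ?R
  show ?L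
  proof (intro allI impI)
    fix A assume A: "adm A"
    show "Lwc_set (op_image (adjoint_op ` \<T>) A)"
      unfolding Lwc_set_op_image_adjoint_iff[OF \<T> bdd[OF A]]
    proof (intro allI impI, rule uniformly_nullI)
      fix x :: "nat \<Rightarrow> 'e" and r :: "nat \<Rightarrow> nat" and p :: "nat \<Rightarrow> _"
      assume x: "disjoint_seq x" "range x \<subseteq> cball 0 1" and r: "strict_mono r" and p: "\<And>n. p n \<in> \<T> \<times> A"
      obtain s where s: "strict_mono s" "P (\<lambda>n. snd (p (s n)))"
        using subseq[OF A, of "\<lambda>n. snd (p n)"] p by (auto simp: mem_Times_iff)
      \<comment> \<open>The disjoint sequence is thinned by \<open>r\<close> and then by
        \<open>s\<close>, so that its terms keep their partners among the selected
        functionals.\<close>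
      have "uniform_limit \<T> (\<lambda>n T. snd (p (s n)) (blinfun_apply T (x (r (s n))))) (\<lambda>_. 0) sequentially"
        by (rule R[rule_format, OF s(2) disjoint_seq_subseq[OF disjoint_seq_subseq[OF x(1) r] s(1)] range_subseq_subset[OF x(2)]])
      from uniform_limit_LIMSEQ[OF this, of "\<lambda>n. fst (p (s n))"]
      show "\<exists>s. (\<lambda>n. (snd (p (s n))) (fst (p (s n)) (x (r (s n))))) \<longlonglongrightarrow> 0"
        using p by (auto simp: mem_Times_iff)
    qed
  qed
qed

text \<open>Elements of \<open>A\<close> are read as functionals on \<open>X'\<close>: the value of
  \<open>bidual a\<close> at \<open>adjoint_op T f\<close> is \<open>f (T a)\<close>. This is how a
  condition on the adjoints, stated for sequences in the bidual, reaches
  \<open>\<T>\<close>.\<close>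

lemma Lwc_set_if_sequential:
  fixes \<T> :: "('x::banach \<Rightarrow>\<^sub>L 'f::banach_lattice) set"
  assumes \<T>: "bounded \<T>" and A: "bounded A"
    and subseq: "\<And>a :: nat \<Rightarrow> 'x. (\<And>n. a n \<in> A) \<Longrightarrow> \<exists>s :: nat \<Rightarrow> nat. strict_mono s \<and> P (\<lambda>n. blinfun_apply bidual (a (s n)))"
    and null: "\<And>(F :: nat \<Rightarrow> ('x \<Rightarrow>\<^sub>L real) \<Rightarrow>\<^sub>L real) f. P F \<Longrightarrow> disjoint_seq f \<Longrightarrow> range f \<subseteq> cball 0 1 \<Longrightarrow>
      uniform_limit (adjoint_op ` \<T>) (\<lambda>n S. F n (blinfun_apply S (f n))) (\<lambda>_. 0) sequentially"
  shows "Lwc_set (op_image \<T> A)"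
  unfolding Lwc_set_op_image_iff[OF \<T> A]
proof (intro allI impI, rule uniformly_nullI)
  fix f :: "nat \<Rightarrow> 'f \<Rightarrow>\<^sub>L real" and r :: "nat \<Rightarrow> nat" and p :: "nat \<Rightarrow> _"
  assume f: "disjoint_seq f" "range f \<subseteq> cball 0 1" and r: "strict_mono r" and p: "\<And>n. p n \<in> \<T> \<times> A"
  obtain s where s: "strict_mono s" "P (\<lambda>n. blinfun_apply bidual (snd (p (s n))))"
    using subseq[of "\<lambda>n. snd (p n)"] p by (auto simp: mem_Times_iff)
  have "uniform_limit (adjoint_op ` \<T>) (\<lambda>n S. blinfun_apply bidual (snd (p (s n))) (blinfun_apply S (f (r (s n))))) (\<lambda>_. 0) sequentially"
    by (rule null[OF s(2) disjoint_seq_subseq[OF disjoint_seq_subseq[OF f(1) r] s(1)] range_subseq_subset[OF f(2)]])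
  from uniform_limit_LIMSEQ[OF this, of "\<lambda>n. adjoint_op (fst (p (s n)))"]
  show "\<exists>s. (\<lambda>n. (f (r (s n))) (fst (p (s n)) (snd (p (s n))))) \<longlonglongrightarrow> 0"
    using p by (auto simp: mem_Times_iff adjoint_op_apply)
qed

section \<open>Dualities for weakly compact, order bounded and limited test sets\<close>

lemma a_Mwc_iff_adjoint_a_Lwc:
  fixes \<T> :: "('e::banach_lattice \<Rightarrow>\<^sub>L 'y::banach) set"
  shows "\<T> \<in> a_Mwc \<longleftrightarrow> adjoint_op ` \<T> \<in> a_Lwc"
proof (cases "bounded \<T>")
  case True
  have "\<exists>s :: nat \<Rightarrow> nat. strict_mono s \<and> weakly_convergent (\<lambda>n. f (s n))"
    if A: "relatively_weakly_compact A" and f: "\<And>n. f n \<in> A" for A and f :: "nat \<Rightarrow> 'y \<Rightarrow>\<^sub>L real"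
    using eberlein[of A f, OF A f] unfolding o_def by metis
  from adjoint_Lwc_set_iff_sequential[where P = weakly_convergent and adm = relatively_weakly_compact,
      OF True relatively_weakly_compact_imp_bounded this weakly_convergent_imp_relatively_weakly_compact]
  show ?thesis using True by (simp add: a_Mwc_iff a_Lwc_def bounded_adjoint_op_image)
qed (simp add: a_Mwc_def a_Lwc_def bounded_adjoint_op_image)

lemma o_Mwc_iff_adjoint_o_Lwc:
  fixes \<T> :: "('e::banach_lattice \<Rightarrow>\<^sub>L 'f::banach_lattice) set"
  shows "\<T> \<in> o_Mwc \<longleftrightarrow> adjoint_op ` \<T> \<in> o_Lwc"
proof (cases "bounded \<T>")
  case True
  have "\<exists>s :: nat \<Rightarrow> nat. strict_mono s \<and> order_bounded (range (\<lambda>n. f (s n)))"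
    if A: "order_bounded A" and f: "\<And>n. f n \<in> A" for A and f :: "nat \<Rightarrow> 'f \<Rightarrow>\<^sub>L real"
  proof -
    obtain a b where "A \<subseteq> {a..b}" using A by (auto simp: order_bounded_def)
    then have "range f \<subseteq> {a..b}" using f by blast
    then have "order_bounded (range f)" unfolding order_bounded_def by blast
    then show ?thesis by (intro exI[of _ "\<lambda>n. n"]) (simp add: strict_mono_def)
  qed
  from adjoint_Lwc_set_iff_sequential[where P = "\<lambda>f. order_bounded (range f)" and adm = order_bounded,
      OF True order_bounded_imp_bounded this]
  show ?thesis using True by (simp add: o_Mwc_iff o_Lwc_def bounded_adjoint_op_image)
qed (simp add: o_Mwc_def o_Lwc_def bounded_adjoint_op_image)

lemma adjoint_a_Mwc_imp_a_Lwc: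
  fixes \<T> :: "('x::banach \<Rightarrow>\<^sub>L 'f::banach_lattice) set"
  assumes "adjoint_op ` \<T> \<in> a_Mwc"
  shows "\<T> \<in> a_Lwc"
  unfolding a_Lwc_def
proof (intro CollectI conjI allI impI)
  show \<T>: "bounded \<T>" using assms by (simp add: a_Mwc_def bounded_adjoint_op_image)
  fix A :: "'x set" assume A: "relatively_weakly_compact A"
  show "Lwc_set (op_image \<T> A)"
  proof (rule Lwc_set_if_sequential[OF \<T> relatively_weakly_compact_imp_bounded[OF A], where P = weakly_convergent])
    show "\<exists>s :: nat \<Rightarrow> nat. strict_mono s \<and> weakly_convergent (\<lambda>n. blinfun_apply bidual (a (s n)))"
      if a: "\<And>n. a n \<in> A" for a :: "nat \<Rightarrow> 'x"
    proof -
      obtain s where s: "strict_mono s" "weakly_convergent (a \<circ> s)" using eberlein[of A a, OF A a] by blast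
      from weakly_convergent_blinfun[OF s(2), of bidual] s(1) show ?thesis by (auto simp: o_def)
    qed
  qed (use assms in \<open>auto simp: a_Mwc_iff\<close>)
qed

lemma adjoint_o_Mwc_imp_o_Lwc:
  fixes \<T> :: "('e::banach_lattice \<Rightarrow>\<^sub>L 'f::banach_lattice) set"
  assumes "adjoint_op ` \<T> \<in> o_Mwc"
  shows "\<T> \<in> o_Lwc"
  unfolding o_Lwc_def
proof (intro CollectI conjI allI impI)
  show \<T>: "bounded \<T>" using assms by (simp add: o_Mwc_def bounded_adjoint_op_image)
  fix A :: "'e set" assume A: "order_bounded A"
  show "Lwc_set (op_image \<T> A)"
  proof (rule Lwc_set_if_sequential[OF \<T> order_bounded_imp_bounded[OF A], where P = "\<lambda>f. order_bounded (range f)"])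
    fix a :: "nat \<Rightarrow> 'e" assume a: "\<And>n. a n \<in> A"
    obtain l u where lu: "A \<subseteq> {l..u}" using A by (auto simp: order_bounded_def)
    have "blinfun_apply bidual (a n) \<in> {blinfun_apply bidual l..blinfun_apply bidual u}" for n
    proof -
      have "a n \<in> {l..u}" using a[of n] lu by blast
      then have "l \<le> a n" "a n \<le> u" by auto
      \<comment> \<open>The embedding into the bidual is positive, because order in the bidual is
        tested on positive functionals; so it preserves order intervals.\<close>
      then show ?thesis by (simp add: less_eq_blinfun_def[where 'a = "'e \<Rightarrow>\<^sub>L real"] blinfun_mono)
    qed
    then have "order_bounded (range (\<lambda>n. blinfun_apply bidual (a n)))"
      unfolding order_bounded_def by blast
    then show "\<exists>s :: nat \<Rightarrow> nat. strict_mono s \<and> order_bounded (range (\<lambda>n. blinfun_apply bidual (a (s n))))"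
      by (intro exI[of _ "\<lambda>n. n"]) (simp add: strict_mono_def)
  qed (use assms in \<open>auto simp: o_Mwc_iff\<close>)
qed

lemma l_Mwc_iff_adjoint_l_Lwc:
  fixes \<T> :: "('e::banach_lattice \<Rightarrow>\<^sub>L 'y::banach) set"
  shows "\<T> \<in> l_Mwc \<longleftrightarrow> adjoint_op ` \<T> \<in> l_Lwc"
proof (cases "bounded \<T>")
  case True
  show ?thesis
  proof
    assume M: "\<T> \<in> l_Mwc"
    have "Lwc_set (op_image (adjoint_op ` \<T>) A)" if A: "limited_set A" for A
      unfolding Lwc_set_op_image_adjoint_iff[OF True limited_set_imp_bounded[OF A]]
    proof (intro allI impI, rule uniformly_nullI)
      fix x :: "nat \<Rightarrow> 'e" and r :: "nat \<Rightarrow> nat" and p :: "nat \<Rightarrow> _"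
      assume x: "disjoint_seq x" "range x \<subseteq> cball 0 1" and r: "strict_mono r" and p: "\<And>n. p n \<in> \<T> \<times> A"
      \<comment> \<open>Limited sets are defined by testing against weak* null sequences, so here
        the images of the \<open>x (r n)\<close> become the test sequence and no subsequence is
        extracted from \<open>A\<close>.\<close>
      define w where "w n = blinfun_apply bidual (fst (p n) (x (r n)))" for n
      have "weak_star_null w"
        unfolding weak_star_null_def
      proof
        fix f :: "'y \<Rightarrow>\<^sub>L real"
        have "uniform_limit \<T> (\<lambda>n T. f (blinfun_apply T (x (r n)))) (\<lambda>_. 0) sequentially"
          by (rule M[unfolded l_Mwc_iff, THEN conjunct2, rule_format,
              OF disjoint_seq_subseq[OF x(1) r] range_subseq_subset[OF x(2)]])
        from uniform_limit_LIMSEQ[OF this, of "\<lambda>n. fst (p n)"] show "(\<lambda>n. w n f) \<longlonglongrightarrow> 0"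
          using p by (simp add: w_def mem_Times_iff)
      qed
      then have "uniform_limit A (\<lambda>n f. blinfun_apply (w n) f) (\<lambda>_. 0) sequentially"
        using A by (simp add: limited_set_def)
      from uniform_limit_LIMSEQ[OF this, of "\<lambda>n. snd (p n)"]
      show "\<exists>s. (\<lambda>n. (snd (p (s n))) (fst (p (s n)) (x (r (s n))))) \<longlonglongrightarrow> 0"
        using p by (intro exI[of _ id]) (simp add: w_def mem_Times_iff)
    qed
    with True show "adjoint_op ` \<T> \<in> l_Lwc" by (simp add: l_Lwc_def bounded_adjoint_op_image)
  next
    assume L: "adjoint_op ` \<T> \<in> l_Lwc"
    \<comment> \<open>A single functional forms a limited set, which is why the condition with one
      fixed \<open>f\<close> is enough to match all limited sets.\<close>
    have "uniform_limit \<T> (\<lambda>n T. blinfun_apply f (blinfun_apply T (x n))) (\<lambda>_. 0) sequentially"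
      if x: "disjoint_seq x" "range x \<subseteq> cball 0 1" for f :: "'y \<Rightarrow>\<^sub>L real" and x
    proof -
      have "Lwc_set (op_image (adjoint_op ` \<T>) {f})" using L limited_set_singleton by (auto simp: l_Lwc_def)
      from Lwc_set_op_image_adjoint_iff[THEN iffD1, rule_format,
          OF True limited_set_imp_bounded[OF limited_set_singleton] this x]
      show ?thesis by (simp add: uniform_limit_iff)
    qed
    with True show "\<T> \<in> l_Mwc" by (simp add: l_Mwc_iff)
  qed
qed (simp add: l_Mwc_def l_Lwc_def bounded_adjoint_op_image)

lemma adjoint_l_Mwc_imp_l_Lwc:
  fixes \<T> :: "('x::banach \<Rightarrow>\<^sub>L 'f::banach_lattice) set"
  assumes M: "adjoint_op ` \<T> \<in> l_Mwc"
  shows "\<T> \<in> l_Lwc"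
  unfolding l_Lwc_def
proof (intro CollectI conjI allI impI)
  show \<T>: "bounded \<T>" using assms by (simp add: l_Mwc_def bounded_adjoint_op_image)
  fix A :: "'x set" assume A: "limited_set A"
  show "Lwc_set (op_image \<T> A)"
    unfolding Lwc_set_op_image_iff[OF \<T> limited_set_imp_bounded[OF A]]
  proof (intro allI impI, rule uniformly_nullI)
    fix f :: "nat \<Rightarrow> 'f \<Rightarrow>\<^sub>L real" and r :: "nat \<Rightarrow> nat" and p :: "nat \<Rightarrow> _"
    assume f: "disjoint_seq f" "range f \<subseteq> cball 0 1" and r: "strict_mono r" and p: "\<And>n. p n \<in> \<T> \<times> A"
    \<comment> \<open>At \<open>x\<close> this sequence has the values of \<open>bidual x\<close> on
      the adjoints applied to \<open>f (r n)\<close>; the hypothesis for the single functional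
      \<open>bidual x\<close> makes it weak* null.\<close>
    define w where "w n = f (r n) o\<^sub>L fst (p n)" for n
    have "weak_star_null w"
      unfolding weak_star_null_def
    proof
      fix x :: 'x
      have "uniform_limit (adjoint_op ` \<T>) (\<lambda>n S. blinfun_apply bidual x (blinfun_apply S (f (r n)))) (\<lambda>_. 0) sequentially"
        by (rule M[unfolded l_Mwc_iff, THEN conjunct2, rule_format,
            OF disjoint_seq_subseq[OF f(1) r] range_subseq_subset[OF f(2)]])
      from uniform_limit_LIMSEQ[OF this, of "\<lambda>n. adjoint_op (fst (p n))"] show "(\<lambda>n. w n x) \<longlonglongrightarrow> 0"
        using p by (simp add: w_def mem_Times_iff adjoint_op_apply)
    qed
    then have "uniform_limit A (\<lambda>n a. blinfun_apply (w n) a) (\<lambda>_. 0) sequentially"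
      using A by (simp add: limited_set_def)
    from uniform_limit_LIMSEQ[OF this, of "\<lambda>n. snd (p n)"]
    show "\<exists>s. (\<lambda>n. (f (r (s n))) (fst (p (s n)) (snd (p (s n))))) \<longlonglongrightarrow> 0"
      using p by (intro exI[of _ id]) (simp add: w_def mem_Times_iff)
  qed
qed

theorem theorem4:
  shows
   "(\<forall>\<T> :: ('e::banach_lattice \<Rightarrow>\<^sub>L 'y::banach) set. \<T> \<in> Mwc \<longleftrightarrow> adjoint_op ` \<T> \<in> Lwc) \<and>
    (\<forall>\<T> :: ('x::banach \<Rightarrow>\<^sub>L 'f::banach_lattice) set. \<T> \<in> Lwc \<longleftrightarrow> adjoint_op ` \<T> \<in> Mwc) \<and>
    (\<forall>\<T> :: ('e \<Rightarrow>\<^sub>L 'y) set. \<T> \<in> a_Mwc \<longleftrightarrow> adjoint_op ` \<T> \<in> a_Lwc) \<and>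
    (\<forall>\<T> :: ('x \<Rightarrow>\<^sub>L 'f) set. adjoint_op ` \<T> \<in> a_Mwc \<longrightarrow> \<T> \<in> a_Lwc) \<and>
    (\<forall>\<T> :: ('e \<Rightarrow>\<^sub>L 'y) set. \<T> \<in> l_Mwc \<longleftrightarrow> adjoint_op ` \<T> \<in> l_Lwc) \<and>
    (\<forall>\<T> :: ('x \<Rightarrow>\<^sub>L 'f) set. adjoint_op ` \<T> \<in> l_Mwc \<longrightarrow> \<T> \<in> l_Lwc) \<and>
    (\<forall>\<T> :: ('e \<Rightarrow>\<^sub>L 'f) set. \<T> \<in> o_Mwc \<longleftrightarrow> adjoint_op ` \<T> \<in> o_Lwc) \<and>
    (\<forall>\<T> :: ('e \<Rightarrow>\<^sub>L 'f) set. adjoint_op ` \<T> \<in> o_Mwc \<longrightarrow> \<T> \<in> o_Lwc)"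
  by (intro conjI allI impI Mwc_iff_adjoint_Lwc Lwc_iff_adjoint_Mwc a_Mwc_iff_adjoint_a_Lwc
      adjoint_a_Mwc_imp_a_Lwc l_Mwc_iff_adjoint_l_Lwc adjoint_l_Mwc_imp_l_Lwc
      o_Mwc_iff_adjoint_o_Lwc adjoint_o_Mwc_imp_o_Lwc)

end
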